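(* Let $G$ be a standard reductive group over $\Bbbk$, let $\mathfrak h$ be the Lie algebra of a maximal torus of $G$, and let $m>0$. Let $\lambda\in\mathfrak h^*$ satisfy $\lambda(h)^p=\lambda(h^{[p]})$ for all $h\in\mathfrak h$, let $\Bbbk_\lambda$ be the one-dimensional $U_0(\mathfrak h_m)$-module on which $\mathfrak h=\mathfrak h t^0$ acts by $\lambda$ and $\bigoplus_{i\ge1}\mathfrak ht^i$ acts by $0$, and let $Q^{\mathfrak h_m}(\lambda)$ be its projective cover as a $U_0(\mathfrak h_m)$-module. Then the only composition factor of $Q^{\mathfrak h_m}(\lambda)$ is $\Bbbk_\lambda$, which occurs with multiplicity $p^{m\dim(\mathfrak h)}$.
   Context: $\Bbbk$ is an algebraically closed field of characteristic $p>0$. A standard reductive group $G$ is a connected reductive algebraic group over $\Bbbk$ such that (H1) the derived subgroup of $G$ is simply connected, (H2) $p$ is good for the root system of $G$, (H3) there is a non-degenerate $G$-invariant bilinear form on $\mathfrak g=\operatorname{Lie}(G)$. $\mathfrak h_m=\mathfrak h\otimes\Bbbk[t]/(t^{m+1})$ is an abelian restricted Lie algebra over $\Bbbk$ with $p$-map determined by $(ht^i)^{[p]}=h^{[p]}t^{pi}$, where $ht^i:=h\otimes t^i$. $U_0(\mathfrak h_m)$ is the restricted enveloping algebra, the quotient of $U(\mathfrak h_m)$ by the ideal generated by $x^p-x^{[p]}$, $x\in\mathfrak h_m$. *)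

theory Defs
  imports
    "HOL-Algebra.Generated_Groups"
    "HOL-Algebra.QuotRing"
    "Jordan_Normal_Form.VS_Connect"
begin

section \<open>Linear algebraic groups over an algebraically closed field\<close>

text \<open>
  An affine algebraic group is represented, as in the classical theory, by a Zariski closed
  subgroup of some \<open>GL n\<close>, that is, by a set of \<open>n \<times> n\<close> matrices.  The size \<open>n\<close> is always passed
  explicitly.
\<close>

definition GL :: "nat \<Rightarrow> 'k::field mat monoid" where
  "GL n = units_of (ring_mat TYPE('k) n ())"

inductive_set polyfun :: "nat \<Rightarrow> ('k::field mat \<Rightarrow> 'k) set" for n :: nat where
  const: "(\<lambda>_. c) \<in> polyfun n"
| coord: "i < n \<Longrightarrow> j < n \<Longrightarrow> (\<lambda>A. A $$ (i, j)) \<in> polyfun n"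
| add: "f \<in> polyfun n \<Longrightarrow> g \<in> polyfun n \<Longrightarrow> (\<lambda>A. f A + g A) \<in> polyfun n"
| mult: "f \<in> polyfun n \<Longrightarrow> g \<in> polyfun n \<Longrightarrow> (\<lambda>A. f A * g A) \<in> polyfun n"

definition zariski_closed :: "nat \<Rightarrow> 'k::field mat set \<Rightarrow> bool" where
  "zariski_closed n Z \<longleftrightarrow>
     (\<exists>S \<subseteq> polyfun n. Z = {g \<in> carrier (GL n). \<forall>f\<in>S. f g = 0})"

definition algebraic_group :: "nat \<Rightarrow> 'k::field mat set \<Rightarrow> bool" where
  "algebraic_group n G \<longleftrightarrow> subgroup G (GL n) \<and> zariski_closed n G"

definition zariski_connected :: "nat \<Rightarrow> 'k::field mat set \<Rightarrow> bool" where
  "zariski_connected n Z \<longleftrightarrow>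
     (\<forall>A B. zariski_closed n A \<and> zariski_closed n B \<and> A \<union> B = Z \<and> A \<inter> B = {} \<longrightarrow> A = {} \<or> B = {})"

text \<open>The coordinate ring of \<open>GL n\<close> is generated by the matrix entries and \<open>1 / det\<close>.\<close>

definition regular_fun :: "nat \<Rightarrow> 'k::field mat set \<Rightarrow> ('k mat \<Rightarrow> 'k) \<Rightarrow> bool" where
  "regular_fun n H f \<longleftrightarrow> (\<exists>q\<in>polyfun n. \<exists>e::nat. \<forall>g\<in>H. f g = q g / det g ^ e)"

definition alg_hom ::
  "nat \<Rightarrow> 'k::field mat set \<Rightarrow> nat \<Rightarrow> 'k mat set \<Rightarrow> ('k mat \<Rightarrow> 'k mat) \<Rightarrow> bool" where
  "alg_hom n H r K \<phi> \<longleftrightarrow>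
     \<phi> \<in> hom (GL n\<lparr>carrier := H\<rparr>) (GL r\<lparr>carrier := K\<rparr>) \<and>
     (\<forall>i<r. \<forall>j<r. regular_fun n H (\<lambda>g. \<phi> g $$ (i, j)))"

definition alg_iso :: "nat \<Rightarrow> 'k::field mat set \<Rightarrow> nat \<Rightarrow> 'k mat set \<Rightarrow> bool" where
  "alg_iso n H r K \<longleftrightarrow>
     (\<exists>\<phi> \<psi>. alg_hom n H r K \<phi> \<and> alg_hom r K n H \<psi> \<and>
        (\<forall>h\<in>H. \<psi> (\<phi> h) = h) \<and> (\<forall>k\<in>K. \<phi> (\<psi> k) = k))"

definition diag_group :: "nat \<Rightarrow> 'k::field mat set" where
  "diag_group r = {A \<in> carrier (GL r). diagonal_mat A}"

definition torus :: "nat \<Rightarrow> 'k::field mat set \<Rightarrow> bool" where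
  "torus n T \<longleftrightarrow> algebraic_group n T \<and> (\<exists>r. alg_iso n T r (diag_group r))"

definition maximal_torus :: "nat \<Rightarrow> 'k::field mat set \<Rightarrow> 'k mat set \<Rightarrow> bool" where
  "maximal_torus n G T \<longleftrightarrow>
     torus n T \<and> T \<subseteq> G \<and> (\<forall>T'. torus n T' \<and> T \<subseteq> T' \<and> T' \<subseteq> G \<longrightarrow> T' = T)"

definition unipotent_group :: "nat \<Rightarrow> 'k::field mat set \<Rightarrow> bool" where
  "unipotent_group n U \<longleftrightarrow> (\<forall>u\<in>U. \<exists>e::nat. (u - 1\<^sub>m n) ^\<^sub>m e = 0\<^sub>m n n)"

definition connected_reductive :: "nat \<Rightarrow> 'k::field mat set \<Rightarrow> bool" where
  "connected_reductive n G \<longleftrightarrow>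
     algebraic_group n G \<and> zariski_connected n G \<and>
     (\<forall>U. algebraic_group n U \<and> zariski_connected n U \<and> normal U (GL n\<lparr>carrier := G\<rparr>) \<and>
          unipotent_group n U \<longrightarrow> U = {1\<^sub>m n})"

section \<open>Lie algebras\<close>

text \<open>
  Tangent space at the identity: \<open>X\<close> is tangent iff every polynomial function \<open>f\<close> vanishing on \<open>G\<close>
  has zero derivative at the identity in direction \<open>X\<close>, i.e. the coefficient of \<open>t\<close> in the polynomial
  \<open>f (1 + t X)\<close> vanishes.  That polynomial is determined by its values because the field is infinite.
\<close>

definition tangent_space :: "nat \<Rightarrow> 'k::field mat set \<Rightarrow> 'k mat set" where
  "tangent_space n G = {X \<in> carrier_mat n n.
     \<forall>f\<in>polyfun n. (\<forall>g\<in>G. f g = 0) \<longrightarrow>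
       (\<forall>q. (\<forall>t. poly q t = f (1\<^sub>m n + t \<cdot>\<^sub>m X)) \<longrightarrow> coeff q 1 = 0)}"

text \<open>The fields \<open>mult\<close> and \<open>one\<close> inherited from the record of modules carry no meaning.\<close>

record ('k, 'l) restricted_lie = "('k, 'l) module" +
  lie_bracket :: "'l \<Rightarrow> 'l \<Rightarrow> 'l"
  p_map :: "'l \<Rightarrow> 'l"

definition lie_algebra :: "nat \<Rightarrow> nat \<Rightarrow> 'k::field mat set \<Rightarrow> ('k, 'k mat) restricted_lie" where
  "lie_algebra p n G = \<lparr>carrier = tangent_space n G, mult = undefined, one = undefined,
     zero = 0\<^sub>m n n, add = (+), smult = (\<cdot>\<^sub>m),
     lie_bracket = (\<lambda>X Y. X * Y - Y * X), p_map = (\<lambda>X. X ^\<^sub>m p)\<rparr>"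

text \<open>
  \<open>L \<otimes> k[t]/(t^(m+1))\<close>, an element \<open>\<Sum>i\<le>m. x i \<otimes> t^i\<close> being encoded by its coefficient function.
  The \<open>p\<close>-map is the \<open>p\<close>-semilinear one with \<open>(x t^i)^[p] = x^[p] t^(p i)\<close>; it is the right one when
  \<open>L\<close> is abelian, which is the only case in which this definition is used.
\<close>

definition current_lie :: "nat \<Rightarrow> nat \<Rightarrow> ('k, 'l) restricted_lie \<Rightarrow> ('k, nat \<Rightarrow> 'l) restricted_lie" where
  "current_lie p m L = \<lparr>
     carrier = {x. (\<forall>i\<le>m. x i \<in> carrier L) \<and> (\<forall>i>m. x i = \<zero>\<^bsub>L\<^esub>)},
     mult = undefined, one = undefined,
     zero = (\<lambda>i. \<zero>\<^bsub>L\<^esub>), add = (\<lambda>x y i. x i \<oplus>\<^bsub>L\<^esub> y i),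
     smult = (\<lambda>c x i. c \<odot>\<^bsub>L\<^esub> x i),
     lie_bracket = (\<lambda>x y k.
       if k \<le> m then \<Oplus>\<^bsub>L\<^esub>i\<in>{..k}. lie_bracket L (x i) (y (k - i)) else \<zero>\<^bsub>L\<^esub>),
     p_map = (\<lambda>x j. if j \<le> m \<and> p dvd j then p_map L (x (j div p)) else \<zero>\<^bsub>L\<^esub>)\<rparr>"

definition t_power :: "('k, 'l) restricted_lie \<Rightarrow> 'l \<Rightarrow> nat \<Rightarrow> (nat \<Rightarrow> 'l)" where
  "t_power L h i = (\<lambda>j. if j = i then h else \<zero>\<^bsub>L\<^esub>)"

section \<open>Roots, good primes, simply connected semisimple groups\<close>

text \<open>Characters and cocharacters are extensional functions, so that they form groups.\<close>

definition characters :: "nat \<Rightarrow> 'k::field mat set \<Rightarrow> ('k mat \<Rightarrow> 'k) set" where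
  "characters n T = {\<chi> \<in> extensional T. regular_fun n T \<chi> \<and> (\<forall>s\<in>T. \<chi> s \<noteq> 0) \<and>
     (\<forall>s\<in>T. \<forall>t\<in>T. \<chi> (s * t) = \<chi> s * \<chi> t)}"

text \<open>Regular functions on the multiplicative group are the Laurent polynomials \<open>poly q a / a ^ e\<close>.\<close>

definition cocharacters :: "nat \<Rightarrow> 'k::field mat set \<Rightarrow> ('k \<Rightarrow> 'k mat) set" where
  "cocharacters n T = {\<gamma> \<in> extensional (- {0}). (\<forall>a. a \<noteq> 0 \<longrightarrow> \<gamma> a \<in> T) \<and>
     (\<forall>a b. a \<noteq> 0 \<and> b \<noteq> 0 \<longrightarrow> \<gamma> (a * b) = \<gamma> a * \<gamma> b) \<and>
     (\<forall>i<n. \<forall>j<n. \<exists>q. \<exists>e::nat. \<forall>a. a \<noteq> 0 \<longrightarrow> \<gamma> a $$ (i, j) = poly q a / a ^ e)}"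

definition cochar_group :: "nat \<Rightarrow> 'k::field mat set \<Rightarrow> ('k \<Rightarrow> 'k mat) monoid" where
  "cochar_group n T = \<lparr>carrier = cocharacters n T,
     mult = (\<lambda>\<gamma> \<delta>. \<lambda>a\<in>- {0}. \<gamma> a * \<delta> a), one = (\<lambda>a\<in>- {0}. 1\<^sub>m n)\<rparr>"

definition pairing :: "('k::field mat \<Rightarrow> 'k) \<Rightarrow> ('k \<Rightarrow> 'k mat) \<Rightarrow> int" where
  "pairing \<chi> \<gamma> = (THE z. \<forall>a. a \<noteq> 0 \<longrightarrow> \<chi> (\<gamma> a) = a powi z)"

definition roots :: "nat \<Rightarrow> 'k::field mat set \<Rightarrow> 'k mat set \<Rightarrow> ('k mat \<Rightarrow> 'k) set" where
  "roots n G T = {\<alpha> \<in> characters n T. \<alpha> \<noteq> (\<lambda>t\<in>T. 1) \<and>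
     (\<exists>X\<in>tangent_space n G. X \<noteq> 0\<^sub>m n n \<and>
        (\<forall>t\<in>T. t * X * inv\<^bsub>GL n\<^esub> t = \<alpha> t \<cdot>\<^sub>m X))}"

text \<open>
  For a semisimple group the roots span the rational character space, so the coroot of \<open>\<alpha>\<close> is the
  unique cocharacter whose associated reflection sends \<open>\<alpha>\<close> to its inverse and preserves the roots.
\<close>

definition is_coroot ::
  "nat \<Rightarrow> 'k::field mat set \<Rightarrow> 'k mat set \<Rightarrow> ('k mat \<Rightarrow> 'k) \<Rightarrow> ('k \<Rightarrow> 'k mat) \<Rightarrow> bool" where
  "is_coroot n S T \<alpha> \<delta> \<longleftrightarrow> \<delta> \<in> cocharacters n T \<and> pairing \<alpha> \<delta> = 2 \<and>
     (\<forall>\<beta>\<in>roots n S T. (\<lambda>t\<in>T. \<beta> t * \<alpha> t powi (- pairing \<beta> \<delta>)) \<in> roots n S T)"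

text \<open>A semisimple group is simply connected iff its coroots generate its cocharacter lattice.\<close>

definition semisimple_simply_connected :: "nat \<Rightarrow> 'k::field mat set \<Rightarrow> bool" where
  "semisimple_simply_connected n S \<longleftrightarrow>
     (\<forall>T. maximal_torus n S T \<longrightarrow>
        generate (cochar_group n T) {\<delta>. \<exists>\<alpha>\<in>roots n S T. is_coroot n S T \<alpha> \<delta>} = cocharacters n T)"

text \<open>The integral linear combination \<open>\<Sum>\<alpha>\<in>\<Delta>. c \<alpha> \<cdot> \<alpha>\<close> in the (multiplicative) character group.\<close>

definition char_comb ::
  "'k::field mat set \<Rightarrow> ('k mat \<Rightarrow> 'k) set \<Rightarrow> (('k mat \<Rightarrow> 'k) \<Rightarrow> int) \<Rightarrow> ('k mat \<Rightarrow> 'k)" where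
  "char_comb T \<Delta> c = (\<lambda>t\<in>T. \<Prod>\<alpha>\<in>\<Delta>. \<alpha> t powi c \<alpha>)"

definition root_base :: "nat \<Rightarrow> 'k::field mat set \<Rightarrow> 'k mat set \<Rightarrow> ('k mat \<Rightarrow> 'k) set \<Rightarrow> bool" where
  "root_base n G T \<Delta> \<longleftrightarrow> \<Delta> \<subseteq> roots n G T \<and>
     (\<forall>c. char_comb T \<Delta> c = (\<lambda>t\<in>T. 1) \<longrightarrow> (\<forall>\<alpha>\<in>\<Delta>. c \<alpha> = 0)) \<and>
     (\<forall>\<beta>\<in>roots n G T. \<exists>c. \<beta> = char_comb T \<Delta> c \<and>
        ((\<forall>\<alpha>\<in>\<Delta>. c \<alpha> \<ge> 0) \<or> (\<forall>\<alpha>\<in>\<Delta>. c \<alpha> \<le> 0)))"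

text \<open>
  The maximal roots for the order given by a base are the highest roots of the irreducible
  components of the root system.
\<close>

definition highest_root ::
  "nat \<Rightarrow> 'k::field mat set \<Rightarrow> 'k mat set \<Rightarrow> ('k mat \<Rightarrow> 'k) set \<Rightarrow> ('k mat \<Rightarrow> 'k) \<Rightarrow> bool" where
  "highest_root n G T \<Delta> \<beta> \<longleftrightarrow> \<beta> \<in> roots n G T \<and>
     (\<forall>\<gamma>\<in>roots n G T. \<forall>c. (\<forall>\<alpha>\<in>\<Delta>. c \<alpha> \<ge> 0) \<and> \<gamma> = (\<lambda>t\<in>T. \<beta> t * char_comb T \<Delta> c t) \<longrightarrow> \<gamma> = \<beta>)"

text \<open>
  \<open>p\<close> is good iff it divides no coefficient of the highest root of any irreducible component; the
  zero coefficients excluded below belong to simple roots of the other components.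
\<close>

definition good_prime :: "nat \<Rightarrow> nat \<Rightarrow> 'k::field mat set \<Rightarrow> 'k mat set \<Rightarrow> bool" where
  "good_prime p n G T \<longleftrightarrow>
     (\<forall>\<Delta> \<beta> c. root_base n G T \<Delta> \<and> highest_root n G T \<Delta> \<beta> \<and> \<beta> = char_comb T \<Delta> c \<longrightarrow>
        (\<forall>\<alpha>\<in>\<Delta>. c \<alpha> \<noteq> 0 \<longrightarrow> \<not> int p dvd c \<alpha>))"

section \<open>Standard reductive groups\<close>

definition bilinear_form_on :: "nat \<Rightarrow> 'k::field mat set \<Rightarrow> ('k mat \<Rightarrow> 'k mat \<Rightarrow> 'k) \<Rightarrow> bool" where
  "bilinear_form_on n V B \<longleftrightarrow>
     (\<forall>X\<in>V. \<forall>Y\<in>V. \<forall>Z\<in>V. B (X + Y) Z = B X Z + B Y Z \<and> B Z (X + Y) = B Z X + B Z Y) \<and>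
     (\<forall>c. \<forall>X\<in>V. \<forall>Y\<in>V. B (c \<cdot>\<^sub>m X) Y = c * B X Y \<and> B X (c \<cdot>\<^sub>m Y) = c * B X Y)"

definition nondegenerate_on :: "nat \<Rightarrow> 'k::field mat set \<Rightarrow> ('k mat \<Rightarrow> 'k mat \<Rightarrow> 'k) \<Rightarrow> bool" where
  "nondegenerate_on n V B \<longleftrightarrow>
     (\<forall>X\<in>V. X \<noteq> 0\<^sub>m n n \<longrightarrow> (\<exists>Y\<in>V. B X Y \<noteq> 0)) \<and>
     (\<forall>Y\<in>V. Y \<noteq> 0\<^sub>m n n \<longrightarrow> (\<exists>X\<in>V. B X Y \<noteq> 0))"

definition ad_invariant :: "nat \<Rightarrow> 'k::field mat set \<Rightarrow> ('k mat \<Rightarrow> 'k mat \<Rightarrow> 'k) \<Rightarrow> bool" where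
  "ad_invariant n G B \<longleftrightarrow>
     (\<forall>g\<in>G. \<forall>X\<in>tangent_space n G. \<forall>Y\<in>tangent_space n G.
        B (g * X * inv\<^bsub>GL n\<^esub> g) (g * Y * inv\<^bsub>GL n\<^esub> g) = B X Y)"

definition standard_reductive :: "nat \<Rightarrow> nat \<Rightarrow> 'k::field mat set \<Rightarrow> bool" where
  "standard_reductive p n G \<longleftrightarrow>
     connected_reductive n G \<and>
     semisimple_simply_connected n (derived (GL n) G) \<and>
     (\<forall>T. maximal_torus n G T \<longrightarrow> good_prime p n G T) \<and>
     (\<exists>B. bilinear_form_on n (tangent_space n G) B \<and>
          nondegenerate_on n (tangent_space n G) B \<and> ad_invariant n G B)"

section \<open>Restricted enveloping algebras\<close>

text \<open>
  Free associative unital algebra on the set \<open>L\<close>: finitely supported functions on words, with the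
  convolution over all splittings of a word as multiplication.
\<close>

definition free_alg :: "'l set \<Rightarrow> ('l list \<Rightarrow> 'k::field) ring" where
  "free_alg L = \<lparr>
     carrier = {f. finite {w. f w \<noteq> 0} \<and> {w. f w \<noteq> 0} \<subseteq> lists L},
     mult = (\<lambda>f g w. \<Sum>i\<le>length w. f (take i w) * g (drop i w)),
     one = (\<lambda>w. if w = [] then 1 else 0),
     zero = (\<lambda>_. 0), add = (\<lambda>f g w. f w + g w)\<rparr>"

definition free_gen :: "'l \<Rightarrow> ('l list \<Rightarrow> 'k::field)" where
  "free_gen x = (\<lambda>w. if w = [x] then 1 else 0)"

definition free_const :: "'k::field \<Rightarrow> ('l list \<Rightarrow> 'k)" where
  "free_const c = (\<lambda>w. if w = [] then c else 0)"

text \<open>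
  The first two families present the tensor algebra of the vector space \<open>L\<close> as a quotient of the
  free algebra on the set \<open>carrier L\<close>; the third imposes \<open>x y - y x = [x, y]\<close>.
\<close>

definition env_ideal :: "('k::field, 'l) restricted_lie \<Rightarrow> ('l list \<Rightarrow> 'k) set" where
  "env_ideal L = (let F = free_alg (carrier L) in
     Idl\<^bsub>F\<^esub> (
       {free_gen (x \<oplus>\<^bsub>L\<^esub> y) \<ominus>\<^bsub>F\<^esub> (free_gen x \<oplus>\<^bsub>F\<^esub> free_gen y) | x y.
          x \<in> carrier L \<and> y \<in> carrier L} \<union>
       {free_gen (c \<odot>\<^bsub>L\<^esub> x) \<ominus>\<^bsub>F\<^esub> (free_const c \<otimes>\<^bsub>F\<^esub> free_gen x) | c x. x \<in> carrier L} \<union>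
       {(free_gen x \<otimes>\<^bsub>F\<^esub> free_gen y \<ominus>\<^bsub>F\<^esub> free_gen y \<otimes>\<^bsub>F\<^esub> free_gen x) \<ominus>\<^bsub>F\<^esub> free_gen (lie_bracket L x y) | x y.
          x \<in> carrier L \<and> y \<in> carrier L}))"

definition env_alg :: "('k::field, 'l) restricted_lie \<Rightarrow> ('l list \<Rightarrow> 'k) set ring" where
  "env_alg L = free_alg (carrier L) Quot env_ideal L"

definition env_inc :: "('k::field, 'l) restricted_lie \<Rightarrow> 'l \<Rightarrow> ('l list \<Rightarrow> 'k) set" where
  "env_inc L x = env_ideal L +>\<^bsub>free_alg (carrier L)\<^esub> free_gen x"

definition env_scalar :: "('k::field, 'l) restricted_lie \<Rightarrow> 'k \<Rightarrow> ('l list \<Rightarrow> 'k) set" where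
  "env_scalar L c = env_ideal L +>\<^bsub>free_alg (carrier L)\<^esub> free_const c"

definition renv_ideal :: "nat \<Rightarrow> ('k::field, 'l) restricted_lie \<Rightarrow> ('l list \<Rightarrow> 'k) set set" where
  "renv_ideal p L = Idl\<^bsub>env_alg L\<^esub>
     {env_inc L x [^]\<^bsub>env_alg L\<^esub> p \<ominus>\<^bsub>env_alg L\<^esub> env_inc L (p_map L x) | x. x \<in> carrier L}"

definition renv_alg :: "nat \<Rightarrow> ('k::field, 'l) restricted_lie \<Rightarrow> ('l list \<Rightarrow> 'k) set set ring" where
  "renv_alg p L = env_alg L Quot renv_ideal p L"

definition renv_inc :: "nat \<Rightarrow> ('k::field, 'l) restricted_lie \<Rightarrow> 'l \<Rightarrow> ('l list \<Rightarrow> 'k) set set" where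
  "renv_inc p L x = renv_ideal p L +>\<^bsub>env_alg L\<^esub> env_inc L x"

definition renv_scalar :: "nat \<Rightarrow> ('k::field, 'l) restricted_lie \<Rightarrow> 'k \<Rightarrow> ('l list \<Rightarrow> 'k) set set" where
  "renv_scalar p L c = renv_ideal p L +>\<^bsub>env_alg L\<^esub> env_scalar L c"

section \<open>Modules over a not necessarily commutative ring\<close>

locale left_module = R?: ring R + M?: abelian_group M
  for R :: "('a, 'c) ring_scheme" (structure) and M :: "('a, 'm, 'd) module_scheme" (structure) +
  assumes smult_closed: "\<lbrakk>a \<in> carrier R; x \<in> carrier M\<rbrakk> \<Longrightarrow> a \<odot>\<^bsub>M\<^esub> x \<in> carrier M"
    and smult_l_distr: "\<lbrakk>a \<in> carrier R; b \<in> carrier R; x \<in> carrier M\<rbrakk> \<Longrightarrow>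
      (a \<oplus>\<^bsub>R\<^esub> b) \<odot>\<^bsub>M\<^esub> x = a \<odot>\<^bsub>M\<^esub> x \<oplus>\<^bsub>M\<^esub> b \<odot>\<^bsub>M\<^esub> x"
    and smult_r_distr: "\<lbrakk>a \<in> carrier R; x \<in> carrier M; y \<in> carrier M\<rbrakk> \<Longrightarrow>
      a \<odot>\<^bsub>M\<^esub> (x \<oplus>\<^bsub>M\<^esub> y) = a \<odot>\<^bsub>M\<^esub> x \<oplus>\<^bsub>M\<^esub> a \<odot>\<^bsub>M\<^esub> y"
    and smult_assoc: "\<lbrakk>a \<in> carrier R; b \<in> carrier R; x \<in> carrier M\<rbrakk> \<Longrightarrow>
      (a \<otimes>\<^bsub>R\<^esub> b) \<odot>\<^bsub>M\<^esub> x = a \<odot>\<^bsub>M\<^esub> (b \<odot>\<^bsub>M\<^esub> x)"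
    and smult_one: "x \<in> carrier M \<Longrightarrow> \<one>\<^bsub>R\<^esub> \<odot>\<^bsub>M\<^esub> x = x"

definition quotient_module :: "('a, 'm, 'd) module_scheme \<Rightarrow> 'm set \<Rightarrow> ('a, 'm set) module" where
  "quotient_module M N = \<lparr>carrier = a_rcosets\<^bsub>M\<^esub> N, mult = undefined, one = undefined,
     zero = N, add = set_add M, smult = (\<lambda>r A. \<Union>x\<in>A. N +>\<^bsub>M\<^esub> (r \<odot>\<^bsub>M\<^esub> x))\<rparr>"

definition simple_module :: "('a, 'c) ring_scheme \<Rightarrow> ('a, 'm, 'd) module_scheme \<Rightarrow> bool" where
  "simple_module R M \<longleftrightarrow> left_module R M \<and> carrier M \<noteq> {\<zero>\<^bsub>M\<^esub>} \<and>
     (\<forall>N. Module.submodule N R M \<longrightarrow> N = {\<zero>\<^bsub>M\<^esub>} \<or> N = carrier M)"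

definition module_iso ::
  "('a, 'c) ring_scheme \<Rightarrow> ('a, 'm, 'd) module_scheme \<Rightarrow> ('a, 'n, 'e) module_scheme \<Rightarrow> bool" where
  "module_iso R M N \<longleftrightarrow> (\<exists>f \<in> LinearCombinations.module_hom R M N. bij_betw f (carrier M) (carrier N))"

definition comp_factor :: "('a, 'm, 'd) module_scheme \<Rightarrow> (nat \<Rightarrow> 'm set) \<Rightarrow> nat \<Rightarrow> ('a, 'm set) module" where
  "comp_factor M N i = quotient_module (M\<lparr>carrier := N (Suc i)\<rparr>) (N i)"

definition composition_series ::
  "('a, 'c) ring_scheme \<Rightarrow> ('a, 'm, 'd) module_scheme \<Rightarrow> nat \<Rightarrow> (nat \<Rightarrow> 'm set) \<Rightarrow> bool" where
  "composition_series R M l N \<longleftrightarrow> N 0 = {\<zero>\<^bsub>M\<^esub>} \<and> N l = carrier M \<and>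
     (\<forall>i\<le>l. Module.submodule (N i) R M) \<and>
     (\<forall>i<l. N i \<subseteq> N (Suc i) \<and> simple_module R (comp_factor M N i))"

text \<open>
  The lifting property is stated for test modules on two fixed types.  This loses nothing: the free
  module on the set \<open>carrier P\<close>, consisting of finitely supported functions \<open>'q \<Rightarrow> 'a\<close>, lives on the
  first of these types, so lifting the identity of \<open>P\<close> along the canonical surjection already makes
  \<open>P\<close> a direct summand of a free module.
\<close>

definition projective_module :: "('a, 'c) ring_scheme \<Rightarrow> ('a, 'q, 'd) module_scheme \<Rightarrow> bool" where
  "projective_module R P \<longleftrightarrow> left_module R P \<and>
     (\<forall>(M :: ('a, 'q \<Rightarrow> 'a) module) (N :: ('a, 'q) module) f g.
        left_module R M \<and> left_module R N \<and>
        g \<in> LinearCombinations.module_hom R M N \<and> g ` carrier M = carrier N \<and>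
        f \<in> LinearCombinations.module_hom R P N \<longrightarrow>
        (\<exists>h \<in> LinearCombinations.module_hom R P M. \<forall>x\<in>carrier P. g (h x) = f x))"

definition projective_cover ::
  "('a, 'c) ring_scheme \<Rightarrow> ('a, 'q, 'd) module_scheme \<Rightarrow> ('q \<Rightarrow> 'v) \<Rightarrow> ('a, 'v, 'e) module_scheme \<Rightarrow> bool" where
  "projective_cover R P \<pi> M \<longleftrightarrow>
     projective_module R P \<and> left_module R M \<and>
     \<pi> \<in> LinearCombinations.module_hom R P M \<and> \<pi> ` carrier P = carrier M \<and>
     (\<forall>N. Module.submodule N R P \<and> N <+>\<^bsub>P\<^esub> a_kernel P M \<pi> = carrier P \<longrightarrow> N = carrier P)"

section \<open>The one-dimensional modules\<close>

definition linear_forms :: "('k::field, 'l) restricted_lie \<Rightarrow> ('l \<Rightarrow> 'k) set" where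
  "linear_forms L = LinearCombinations.module_hom class_ring L
     \<lparr>carrier = UNIV, mult = (*), one = 1, zero = 0, add = (+), smult = (*)\<rparr>"

text \<open>
  Determines \<open>K\<close> up to isomorphism, since \<open>U\<^sub>0(L \<otimes> k[t]/(t^(m+1)))\<close> is generated by scalars and
  the elements \<open>h t^i\<close>.
\<close>

definition weight_module ::
  "nat \<Rightarrow> nat \<Rightarrow> ('k::field, 'l) restricted_lie \<Rightarrow> ('l \<Rightarrow> 'k) \<Rightarrow>
     (((nat \<Rightarrow> 'l) list \<Rightarrow> 'k) set set, 'v) module \<Rightarrow> bool" where
  "weight_module p m L lam K \<longleftrightarrow>
     (let Lm = current_lie p m L in
        left_module (renv_alg p Lm) K \<and>
        (\<exists>v\<in>carrier K. v \<noteq> \<zero>\<^bsub>K\<^esub> \<and> carrier K = {renv_scalar p Lm c \<odot>\<^bsub>K\<^esub> v | c. True}) \<and>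
        (\<forall>h\<in>carrier L. \<forall>v\<in>carrier K.
           renv_inc p Lm (t_power L h 0) \<odot>\<^bsub>K\<^esub> v = renv_scalar p Lm (lam h) \<odot>\<^bsub>K\<^esub> v \<and>
           (\<forall>i\<in>{1..m}. renv_inc p Lm (t_power L h i) \<odot>\<^bsub>K\<^esub> v = \<zero>\<^bsub>K\<^esub>)))"

end

theory Submission
  imports Defs "HOL-Library.Poly_Mapping" "HOL-Library.Multiset" "HOL-Library.Function_Algebras"
    "HOL-Computational_Algebra.Polynomial"
begin

text \<open>
  Write \<open>L\<close> for the Lie algebra of \<open>T\<close>, \<open>d\<close> for its dimension and \<open>A\<close> for the restricted enveloping algebra of
  \<open>L \<otimes> k[t]/(t^(m+1))\<close>. The cover
  of \<open>k_lam\<close> is the direct factor of \<open>A\<close> on which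
  \<open>L t^0\<close> acts by \<open>lam\<close>, and this factor is the restricted enveloping algebra of the part of positive
  degree: a commutative local algebra of dimension \<open>p^(m d)\<close>. The proof
  establishes this description by bounding the cover from both sides.

  Upper bound. As \<open>k_lam\<close> is one-dimensional, its cover \<open>Q\<close> is cyclic, generated by a lift \<open>q0\<close> of a basis
  vector (\<open>Q_cyclic\<close>). The elements \<open>h t^0 - lam h\<close> kill \<open>Q\<close> (\<open>shifted_Q\<close>): the \<open>p\<close>-map of \<open>L\<close> is
  injective, so every \<open>h\<close> in \<open>L\<close> is a linear combination of its proper \<open>p\<close>-power iterates
  (\<open>mem_span_frob_orbit\<close>), and \<open>h t^0 - lam h\<close> is a multiple of itself by an element that acts on
  \<open>k_lam\<close> by zero. Fix a basis \<open>B\<close> of \<open>L\<close>. For \<open>b\<close> in \<open>B\<close> and \<open>j\<close> prime to \<open>p\<close> the \<open>p^s\<close>-th power of \<open>b t^j\<close> is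
  \<open>b^[p^s] t^(j p^s)\<close>, and the elements \<open>b^[p^s]\<close> form a basis of \<open>L\<close> again, so the \<open>b t^j\<close> with \<open>j\<close> prime
  to \<open>p\<close> generate everything of positive degree. Such a generator has nilpotency exponent
  \<open>p^(height j)\<close> with \<open>height j\<close> the number of \<open>s\<close> such that \<open>j p^s \<le> m\<close>. Hence \<open>Q\<close> is spanned by the
  monomials in a box (\<open>spanned_all\<close>), and the box has \<open>p^(m d)\<close> elements since every degree from \<open>1\<close> to \<open>m\<close> is
  uniquely of the form \<open>j p^s\<close> (\<open>card_box\<close>).

  Lower bound. Sending \<open>b t^j\<close> to a variable and \<open>h t^0\<close> to \<open>lam h\<close> extends to a homomorphism of \<open>A\<close> onto
  the polynomial algebra truncated at the box (\<open>box_null_ev_of_cls_zero\<close>). As \<open>Q\<close> is projective, the surjection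
  \<open>a \<mapsto> a q0\<close> splits, and the splitting forces the annihilator of \<open>q0\<close> into the kernel of this
  homomorphism. So \<open>Q\<close> is the truncated polynomial algebra (\<open>annihilator_iff\<close>).

  Composition factors. An element of \<open>A\<close> that acts by zero on \<open>k_lam\<close> raises the order of vanishing of
  elements of \<open>Q\<close>. So in any submodule not contained in a submodule \<open>S\<close> there is a vector outside \<open>S\<close> on which
  \<open>A\<close> acts modulo \<open>S\<close> as on \<open>k_lam\<close> (\<open>eigenvector_modulo\<close>). Every step of a composition series is
  therefore one-dimensional with factor \<open>k_lam\<close> (\<open>composition_step\<close>), and the number of steps is
  \<open>dim Q = p^(m d)\<close>.

  It remains to see that \<open>L\<close> is abelian with an injective \<open>p\<close>-semilinear \<open>p\<close>-map. It is closed under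
  \<open>p\<close>-th powers because the \<open>p\<close>-th power of the left invariant derivation of \<open>X\<close> is that of \<open>X^p\<close>
  (\<open>tangent_space_p_power\<close>). It lies in the linear span of the matrices in \<open>T\<close> (\<open>tangent_in_span\<close>), which
  is commutative; and the \<open>p\<close>-th power map is injective on this span because every element of \<open>T\<close> is a
  \<open>p\<close>-th power in \<open>T\<close> (\<open>U_pow_inj\<close>).
\<close>

section \<open>The free associative algebra\<close>

lemma free_carrier: "f \<in> carrier (free_alg S) \<longleftrightarrow> finite {w. f w \<noteq> 0} \<and> {w. f w \<noteq> 0} \<subseteq> lists S"
  by (simp add: free_alg_def)

lemma free_mult: "(f \<otimes>\<^bsub>free_alg S\<^esub> g) w = (\<Sum>i\<le>length w. f (take i w) * g (drop i w))"
  by (simp add: free_alg_def)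

lemma free_add: "(f \<oplus>\<^bsub>free_alg S\<^esub> g) w = f w + g w"
  by (simp add: free_alg_def)

lemma free_zero: "\<zero>\<^bsub>free_alg S\<^esub> w = 0"
  by (simp add: free_alg_def)

lemma free_one: "\<one>\<^bsub>free_alg S\<^esub> = free_const 1"
  by (simp add: free_alg_def free_const_def)

lemma free_mult_closed:
  assumes "f \<in> carrier (free_alg S)" "g \<in> carrier (free_alg S)"
  shows "f \<otimes>\<^bsub>free_alg S\<^esub> g \<in> carrier (free_alg S)"
proof -
  have sub: "{w. (f \<otimes>\<^bsub>free_alg S\<^esub> g) w \<noteq> 0} \<subseteq> (\<lambda>(u, v). u @ v) ` ({w. f w \<noteq> 0} \<times> {w. g w \<noteq> 0})"
  proof
    fix w assume "w \<in> {w. (f \<otimes>\<^bsub>free_alg S\<^esub> g) w \<noteq> 0}"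
    then obtain i where "f (take i w) * g (drop i w) \<noteq> 0"
      by (auto simp: free_mult elim: sum.not_neutral_contains_not_neutral)
    then show "w \<in> (\<lambda>(u, v). u @ v) ` ({w. f w \<noteq> 0} \<times> {w. g w \<noteq> 0})"
      by (intro image_eqI[of _ _ "(take i w, drop i w)"]) auto
  qed
  moreover have "(\<lambda>(u, v). u @ v) ` ({w. f w \<noteq> 0} \<times> {w. g w \<noteq> 0}) \<subseteq> lists S"
    using assms by (fastforce simp: free_carrier)
  moreover have "finite ((\<lambda>(u, v). u @ v) ` ({w. f w \<noteq> 0} \<times> {w. g w \<noteq> 0}))"
    using assms by (simp add: free_carrier)
  ultimately show ?thesis
    unfolding free_carrier by (meson finite_subset order_trans)
qed

lemma free_mult_assoc:
  "(f \<otimes>\<^bsub>free_alg S\<^esub> g) \<otimes>\<^bsub>free_alg S\<^esub> h = f \<otimes>\<^bsub>free_alg S\<^esub> (g \<otimes>\<^bsub>free_alg S\<^esub> h)"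
proof
  fix w :: "'a list"
  define n where "n = length w"
  define G where "G = (\<lambda>j k. f (take j w) * g (take k (drop j w)) * h (drop (j + k) w))"
  have "((f \<otimes>\<^bsub>free_alg S\<^esub> g) \<otimes>\<^bsub>free_alg S\<^esub> h) w
      = (\<Sum>i\<le>n. \<Sum>j\<le>i. G j (i - j))"
    unfolding free_mult G_def n_def sum_distrib_right
    by (intro sum.cong refl) (auto simp: take_drop min_def)
  also have "\<dots> = (\<Sum>(j, k) \<in> {(j, k). j + k \<le> n}. G j k)"
    by (rule sum.triangle_reindex_eq[symmetric])
  also have "{(j, k). j + k \<le> n} = Sigma {..n} (\<lambda>j. {..n - j})" by auto
  also have "(\<Sum>(j, k) \<in> Sigma {..n} (\<lambda>j. {..n - j}). G j k) = (\<Sum>j\<le>n. \<Sum>k\<le>n-j. G j k)"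
    by (rule sum.Sigma[symmetric]) auto
  also have "\<dots> = (f \<otimes>\<^bsub>free_alg S\<^esub> (g \<otimes>\<^bsub>free_alg S\<^esub> h)) w"
    unfolding free_mult G_def n_def sum_distrib_left
    by (intro sum.cong) (simp_all add: drop_drop mult.assoc add.commute)
  finally show "((f \<otimes>\<^bsub>free_alg S\<^esub> g) \<otimes>\<^bsub>free_alg S\<^esub> h) w = (f \<otimes>\<^bsub>free_alg S\<^esub> (g \<otimes>\<^bsub>free_alg S\<^esub> h)) w" .
qed

lemma free_const_mult: "free_const c \<otimes>\<^bsub>free_alg S\<^esub> f = (\<lambda>w. c * f w)"
proof
  fix w
  have "(free_const c \<otimes>\<^bsub>free_alg S\<^esub> f) w = (\<Sum>i\<in>{0}. free_const c (take i w) * f (drop i w))"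
    unfolding free_mult by (rule sum.mono_neutral_right) (auto simp: free_const_def)
  then show "(free_const c \<otimes>\<^bsub>free_alg S\<^esub> f) w = c * f w" by (simp add: free_const_def)
qed

lemma free_mult_const: "f \<otimes>\<^bsub>free_alg S\<^esub> free_const c = (\<lambda>w. f w * c)"
proof
  fix w
  have "(f \<otimes>\<^bsub>free_alg S\<^esub> free_const c) w = (\<Sum>i\<in>{length w}. f (take i w) * free_const c (drop i w))"
    unfolding free_mult by (rule sum.mono_neutral_right) (auto simp: free_const_def)
  then show "(f \<otimes>\<^bsub>free_alg S\<^esub> free_const c) w = f w * c" by (simp add: free_const_def)
qed

lemma free_gen_mult:
  "free_gen x \<otimes>\<^bsub>free_alg S\<^esub> f = (\<lambda>w. if w \<noteq> [] \<and> hd w = x then f (tl w) else 0)"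
proof
  fix w
  show "(free_gen x \<otimes>\<^bsub>free_alg S\<^esub> f) w = (if w \<noteq> [] \<and> hd w = x then f (tl w) else 0)"
  proof (cases w)
    case (Cons y u)
    have "(free_gen x \<otimes>\<^bsub>free_alg S\<^esub> f) w = (\<Sum>i\<in>{1}. free_gen x (take i w) * f (drop i w))"
      unfolding free_mult using Cons
      by (intro sum.mono_neutral_right) (auto simp: free_gen_def take_Cons split: nat.splits)
    then show ?thesis using Cons by (simp add: free_gen_def)
  qed (simp add: free_mult free_gen_def)
qed

lemma free_gen_closed: "x \<in> S \<Longrightarrow> free_gen x \<in> carrier (free_alg S)"
  by (simp add: free_carrier free_gen_def)

lemma free_const_closed: "free_const c \<in> carrier (free_alg S)"
proof -
  have "{w. free_const c w \<noteq> 0} \<subseteq> {[]}" by (auto simp: free_const_def split: if_splits)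
  then show ?thesis
    unfolding free_carrier using finite_subset[of _ "{[]}"] by auto
qed

lemma free_add_closed:
  assumes "f \<in> carrier (free_alg S)" "g \<in> carrier (free_alg S)"
  shows "f \<oplus>\<^bsub>free_alg S\<^esub> g \<in> carrier (free_alg S)"
proof -
  have "{w. f w + g w \<noteq> 0} \<subseteq> {w. f w \<noteq> 0} \<union> {w. g w \<noteq> 0}" by auto
  with assms show ?thesis
    unfolding free_carrier free_add by (meson finite_UnI finite_subset le_sup_iff order_trans)
qed

lemma free_alg_ring: "ring (free_alg S)"
proof (rule ringI)
  show "abelian_group (free_alg S)"
  proof (rule abelian_groupI)
    fix f assume f: "f \<in> carrier (free_alg S)"
    then show "\<exists>g\<in>carrier (free_alg S). g \<oplus>\<^bsub>free_alg S\<^esub> f = \<zero>\<^bsub>free_alg S\<^esub>"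
      by (intro bexI[of _ "\<lambda>w. - f w"]) (auto simp: free_carrier free_add free_zero fun_eq_iff)
  next
    show "\<zero>\<^bsub>free_alg S\<^esub> \<in> carrier (free_alg S)" by (simp add: free_carrier free_zero)
  qed (simp_all add: free_add_closed free_add free_zero fun_eq_iff add_ac)
  show "Group.monoid (free_alg S)"
    by (rule monoidI)
       (auto simp: free_mult_closed free_mult_assoc free_one free_const_closed free_const_mult free_mult_const)
qed (auto simp: free_mult free_add fun_eq_iff distrib_left distrib_right sum.distrib)

text \<open>Words span the free algebra, so a property passing to sums and to left multiples by generators
  has only to be checked on scalars.\<close>

lemma free_alg_induct [consumes 1, case_names const add gen]:
  assumes f: "f \<in> carrier (free_alg S)"
    and c: "\<And>c. P (free_const c)"
    and a: "\<And>f g. f \<in> carrier (free_alg S) \<Longrightarrow> g \<in> carrier (free_alg S) \<Longrightarrow> P f \<Longrightarrow> P g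
              \<Longrightarrow> P (f \<oplus>\<^bsub>free_alg S\<^esub> g)"
    and g: "\<And>x f. x \<in> S \<Longrightarrow> f \<in> carrier (free_alg S) \<Longrightarrow> P f \<Longrightarrow> P (free_gen x \<otimes>\<^bsub>free_alg S\<^esub> f)"
  shows "P f"
proof -
  have word: "P (\<lambda>u. if u = w then c else 0)" if "w \<in> lists S" for w c
    using that
  proof (induction w)
    case Nil
    then show ?case using c[of c] by (simp add: free_const_def)
  next
    case (Cons x w)
    have "(\<lambda>u. if u = w then c else 0) \<in> carrier (free_alg S)"
      using Cons by (auto simp: free_carrier)
    then have "P (free_gen x \<otimes>\<^bsub>free_alg S\<^esub> (\<lambda>u. if u = w then c else 0))"
      using Cons g[of x] by auto
    also have "free_gen x \<otimes>\<^bsub>free_alg S\<^esub> (\<lambda>u. if u = w then c else 0) = (\<lambda>u. if u = x # w then c else 0)"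
      by (auto simp: free_gen_mult fun_eq_iff neq_Nil_conv)
    finally show ?case .
  qed
  have "P (\<lambda>u. if u \<in> W then f u else 0)" if "finite W" "W \<subseteq> lists S" for W
    using that
  proof (induction W rule: finite_induct)
    case empty
    then show ?case using c[of 0] by (simp add: free_const_def)
  next
    case (insert w W)
    have "P ((\<lambda>u. if u = w then f w else 0) \<oplus>\<^bsub>free_alg S\<^esub> (\<lambda>u. if u \<in> W then f u else 0))"
      using insert word by (intro a) (auto simp: free_carrier)
    also have "(\<lambda>u. if u = w then f w else 0) \<oplus>\<^bsub>free_alg S\<^esub> (\<lambda>u. if u \<in> W then f u else 0)
        = (\<lambda>u. if u \<in> insert w W then f u else 0)"
      using insert by (auto simp: free_add fun_eq_iff)
    finally show ?case .
  qed
  from this[of "{w. f w \<noteq> 0}"] f have "P (\<lambda>u. if u \<in> {w. f w \<noteq> 0} then f u else 0)"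
    by (auto simp: free_carrier)
  moreover have "(\<lambda>u. if u \<in> {w. f w \<noteq> 0} then f u else 0) = f" by auto
  ultimately show ?thesis by simp
qed

text \<open>Evaluation at \<open>\<phi>\<close> of noncommutative polynomials in a commutative monoid algebra. The targets of
  interest are the polynomial rings, for which the monoid consists of multisets of variables.\<close>

definition free_eval :: "('l \<Rightarrow> 'm::comm_monoid_add \<Rightarrow>\<^sub>0 'k::field) \<Rightarrow> ('l list \<Rightarrow> 'k) \<Rightarrow> ('m \<Rightarrow>\<^sub>0 'k)" where
  "free_eval \<phi> f = (\<Sum>w | f w \<noteq> 0. Poly_Mapping.single 0 (f w) * prod_list (map \<phi> w))"

lemma free_eval_superset:
  assumes "finite W" "{w. f w \<noteq> 0} \<subseteq> W"
  shows "free_eval \<phi> f = (\<Sum>w\<in>W. Poly_Mapping.single 0 (f w) * prod_list (map \<phi> w))"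
  unfolding free_eval_def by (rule sum.mono_neutral_left) (use assms in auto)

lemma free_eval_add:
  assumes "f \<in> carrier (free_alg S)" "g \<in> carrier (free_alg S)"
  shows "free_eval \<phi> (f \<oplus>\<^bsub>free_alg S\<^esub> g) = free_eval \<phi> f + free_eval \<phi> g"
proof -
  let ?W = "{w. f w \<noteq> 0} \<union> {w. g w \<noteq> 0}"
  have W: "finite ?W" using assms by (simp add: free_carrier)
  show ?thesis
    unfolding free_eval_superset[OF W, of f, OF Un_upper1] free_eval_superset[OF W, of g, OF Un_upper2]
    by (subst free_eval_superset[OF W])
       (auto simp: free_add single_add distrib_right sum.distrib)
qed

lemma free_eval_const [simp]: "free_eval \<phi> (free_const c) = Poly_Mapping.single 0 c"
  by (subst free_eval_superset[of "{[]}"]) (auto simp: free_const_def split: if_splits)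

lemma free_eval_gen_mult:
  assumes "f \<in> carrier (free_alg S)"
  shows "free_eval \<phi> (free_gen x \<otimes>\<^bsub>free_alg S\<^esub> f) = \<phi> x * free_eval \<phi> f"
proof -
  let ?W = "{w. f w \<noteq> 0}"
  have fin: "finite ((#) x ` ?W)" using assms by (simp add: free_carrier)
  have "free_eval \<phi> (free_gen x \<otimes>\<^bsub>free_alg S\<^esub> f)
      = (\<Sum>w\<in>(#) x ` ?W. Poly_Mapping.single 0 ((free_gen x \<otimes>\<^bsub>free_alg S\<^esub> f) w) * prod_list (map \<phi> w))"
  proof (rule free_eval_superset[OF fin], rule subsetI)
    fix w assume "w \<in> {w. (free_gen x \<otimes>\<^bsub>free_alg S\<^esub> f) w \<noteq> 0}"
    then show "w \<in> (#) x ` ?W" by (cases w) (auto simp: free_gen_mult split: if_splits)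
  qed
  also have "\<dots> = (\<Sum>w\<in>?W. Poly_Mapping.single 0 (f w) * (\<phi> x * prod_list (map \<phi> w)))"
    by (subst sum.reindex) (auto simp: free_gen_mult)
  also have "\<dots> = \<phi> x * free_eval \<phi> f"
    unfolding free_eval_def sum_distrib_left by (simp add: ac_simps)
  finally show ?thesis .
qed

lemma free_eval_gen [simp]: "free_eval \<phi> (free_gen x) = \<phi> x"
  by (subst free_eval_superset[of "{[x]}"]) (auto simp: free_gen_def split: if_splits)

lemma free_eval_mult:
  assumes "f \<in> carrier (free_alg S)" "g \<in> carrier (free_alg S)"
  shows "free_eval \<phi> (f \<otimes>\<^bsub>free_alg S\<^esub> g) = free_eval \<phi> f * free_eval \<phi> g"
proof -
  interpret F: ring "free_alg S" by (rule free_alg_ring)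
  show ?thesis using assms(1)
  proof (induction f rule: free_alg_induct)
    case (const c)
    have fin: "finite {w. g w \<noteq> 0}" using assms(2) by (simp add: free_carrier)
    have "free_eval \<phi> (free_const c \<otimes>\<^bsub>free_alg S\<^esub> g)
        = (\<Sum>w | g w \<noteq> 0. Poly_Mapping.single 0 (c * g w) * prod_list (map \<phi> w))"
      by (subst free_eval_superset[OF fin]) (auto simp: free_const_mult)
    also have "\<dots> = Poly_Mapping.single 0 c * free_eval \<phi> g"
      unfolding free_eval_def sum_distrib_left
      by (intro sum.cong refl) (simp add: mult_single mult.assoc[symmetric])
    finally show ?case by simp
  next
    case (add f h)
    then show ?case
      using assms(2) by (simp add: F.l_distr free_eval_add distrib_right)
  next
    case (gen x f)
    then show ?case
      using assms(2)
      by (simp add: free_mult_assoc free_eval_gen_mult[where S=S] free_mult_closed mult.assoc)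
  qed
qed

lemma (in abelian_group) minus_eq_zero_iff:
  "x \<in> carrier G \<Longrightarrow> y \<in> carrier G \<Longrightarrow> x \<ominus> y = \<zero> \<longleftrightarrow> x = y"
  by (metis a_minus_def add.inv_closed add.inv_inv minus_equality r_neg)

lemma free_minus:
  assumes "f \<in> carrier (free_alg S)" "g \<in> carrier (free_alg S)"
  shows "f \<ominus>\<^bsub>free_alg S\<^esub> g = (\<lambda>w. f w - g w)"
proof -
  interpret F: ring "free_alg S" by (rule free_alg_ring)
  have c: "(\<lambda>w. - g w) \<in> carrier (free_alg S)" using assms(2) by (simp add: free_carrier)
  have "(\<lambda>w. - g w) \<oplus>\<^bsub>free_alg S\<^esub> g = \<zero>\<^bsub>free_alg S\<^esub>"
    by (simp add: fun_eq_iff free_add free_zero)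
  then have "\<ominus>\<^bsub>free_alg S\<^esub> g = (\<lambda>w. - g w)"
    using F.minus_equality[OF _ assms(2) c] by simp
  then show ?thesis by (simp add: a_minus_def fun_eq_iff free_add)
qed

lemma free_eval_minus:
  assumes "f \<in> carrier (free_alg S)" "g \<in> carrier (free_alg S)"
  shows "free_eval \<phi> (f \<ominus>\<^bsub>free_alg S\<^esub> g) = free_eval \<phi> f - free_eval \<phi> g"
proof -
  interpret F: ring "free_alg S" by (rule free_alg_ring)
  have "f = (f \<ominus>\<^bsub>free_alg S\<^esub> g) \<oplus>\<^bsub>free_alg S\<^esub> g"
    using assms by (simp add: fun_eq_iff free_add free_minus)
  then have "free_eval \<phi> f = free_eval \<phi> (f \<ominus>\<^bsub>free_alg S\<^esub> g) + free_eval \<phi> g"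
    using free_eval_add[OF F.minus_closed[OF assms] assms(2)] by metis
  then show ?thesis by simp
qed

lemma free_eval_pow:
  assumes "f \<in> carrier (free_alg S)"
  shows "free_eval \<phi> (f [^]\<^bsub>free_alg S\<^esub> (n::nat)) = free_eval \<phi> f ^ n"
proof -
  interpret F: ring "free_alg S" by (rule free_alg_ring)
  show ?thesis
    by (induction n) (simp_all add: free_one free_eval_mult[where S=S] assms mult.commute)
qed

section \<open>Restricted enveloping algebras as quotients of free algebras\<close>

text \<open>The restricted enveloping algebra is a quotient of a quotient of a free algebra. Composing the two
projections gives one surjection \<open>cls\<close> from the free algebra, so that its elements and
relations can be treated as noncommutative polynomials. The closure properties
say that the relations lie in the free algebra.\<close>

locale restricted_data =
  fixes p :: nat and C :: "('k::field, 'l) restricted_lie"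
  assumes add_closed: "\<And>x y. x \<in> carrier C \<Longrightarrow> y \<in> carrier C \<Longrightarrow> x \<oplus>\<^bsub>C\<^esub> y \<in> carrier C"
    and smult_closed: "\<And>c x. x \<in> carrier C \<Longrightarrow> c \<odot>\<^bsub>C\<^esub> x \<in> carrier C"
    and bracket_closed: "\<And>x y. x \<in> carrier C \<Longrightarrow> y \<in> carrier C \<Longrightarrow> lie_bracket C x y \<in> carrier C"
    and p_map_closed: "\<And>x. x \<in> carrier C \<Longrightarrow> p_map C x \<in> carrier C"
begin

abbreviation "F \<equiv> (free_alg (carrier C) :: ('l list \<Rightarrow> 'k) ring)"
abbreviation "A \<equiv> renv_alg p C"

definition cls0 :: "('l list \<Rightarrow> 'k) \<Rightarrow> ('l list \<Rightarrow> 'k) set" where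
  "cls0 f = env_ideal C +>\<^bsub>F\<^esub> f"

definition cls :: "('l list \<Rightarrow> 'k) \<Rightarrow> ('l list \<Rightarrow> 'k) set set" where
  "cls f = renv_ideal p C +>\<^bsub>env_alg C\<^esub> cls0 f"

abbreviation "inc \<equiv> renv_inc p C"
abbreviation "scal \<equiv> renv_scalar p C"

lemma inc_eq: "inc x = cls (free_gen x)"
  by (simp add: renv_inc_def cls_def cls0_def env_inc_def)

lemma scal_eq: "scal c = cls (free_const c)"
  by (simp add: renv_scalar_def cls_def cls0_def env_scalar_def)

sublocale F: ring F by (rule free_alg_ring)

definition env_rels :: "('l list \<Rightarrow> 'k) set" where
  "env_rels = {free_gen (x \<oplus>\<^bsub>C\<^esub> y) \<ominus>\<^bsub>F\<^esub> (free_gen x \<oplus>\<^bsub>F\<^esub> free_gen y) | x y.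
          x \<in> carrier C \<and> y \<in> carrier C} \<union>
       {free_gen (c \<odot>\<^bsub>C\<^esub> x) \<ominus>\<^bsub>F\<^esub> (free_const c \<otimes>\<^bsub>F\<^esub> free_gen x) | c x. x \<in> carrier C} \<union>
       {(free_gen x \<otimes>\<^bsub>F\<^esub> free_gen y \<ominus>\<^bsub>F\<^esub> free_gen y \<otimes>\<^bsub>F\<^esub> free_gen x) \<ominus>\<^bsub>F\<^esub> free_gen (lie_bracket C x y) | x y.
          x \<in> carrier C \<and> y \<in> carrier C}"

lemma env_ideal_eq: "env_ideal C = Idl\<^bsub>F\<^esub> env_rels"
  by (simp add: env_ideal_def env_rels_def Let_def)

lemma env_rels_closed: "env_rels \<subseteq> carrier F"
  unfolding env_rels_def
  by (auto intro!: F.minus_closed F.m_closed F.a_closed free_gen_closed free_const_closed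
      add_closed smult_closed bracket_closed)

sublocale EI: ideal "env_ideal C" F
  unfolding env_ideal_eq by (rule F.genideal_ideal[OF env_rels_closed])

sublocale E: ring "env_alg C"
  unfolding env_alg_def by (rule EI.quotient_is_ring)

lemma cls0_hom: "cls0 \<in> Ring.ring_hom F (env_alg C)"
  using EI.rcos_ring_hom unfolding env_alg_def cls0_def[abs_def] .

lemma cls0_surj: "X \<in> carrier (env_alg C) \<Longrightarrow> \<exists>f\<in>carrier F. X = cls0 f"
  unfolding env_alg_def cls0_def by (auto simp: FactRing_def A_RCOSETS_def RCOSETS_def a_r_coset_def)

sublocale H0: ring_hom_ring F "env_alg C" cls0
  by (rule ring_hom_ringI2[OF F.ring_axioms E.ring_axioms cls0_hom])

lemma env_inc_eq: "env_inc C x = cls0 (free_gen x)"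
  by (simp add: env_inc_def cls0_def)

lemma env_inc_closed: "x \<in> carrier C \<Longrightarrow> env_inc C x \<in> carrier (env_alg C)"
  unfolding env_inc_eq by (simp add: free_gen_closed)

definition p_rels :: "('l list \<Rightarrow> 'k) set set" where
  "p_rels = {env_inc C x [^]\<^bsub>env_alg C\<^esub> p \<ominus>\<^bsub>env_alg C\<^esub> env_inc C (p_map C x) | x. x \<in> carrier C}"

lemma p_rels_closed: "p_rels \<subseteq> carrier (env_alg C)"
  unfolding p_rels_def
  by (auto intro!: E.minus_closed E.nat_pow_closed env_inc_closed p_map_closed)

sublocale RI: ideal "renv_ideal p C" "env_alg C"
  unfolding renv_ideal_def p_rels_def[symmetric] by (rule E.genideal_ideal[OF p_rels_closed])

sublocale A: ring A
  unfolding renv_alg_def by (rule RI.quotient_is_ring)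

lemma cls_hom: "cls \<in> Ring.ring_hom F A"
  using ring_hom_trans[OF cls0_hom RI.rcos_ring_hom]
  unfolding renv_alg_def cls_def[abs_def] comp_def .

sublocale H: ring_hom_ring F A cls
  by (rule ring_hom_ringI2[OF F.ring_axioms A.ring_axioms cls_hom])

lemma cls_surj: "a \<in> carrier A \<Longrightarrow> \<exists>f\<in>carrier F. a = cls f"
proof -
  assume "a \<in> carrier A"
  then obtain X where X: "X \<in> carrier (env_alg C)" "a = renv_ideal p C +>\<^bsub>env_alg C\<^esub> X"
    unfolding renv_alg_def by (auto simp: FactRing_def A_RCOSETS_def RCOSETS_def a_r_coset_def)
  with cls0_surj[OF X(1)] show ?thesis by (auto simp: cls_def)
qed

lemma cls_minus:
  "f \<in> carrier F \<Longrightarrow> g \<in> carrier F \<Longrightarrow> cls (f \<ominus>\<^bsub>F\<^esub> g) = cls f \<ominus>\<^bsub>A\<^esub> cls g"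
  by (simp add: a_minus_def)

lemma cls0_minus:
  "f \<in> carrier F \<Longrightarrow> g \<in> carrier F \<Longrightarrow> cls0 (f \<ominus>\<^bsub>F\<^esub> g) = cls0 f \<ominus>\<^bsub>env_alg C\<^esub> cls0 g"
  by (simp add: a_minus_def)

lemma zero_env: "\<zero>\<^bsub>env_alg C\<^esub> = env_ideal C"
  by (simp add: env_alg_def FactRing_def)

lemma zero_renv: "\<zero>\<^bsub>A\<^esub> = renv_ideal p C"
  by (simp add: renv_alg_def FactRing_def)

lemma cls0_eq_zero_iff: "f \<in> carrier F \<Longrightarrow> cls0 f = \<zero>\<^bsub>env_alg C\<^esub> \<longleftrightarrow> f \<in> env_ideal C"
  unfolding zero_env cls0_def
  using EI.rcos_const_imp_mem F.a_rcos_zero[OF EI.ideal_axioms] by blast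

lemma renv_coset_zero_iff:
  "X \<in> carrier (env_alg C) \<Longrightarrow>
    renv_ideal p C +>\<^bsub>env_alg C\<^esub> X = \<zero>\<^bsub>A\<^esub> \<longleftrightarrow> X \<in> renv_ideal p C"
  unfolding zero_renv
  using RI.rcos_const_imp_mem E.a_rcos_zero[OF RI.ideal_axioms] by blast

lemma cls_env_rel:
  assumes "f \<in> carrier F" "g \<in> carrier F" "f \<ominus>\<^bsub>F\<^esub> g \<in> env_rels"
  shows "cls f = cls g"
proof -
  have "f \<ominus>\<^bsub>F\<^esub> g \<in> env_ideal C"
    unfolding env_ideal_eq using F.genideal_self[OF env_rels_closed] assms(3) by blast
  then have "cls0 f \<ominus>\<^bsub>env_alg C\<^esub> cls0 g = \<zero>\<^bsub>env_alg C\<^esub>"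
    using assms by (simp add: cls0_eq_zero_iff flip: cls0_minus)
  then have "cls0 f = cls0 g"
    using assms by (simp add: E.minus_eq_zero_iff)
  then show ?thesis by (simp add: cls_def)
qed

lemma inc_closed [simp]: "x \<in> carrier C \<Longrightarrow> inc x \<in> carrier A"
  by (simp add: inc_eq free_gen_closed)

lemma scal_closed [simp]: "scal c \<in> carrier A"
  by (simp add: scal_eq free_const_closed)

lemma inc_add:
  assumes "x \<in> carrier C" "y \<in> carrier C"
  shows "inc (x \<oplus>\<^bsub>C\<^esub> y) = inc x \<oplus>\<^bsub>A\<^esub> inc y"
proof -
  have "cls (free_gen (x \<oplus>\<^bsub>C\<^esub> y)) = cls (free_gen x \<oplus>\<^bsub>F\<^esub> free_gen y)"
    by (rule cls_env_rel) (use assms in \<open>auto simp: free_gen_closed add_closed env_rels_def\<close>)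
  then show ?thesis using assms by (simp add: inc_eq free_gen_closed)
qed

lemma inc_smult:
  assumes "x \<in> carrier C"
  shows "inc (c \<odot>\<^bsub>C\<^esub> x) = scal c \<otimes>\<^bsub>A\<^esub> inc x"
proof -
  have "cls (free_gen (c \<odot>\<^bsub>C\<^esub> x)) = cls (free_const c \<otimes>\<^bsub>F\<^esub> free_gen x)"
    by (rule cls_env_rel)
       (use assms in \<open>auto simp: free_gen_closed free_const_closed smult_closed env_rels_def\<close>)
  then show ?thesis using assms by (simp add: inc_eq scal_eq free_gen_closed free_const_closed)
qed

lemma inc_bracket:
  assumes "x \<in> carrier C" "y \<in> carrier C"
  shows "inc x \<otimes>\<^bsub>A\<^esub> inc y \<ominus>\<^bsub>A\<^esub> inc y \<otimes>\<^bsub>A\<^esub> inc x = inc (lie_bracket C x y)"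
proof -
  have "cls (free_gen x \<otimes>\<^bsub>F\<^esub> free_gen y \<ominus>\<^bsub>F\<^esub> free_gen y \<otimes>\<^bsub>F\<^esub> free_gen x)
      = cls (free_gen (lie_bracket C x y))"
  proof (rule cls_env_rel)
    show "(free_gen x \<otimes>\<^bsub>F\<^esub> free_gen y \<ominus>\<^bsub>F\<^esub> free_gen y \<otimes>\<^bsub>F\<^esub> free_gen x) \<ominus>\<^bsub>F\<^esub> free_gen (lie_bracket C x y) \<in> env_rels"
      unfolding env_rels_def using assms by blast
  qed (use assms in \<open>simp_all add: free_gen_closed bracket_closed F.minus_closed\<close>)
  then show ?thesis using assms by (simp add: inc_eq cls_minus free_gen_closed)
qed

lemma inc_pow:
  assumes "x \<in> carrier C"
  shows "inc x [^]\<^bsub>A\<^esub> p = inc (p_map C x)"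
proof -
  interpret R: ring_hom_ring "env_alg C" A "(+>\<^bsub>env_alg C\<^esub>) (renv_ideal p C)"
    unfolding renv_alg_def by (rule RI.rcos_ring_hom_ring)
  let ?X = "env_inc C x [^]\<^bsub>env_alg C\<^esub> p" and ?Y = "env_inc C (p_map C x)"
  have c: "?X \<in> carrier (env_alg C)" "?Y \<in> carrier (env_alg C)"
    using assms by (auto intro!: E.nat_pow_closed env_inc_closed p_map_closed)
  have "?X \<ominus>\<^bsub>env_alg C\<^esub> ?Y \<in> renv_ideal p C"
    unfolding renv_ideal_def p_rels_def[symmetric]
    using E.genideal_self[OF p_rels_closed] assms p_rels_def by blast
  then have "renv_ideal p C +>\<^bsub>env_alg C\<^esub> (?X \<ominus>\<^bsub>env_alg C\<^esub> ?Y) = \<zero>\<^bsub>A\<^esub>"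
    using c by (simp add: renv_coset_zero_iff)
  then have "(renv_ideal p C +>\<^bsub>env_alg C\<^esub> ?X) \<ominus>\<^bsub>A\<^esub> (renv_ideal p C +>\<^bsub>env_alg C\<^esub> ?Y) = \<zero>\<^bsub>A\<^esub>"
    using c by (simp add: a_minus_def)
  then have "renv_ideal p C +>\<^bsub>env_alg C\<^esub> ?X = renv_ideal p C +>\<^bsub>env_alg C\<^esub> ?Y"
    using c by (simp add: A.minus_eq_zero_iff)
  then show ?thesis
    using R.hom_nat_pow[OF env_inc_closed[OF assms], of p] by (simp add: renv_inc_def)
qed

text \<open>The kernel of \<open>cls\<close> is the smallest ideal of the free algebra containing the relations. This is the
  universal property of the restricted enveloping algebra, used later for the ideal of noncommutative
  polynomials that vanish in a truncated polynomial ring.\<close>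

lemma cls_zero_imp_mem:
  assumes Z: "ideal Z F" and rels: "env_rels \<subseteq> Z"
    and prel: "\<And>x. x \<in> carrier C \<Longrightarrow> free_gen x [^]\<^bsub>F\<^esub> p \<ominus>\<^bsub>F\<^esub> free_gen (p_map C x) \<in> Z"
    and f: "f \<in> carrier F" "cls f = \<zero>\<^bsub>A\<^esub>"
  shows "f \<in> Z"
proof -
  interpret Z: ideal Z F by (rule Z)
  have sub: "env_ideal C \<subseteq> Z"
    unfolding env_ideal_eq by (rule F.genideal_minimal[OF Z rels])
  have "ideal (cls0 ` Z) (env_alg C)"
    using F.ring_ideal_imp_quot_ideal[OF EI.ideal_axioms Z]
    by (simp add: env_alg_def cls0_def[abs_def])
  moreover have "p_rels \<subseteq> cls0 ` Z"
  proof
    fix X assume "X \<in> p_rels"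
    then obtain x where x: "x \<in> carrier C"
      and X: "X = env_inc C x [^]\<^bsub>env_alg C\<^esub> p \<ominus>\<^bsub>env_alg C\<^esub> env_inc C (p_map C x)"
      by (auto simp: p_rels_def)
    have "X = cls0 (free_gen x [^]\<^bsub>F\<^esub> p \<ominus>\<^bsub>F\<^esub> free_gen (p_map C x))"
      using x by (simp add: X env_inc_eq cls0_minus free_gen_closed p_map_closed H0.hom_nat_pow)
    then show "X \<in> cls0 ` Z" using prel[OF x] by blast
  qed
  ultimately have "renv_ideal p C \<subseteq> cls0 ` Z"
    unfolding renv_ideal_def p_rels_def[symmetric] by (rule E.genideal_minimal)
  moreover have "cls0 f \<in> renv_ideal p C"
    using f renv_coset_zero_iff[of "cls0 f"] by (simp add: cls_def)
  ultimately obtain z where z: "z \<in> Z" "cls0 f = cls0 z" by blast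
  then have zc: "z \<in> carrier F" using Z.Icarr by blast
  have "cls0 (f \<ominus>\<^bsub>F\<^esub> z) = \<zero>\<^bsub>env_alg C\<^esub>"
    using z zc f by (simp add: cls0_minus E.minus_eq_zero_iff)
  then have "f \<ominus>\<^bsub>F\<^esub> z \<in> Z"
    using cls0_eq_zero_iff[of "f \<ominus>\<^bsub>F\<^esub> z"] sub f zc by blast
  then have "(f \<ominus>\<^bsub>F\<^esub> z) \<oplus>\<^bsub>F\<^esub> z \<in> Z" using z by (simp add: Z.a_closed)
  moreover have "(f \<ominus>\<^bsub>F\<^esub> z) \<oplus>\<^bsub>F\<^esub> z = f"
    using f zc by (simp add: a_minus_def F.a_assoc F.l_neg)
  ultimately show ?thesis by simp
qed

lemma scal_add: "scal (c + d) = scal c \<oplus>\<^bsub>A\<^esub> scal d"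
proof -
  have "(free_const (c + d) :: 'l list \<Rightarrow> 'k) = free_const c \<oplus>\<^bsub>F\<^esub> free_const d"
    by (simp add: fun_eq_iff free_add) (simp add: free_const_def)
  then show ?thesis by (simp add: scal_eq free_const_closed)
qed

lemma scal_mult: "scal (c * d) = scal c \<otimes>\<^bsub>A\<^esub> scal d"
proof -
  have "(free_const (c * d) :: 'l list \<Rightarrow> 'k) = free_const c \<otimes>\<^bsub>F\<^esub> free_const d"
    unfolding free_const_mult by (auto simp: fun_eq_iff free_const_def)
  then show ?thesis by (simp add: scal_eq free_const_closed)
qed

lemma scal_one: "scal 1 = \<one>\<^bsub>A\<^esub>"
  unfolding scal_eq free_one[of "carrier C", symmetric] by simp

lemma scal_zero: "scal 0 = \<zero>\<^bsub>A\<^esub>"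
proof -
  have "free_const 0 = \<zero>\<^bsub>F\<^esub>" by (simp add: fun_eq_iff free_zero free_const_def)
  then show ?thesis by (simp add: scal_eq)
qed

lemma scal_minus: "scal (- c) = \<ominus>\<^bsub>A\<^esub> scal c"
  using scal_add[of "-c" c] by (simp add: scal_zero A.minus_equality)

lemma scal_pow: "scal (c ^ n) = scal c [^]\<^bsub>A\<^esub> (n::nat)"
  by (induction n) (simp_all add: scal_one power_Suc2 scal_mult del: power_Suc)

lemma scal_of_nat: "scal (of_nat n) = [n] \<cdot>\<^bsub>A\<^esub> \<one>\<^bsub>A\<^esub>"
  by (induction n) (simp_all add: scal_zero scal_add scal_one A.a_comm)

end

section \<open>Commuting elements in prime characteristic\<close>

context ring
begin

lemma binomial_commuting:
  assumes x: "x \<in> carrier R" and y: "y \<in> carrier R" and xy: "x \<otimes> y = y \<otimes> x"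
  shows "(x \<oplus> y) [^] (n::nat) = (\<Oplus>k\<in>{..n}. [(n choose k)] \<cdot>\<^bsub>R\<^esub> (x [^] k \<otimes> y [^] (n - k)))"
proof (induction n)
  case 0
  then show ?case using x y by simp
next
  case (Suc n)
  define T where "T = (\<lambda>n k. [(n choose k)] \<cdot>\<^bsub>R\<^esub> (x [^] k \<otimes> y [^] (n - k)))"
  have T: "T n k \<in> carrier R" for n k using x y by (simp add: T_def)
  have yx: "y [^] (j::nat) \<otimes> x = x \<otimes> y [^] j" for j
  proof (induction j)
    case (Suc j)
    have "y [^] Suc j \<otimes> x = y [^] j \<otimes> (y \<otimes> x)" using x y by (simp add: m_assoc)
    also have "\<dots> = (y [^] j \<otimes> x) \<otimes> y" using x y by (simp add: m_assoc flip: xy)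
    finally show ?case using x y by (simp add: Suc m_assoc)
  qed (use x in simp)
  have step: "T (Suc n) (Suc k) = T n k \<otimes> x \<oplus> T n (Suc k) \<otimes> y" if "k \<le> n" for k
  proof -
    have 1: "T n k \<otimes> x = [(n choose k)] \<cdot>\<^bsub>R\<^esub> (x [^] Suc k \<otimes> y [^] (n - k))"
      using x y by (simp add: T_def add_pow_ldistr m_assoc yx)
    have 2: "T n (Suc k) \<otimes> y = [(n choose Suc k)] \<cdot>\<^bsub>R\<^esub> (x [^] Suc k \<otimes> y [^] (n - k))"
    proof (cases "k < n")
      case True
      then have "n - k = Suc (n - Suc k)" by simp
      then show ?thesis using x y by (simp add: T_def add_pow_ldistr m_assoc)
    next
      case False
      then show ?thesis using that x y by (simp add: T_def binomial_eq_0)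
    qed
    show ?thesis unfolding 1 2 using x y
      by (simp add: T_def add.nat_pow_mult)
  qed
  have zero: "T (Suc n) 0 = T n 0 \<otimes> y"
    using x y by (simp add: T_def)
  have "(\<Oplus>k\<in>{..Suc n}. T (Suc n) k) = (\<Oplus>k\<in>{..n}. T (Suc n) (Suc k)) \<oplus> T (Suc n) 0"
    using T by (intro finsum_Suc2) auto
  also have "(\<Oplus>k\<in>{..n}. T (Suc n) (Suc k)) = (\<Oplus>k\<in>{..n}. T n k \<otimes> x \<oplus> T n (Suc k) \<otimes> y)"
    using T x y by (intro finsum_cong') (auto simp: step)
  also have "\<dots> = (\<Oplus>k\<in>{..n}. T n k \<otimes> x) \<oplus> (\<Oplus>k\<in>{..n}. T n (Suc k) \<otimes> y)"
    using T x y by (intro finsum_addf) auto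
  also have "\<dots> \<oplus> T (Suc n) 0
      = (\<Oplus>k\<in>{..n}. T n k \<otimes> x) \<oplus> ((\<Oplus>k\<in>{..n}. T n (Suc k) \<otimes> y) \<oplus> T n 0 \<otimes> y)"
    using T x y by (subst zero, subst a_assoc) (auto intro!: finsum_closed)
  also have "(\<Oplus>k\<in>{..n}. T n (Suc k) \<otimes> y) \<oplus> T n 0 \<otimes> y = (\<Oplus>k\<in>{..Suc n}. T n k \<otimes> y)"
    using T y by (subst finsum_Suc2) auto
  also have "\<dots> = (\<Oplus>k\<in>{..n}. T n k \<otimes> y)"
  proof -
    have "T n (Suc n) \<otimes> y = \<zero>" using x y by (simp add: T_def binomial_eq_0)
    then show ?thesis using T y by (subst finsum_Suc) auto
  qed
  also have "(\<Oplus>k\<in>{..n}. T n k \<otimes> x) \<oplus> (\<Oplus>k\<in>{..n}. T n k \<otimes> y)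
      = (\<Oplus>k\<in>{..n}. T n k) \<otimes> x \<oplus> (\<Oplus>k\<in>{..n}. T n k) \<otimes> y"
    using T x y by (simp add: finsum_ldistr)
  also have "\<dots> = (\<Oplus>k\<in>{..n}. T n k) \<otimes> (x \<oplus> y)"
    using T x y by (simp add: r_distr finsum_closed)
  finally show ?case
    using Suc unfolding T_def by simp
qed

text \<open>The inner binomial coefficients are divisible by \<open>p\<close>. Only the two elements are required to commute, as
  the statement is also applied to matrices.\<close>

lemma freshmans_dream_commuting:
  assumes p: "prime p" and char: "[(p::nat)] \<cdot>\<^bsub>R\<^esub> \<one> = \<zero>"
    and x: "x \<in> carrier R" and y: "y \<in> carrier R" and xy: "x \<otimes> y = y \<otimes> x"
  shows "(x \<oplus> y) [^] p = x [^] p \<oplus> y [^] p"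
proof -
  define T where "T = (\<lambda>k. [(p choose k)] \<cdot>\<^bsub>R\<^esub> (x [^] k \<otimes> y [^] (p - k)))"
  have T: "T k \<in> carrier R" for k using x y by (simp add: T_def)
  have kill: "[(p * q)] \<cdot>\<^bsub>R\<^esub> z = \<zero>" if "z \<in> carrier R" for z and q :: nat
  proof -
    have "[p] \<cdot>\<^bsub>R\<^esub> z = ([p] \<cdot>\<^bsub>R\<^esub> \<one>) \<otimes> z" using that by (simp add: add_pow_ldistr)
    then have "[p] \<cdot>\<^bsub>R\<^esub> z = \<zero>" using that char by simp
    then show ?thesis using that by (simp flip: add.nat_pow_pow)
  qed
  have vanish: "T k = \<zero>" if "k \<noteq> 0" "k < p" for k
  proof -
    have "p dvd (p choose k)" using that p by (intro dvd_choose_prime) auto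
    then show ?thesis using x y by (auto simp: T_def kill elim!: dvdE)
  qed
  obtain n where n: "p = Suc n" using p by (metis not_prime_0 old.nat.exhaust)
  have "(x \<oplus> y) [^] p = (\<Oplus>k\<in>{..p}. T k)"
    unfolding T_def by (rule binomial_commuting[OF x y xy])
  also have "\<dots> = T (Suc n) \<oplus> (\<Oplus>k\<in>{..n}. T k)"
    unfolding n using T by (simp add: finsum_Suc)
  also have "(\<Oplus>k\<in>{..n}. T k) = (\<Oplus>k\<in>{..n}. if 0 = k then T k else \<zero>)"
    using T by (intro finsum_cong') (auto simp: vanish n)
  also have "\<dots> = T 0"
    using T by (intro finsum_singleton) auto
  finally show ?thesis using x y n by (simp add: T_def)
qed

end

section \<open>The current algebra of a toral Lie algebra\<close>

text \<open>The properties of the Lie algebra of a torus on which everything depends. A finite-dimensional abelian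
  restricted Lie algebra over an algebraically closed field is toral, that is, spanned by elements \<open>h\<close> with
  \<open>h^[p] = h\<close>, exactly when its \<open>p\<close>-map is injective; injectivity is the form of torality used here.\<close>

locale toral_lie =
  fixes p m :: nat and L :: "('k::alg_closed_field, 'l) restricted_lie"
  assumes vs: "vectorspace class_ring L"
    and fin: "vectorspace.fin_dim class_ring L"
    and char: "CHAR('k) = p" "p > 0"
    and bracket: "\<And>x y. x \<in> carrier L \<Longrightarrow> y \<in> carrier L \<Longrightarrow> lie_bracket L x y = \<zero>\<^bsub>L\<^esub>"
    and frob_closed: "\<And>x. x \<in> carrier L \<Longrightarrow> p_map L x \<in> carrier L"
    and frob_add: "\<And>x y. x \<in> carrier L \<Longrightarrow> y \<in> carrier L \<Longrightarrow>
        p_map L (x \<oplus>\<^bsub>L\<^esub> y) = p_map L x \<oplus>\<^bsub>L\<^esub> p_map L y"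
    and frob_smult: "\<And>c x. x \<in> carrier L \<Longrightarrow> p_map L (c \<odot>\<^bsub>L\<^esub> x) = c ^ p \<odot>\<^bsub>L\<^esub> p_map L x"
    and frob_inj: "\<And>x. x \<in> carrier L \<Longrightarrow> p_map L x = \<zero>\<^bsub>L\<^esub> \<Longrightarrow> x = \<zero>\<^bsub>L\<^esub>"
begin

sublocale L: vectorspace class_ring L by (rule vs)

lemma prime_p: "prime p"
  using prime_CHAR_semidom[where ?'a='k] char by simp

lemma class_ring_carrier [simp]: "c \<in> carrier class_ring"
  by (simp add: class_ring_simps)

lemma smult_closed [simp]: "x \<in> carrier L \<Longrightarrow> c \<odot>\<^bsub>L\<^esub> x \<in> carrier L"
  by (rule L.smult_closed) simp_all

abbreviation "C \<equiv> current_lie p m L"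

lemma current_carrier: "x \<in> carrier C \<longleftrightarrow> (\<forall>i\<le>m. x i \<in> carrier L) \<and> (\<forall>i>m. x i = \<zero>\<^bsub>L\<^esub>)"
  by (simp add: current_lie_def)

lemma current_component: "x \<in> carrier C \<Longrightarrow> x i \<in> carrier L"
  by (cases "i \<le> m") (auto simp: current_carrier)

lemma current_zero: "\<zero>\<^bsub>C\<^esub> = (\<lambda>i. \<zero>\<^bsub>L\<^esub>)"
  and current_add: "x \<oplus>\<^bsub>C\<^esub> y = (\<lambda>i. x i \<oplus>\<^bsub>L\<^esub> y i)"
  and current_smult: "c \<odot>\<^bsub>C\<^esub> x = (\<lambda>i. c \<odot>\<^bsub>L\<^esub> x i)"
  and current_p_map: "p_map C x = (\<lambda>j. if j \<le> m \<and> p dvd j then p_map L (x (j div p)) else \<zero>\<^bsub>L\<^esub>)"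
  by (simp_all add: current_lie_def)

lemma zero_smult [simp]: "c \<odot>\<^bsub>L\<^esub> \<zero>\<^bsub>L\<^esub> = \<zero>\<^bsub>L\<^esub>"
  by (rule L.smult_r_null) simp

lemma frob_zero [simp]: "p_map L \<zero>\<^bsub>L\<^esub> = \<zero>\<^bsub>L\<^esub>"
  using frob_add[of "\<zero>\<^bsub>L\<^esub>" "\<zero>\<^bsub>L\<^esub>"] frob_closed[of "\<zero>\<^bsub>L\<^esub>"] by simp

lemma current_bracket:
  assumes "x \<in> carrier C" "y \<in> carrier C"
  shows "lie_bracket C x y = \<zero>\<^bsub>C\<^esub>"
proof -
  have "(\<Oplus>\<^bsub>L\<^esub>i\<in>{..k}. lie_bracket L (x i) (y (k - i))) = \<zero>\<^bsub>L\<^esub>" for k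
    using assms by (intro L.add.finprod_one_eqI) (simp add: bracket current_component)
  then show ?thesis by (simp add: current_lie_def fun_eq_iff)
qed

sublocale restricted_data p C
proof
  fix x y assume x: "x \<in> carrier C" and y: "y \<in> carrier C"
  show "x \<oplus>\<^bsub>C\<^esub> y \<in> carrier C" using x y by (simp add: current_carrier current_add)
  show "lie_bracket C x y \<in> carrier C"
    unfolding current_bracket[OF x y] by (simp add: current_carrier current_zero)
next
  fix c x assume x: "x \<in> carrier C"
  show "c \<odot>\<^bsub>C\<^esub> x \<in> carrier C" using x by (simp add: current_carrier current_smult)
next
  fix x assume x: "x \<in> carrier C"
  show "p_map C x \<in> carrier C"
    unfolding current_carrier current_p_map using current_component[OF x] by (auto intro: frob_closed)
qed

lemma inc_zero: "inc \<zero>\<^bsub>C\<^esub> = \<zero>\<^bsub>A\<^esub>"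
proof -
  have z: "\<zero>\<^bsub>C\<^esub> \<in> carrier C" by (simp add: current_carrier current_zero)
  have "\<zero>\<^bsub>C\<^esub> \<oplus>\<^bsub>C\<^esub> \<zero>\<^bsub>C\<^esub> = \<zero>\<^bsub>C\<^esub>" by (simp add: current_zero current_add)
  with inc_add[OF z z] have "inc \<zero>\<^bsub>C\<^esub> \<oplus>\<^bsub>A\<^esub> inc \<zero>\<^bsub>C\<^esub> = inc \<zero>\<^bsub>C\<^esub>" by simp
  then show ?thesis using A.add.l_cancel_one[of "inc \<zero>\<^bsub>C\<^esub>" "inc \<zero>\<^bsub>C\<^esub>"] z by simp
qed

lemma inc_commute:
  assumes "x \<in> carrier C" "y \<in> carrier C"
  shows "inc x \<otimes>\<^bsub>A\<^esub> inc y = inc y \<otimes>\<^bsub>A\<^esub> inc x"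
  using inc_bracket[OF assms] assms by (simp add: current_bracket inc_zero A.minus_eq_zero_iff)

lemma scal_central:
  assumes "a \<in> carrier A"
  shows "scal c \<otimes>\<^bsub>A\<^esub> a = a \<otimes>\<^bsub>A\<^esub> scal c"
proof -
  obtain f where f: "f \<in> carrier F" "a = cls f" using cls_surj[OF assms] by blast
  have "free_const c \<otimes>\<^bsub>F\<^esub> f = f \<otimes>\<^bsub>F\<^esub> free_const c"
    by (simp add: free_const_mult free_mult_const mult.commute)
  then show ?thesis using f by (simp add: scal_eq free_const_closed flip: H.hom_mult)
qed

lemma alg_induct [consumes 1, case_names scal add inc]:
  assumes a: "a \<in> carrier A"
    and c: "\<And>c. P (scal c)"
    and s: "\<And>a b. a \<in> carrier A \<Longrightarrow> b \<in> carrier A \<Longrightarrow> P a \<Longrightarrow> P b \<Longrightarrow> P (a \<oplus>\<^bsub>A\<^esub> b)"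
    and g: "\<And>x a. x \<in> carrier C \<Longrightarrow> a \<in> carrier A \<Longrightarrow> P a \<Longrightarrow> P (inc x \<otimes>\<^bsub>A\<^esub> a)"
  shows "P a"
proof -
  obtain f where f: "f \<in> carrier F" "a = cls f" using cls_surj[OF a] by blast
  have "P (cls f)" using f(1)
  proof (induction f rule: free_alg_induct)
    case (const c)
    then show ?case using c[of c] by (simp add: scal_eq)
  next
    case (add f g)
    then show ?case using s by simp
  next
    case (gen x f)
    then show ?case using g[of x "cls f"] by (simp add: inc_eq free_gen_closed)
  qed
  then show ?thesis using f by simp
qed

lemma inc_central:
  assumes "x \<in> carrier C" "a \<in> carrier A"
  shows "inc x \<otimes>\<^bsub>A\<^esub> a = a \<otimes>\<^bsub>A\<^esub> inc x"
  using assms(2)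
proof (induction a rule: alg_induct)
  case (scal c)
  then show ?case using assms(1) by (simp add: scal_central)
next
  case (add a b)
  then show ?case using assms(1) by (simp add: A.r_distr A.l_distr)
next
  case (inc y a)
  have "inc x \<otimes>\<^bsub>A\<^esub> (inc y \<otimes>\<^bsub>A\<^esub> a) = (inc x \<otimes>\<^bsub>A\<^esub> inc y) \<otimes>\<^bsub>A\<^esub> a"
    using inc assms(1) by (simp add: A.m_assoc)
  also have "\<dots> = inc y \<otimes>\<^bsub>A\<^esub> (inc x \<otimes>\<^bsub>A\<^esub> a)"
    unfolding inc_commute[OF assms(1) inc(1)] using inc(1,2) assms(1) by (simp add: A.m_assoc)
  also have "\<dots> = inc y \<otimes>\<^bsub>A\<^esub> (a \<otimes>\<^bsub>A\<^esub> inc x)"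
    by (simp only: inc.IH)
  finally show ?case using inc(1,2) assms(1) by (simp add: A.m_assoc)
qed

text \<open>The bracket of the current algebra vanishes, so the generators commute with each other, and the
  centralizer of any set is a subalgebra.\<close>

lemma A_comm:
  assumes "a \<in> carrier A" "b \<in> carrier A"
  shows "a \<otimes>\<^bsub>A\<^esub> b = b \<otimes>\<^bsub>A\<^esub> a"
  using assms(1)
proof (induction a rule: alg_induct)
  case (scal c)
  then show ?case using assms(2) by (simp add: scal_central)
next
  case (add a b)
  then show ?case using assms(2) by (simp add: A.r_distr A.l_distr)
next
  case (inc x a)
  have "(inc x \<otimes>\<^bsub>A\<^esub> a) \<otimes>\<^bsub>A\<^esub> b = inc x \<otimes>\<^bsub>A\<^esub> (b \<otimes>\<^bsub>A\<^esub> a)"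
    using inc assms(2) by (simp add: A.m_assoc)
  also have "\<dots> = b \<otimes>\<^bsub>A\<^esub> (inc x \<otimes>\<^bsub>A\<^esub> a)"
    using inc assms(2) by (simp add: inc_central[of x b] flip: A.m_assoc)
  finally show ?case .
qed

sublocale A: cring A
  by (intro cring.intro comm_monoid.intro comm_monoid_axioms.intro A.ring_axioms
      A.monoid_axioms A_comm)

lemma A_char: "[p] \<cdot>\<^bsub>A\<^esub> \<one>\<^bsub>A\<^esub> = \<zero>\<^bsub>A\<^esub>"
proof -
  have "(of_nat p :: 'k) = 0" unfolding char(1)[symmetric] by simp
  then show ?thesis using scal_of_nat[of p] by (simp add: scal_zero)
qed

lemma A_frob_add:
  "a \<in> carrier A \<Longrightarrow> b \<in> carrier A \<Longrightarrow> (a \<oplus>\<^bsub>A\<^esub> b) [^]\<^bsub>A\<^esub> p = a [^]\<^bsub>A\<^esub> p \<oplus>\<^bsub>A\<^esub> b [^]\<^bsub>A\<^esub> p"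
  using A.freshmans_dream_commuting[OF prime_p A_char] A_comm by blast

lemma A_frob_minus:
  assumes "a \<in> carrier A" "b \<in> carrier A"
  shows "(a \<ominus>\<^bsub>A\<^esub> b) [^]\<^bsub>A\<^esub> p = a [^]\<^bsub>A\<^esub> p \<ominus>\<^bsub>A\<^esub> b [^]\<^bsub>A\<^esub> p"
proof -
  have "a = (a \<ominus>\<^bsub>A\<^esub> b) \<oplus>\<^bsub>A\<^esub> b"
    using assms by (simp add: a_minus_def A.a_assoc A.l_neg)
  then have "a [^]\<^bsub>A\<^esub> p = (a \<ominus>\<^bsub>A\<^esub> b) [^]\<^bsub>A\<^esub> p \<oplus>\<^bsub>A\<^esub> b [^]\<^bsub>A\<^esub> p"
    using A_frob_add[of "a \<ominus>\<^bsub>A\<^esub> b" b] assms by simp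
  then show ?thesis
    using assms by (simp add: a_minus_def A.a_assoc A.r_neg)
qed

end

section \<open>Bases adapted to the p-map\<close>

context toral_lie
begin

abbreviation "Fr \<equiv> p_map L"

lemma frob_finsum:
  assumes "finite I" "f \<in> I \<rightarrow> carrier L"
  shows "Fr (\<Oplus>\<^bsub>L\<^esub>i\<in>I. f i) = (\<Oplus>\<^bsub>L\<^esub>i\<in>I. Fr (f i))"
  using assms
proof (induction I rule: finite_induct)
  case (insert i I)
  then have f: "f \<in> I \<rightarrow> carrier L" "f i \<in> carrier L" by auto
  then have "(\<lambda>i. Fr (f i)) \<in> I \<rightarrow> carrier L" using frob_closed by auto
  then show ?case using insert f
    by (simp add: L.M.finsum_insert frob_add frob_closed L.M.finsum_closed)
qed simp

lemma frob_eqD: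
  assumes "x \<in> carrier L" "y \<in> carrier L" "Fr x = Fr y"
  shows "x = y"
proof -
  have "x = (x \<ominus>\<^bsub>L\<^esub> y) \<oplus>\<^bsub>L\<^esub> y"
    using assms by (simp add: a_minus_def L.M.a_assoc L.M.l_neg)
  then have "Fr x = Fr (x \<ominus>\<^bsub>L\<^esub> y) \<oplus>\<^bsub>L\<^esub> Fr y"
    using frob_add[of "x \<ominus>\<^bsub>L\<^esub> y" y] assms by simp
  then have "Fr (x \<ominus>\<^bsub>L\<^esub> y) = \<zero>\<^bsub>L\<^esub>"
    using assms L.M.add.l_cancel_one'[of "Fr y" "Fr (x \<ominus>\<^bsub>L\<^esub> y)"]
    by (simp add: frob_closed L.M.a_comm)
  then have "x \<ominus>\<^bsub>L\<^esub> y = \<zero>\<^bsub>L\<^esub>" using assms frob_inj by simp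
  then show ?thesis using assms by (simp add: L.M.minus_eq_zero_iff)
qed

lemma frob_inj_on: "S \<subseteq> carrier L \<Longrightarrow> inj_on Fr S"
  by (rule inj_onI) (use frob_eqD in blast)

lemma frob_pow_closed: "x \<in> carrier L \<Longrightarrow> (Fr ^^ k) x \<in> carrier L"
  by (induction k) (auto intro: frob_closed)

text \<open>The field is perfect, so an injective Frobenius-semilinear map preserves linear independence.\<close>

lemma frob_lin_indpt:
  assumes B: "finite B" "B \<subseteq> carrier L" and li: "L.lin_indpt B"
  shows "L.lin_indpt (Fr ` B)"
proof (rule L.finite_lin_indpt2)
  show "finite (Fr ` B)" "Fr ` B \<subseteq> carrier L" using B frob_closed by auto
  fix a assume "L.lincomb a (Fr ` B) = \<zero>\<^bsub>L\<^esub>"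
  then have 0: "(\<Oplus>\<^bsub>L\<^esub>b\<in>B. a (Fr b) \<odot>\<^bsub>L\<^esub> Fr b) = \<zero>\<^bsub>L\<^esub>"
    unfolding L.lincomb_def using B frob_inj_on[OF B(2)] frob_closed
    by (subst (asm) L.M.finsum_reindex) auto
  have p: "p > 0" using char by simp
  \<comment> \<open>The field is perfect: a relation among the images is the image of the relation with the \<open>p\<close>-th roots as coefficients.\<close>
  define r where "r = (\<lambda>b. SOME y. y ^ p = a (Fr b))"
  have r: "r b ^ p = a (Fr b)" for b
    unfolding r_def using someI_ex[OF nth_root_exists[OF p, of "a (Fr b)"]] .
  have "Fr (L.lincomb r B) = (\<Oplus>\<^bsub>L\<^esub>b\<in>B. Fr (r b \<odot>\<^bsub>L\<^esub> b))"
    unfolding L.lincomb_def using B by (intro frob_finsum) auto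
  also have "\<dots> = (\<Oplus>\<^bsub>L\<^esub>b\<in>B. a (Fr b) \<odot>\<^bsub>L\<^esub> Fr b)"
    using B frob_closed by (intro L.M.finsum_cong') (auto simp: frob_smult r)
  finally have "Fr (L.lincomb r B) = \<zero>\<^bsub>L\<^esub>" using 0 by simp
  moreover have "r \<in> B \<rightarrow> carrier class_ring" by simp
  ultimately have zero: "L.lincomb r B = \<zero>\<^bsub>L\<^esub>"
    using frob_inj[OF L.lincomb_closed[OF B(2)]] by blast
  have "r b = 0" if "b \<in> B" for b
  proof (rule ccontr)
    assume "r b \<noteq> 0"
    then have "L.lin_dep B"
      using L.lin_dep_crit[OF B(1) order_refl _ that, of r] zero
      by (simp add: class_ring_simps)
    with li show False by simp
  qed
  then have "a (Fr b) = 0" if "b \<in> B" for b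
    using r[of b] that p by (simp add: power_0_left)
  then show "\<forall>v\<in>Fr ` B. a v = \<zero>\<^bsub>class_ring\<^esub>" by (simp add: class_ring_simps)
qed

lemma subset_span_of_max_card:
  assumes S: "S \<subseteq> carrier L" and B: "B \<subseteq> S" "L.lin_indpt B"
    and max: "\<And>B'. B' \<subseteq> S \<Longrightarrow> L.lin_indpt B' \<Longrightarrow> card B' \<le> card B"
  shows "S \<subseteq> L.span B"
proof
  fix v assume v: "v \<in> S"
  have fB: "finite B" using L.fin_dim_li_fin[OF fin B(2)] B S by blast
  show "v \<in> L.span B"
  proof (cases "v \<in> B")
    case True
    then show ?thesis using L.in_own_span[of B] B S by blast
  next
    case False
    have "\<not> card (B \<union> {v}) \<le> card B" using False fB by simp
    then have "L.lin_dep (B \<union> {v})" using max[of "B \<union> {v}"] B v by blast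
    then show ?thesis using L.lin_dep_iff_in_span[of B v] B S v False by blast
  qed
qed

text \<open>Toral elements are separable over the Frobenius: \<open>h\<close> lies in the span of its proper
  \<open>p\<close>-power iterates, because the images of a maximal independent family of iterates are again such
  a family.\<close>

lemma mem_span_frob_orbit:
  assumes h: "h \<in> carrier L"
  shows "h \<in> L.span {(Fr ^^ i) h | i. i \<ge> 1}"
proof -
  define S where "S = {(Fr ^^ i) h | i. True}"
  have S: "S \<subseteq> carrier L" using h frob_pow_closed by (auto simp: S_def)
  have "\<exists>B. (B \<subseteq> S \<and> L.lin_indpt B) \<and> (\<forall>B'. B' \<subseteq> S \<and> L.lin_indpt B' \<longrightarrow> card B' \<le> card B)"
  proof (rule ex_has_greatest_nat[where P = "\<lambda>B. B \<subseteq> S \<and> L.lin_indpt B" and f = card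
        and k = "{}" and b = "Suc L.dim"])
    show "{} \<subseteq> S \<and> L.lin_indpt {}" by (simp add: L.lin_dep_def)
    show "\<forall>B'. B' \<subseteq> S \<and> L.lin_indpt B' \<longrightarrow> card B' < Suc L.dim"
      using L.li_le_dim(2)[OF fin] S by (auto simp: less_Suc_eq_le)
  qed
  then obtain B where B: "B \<subseteq> S" "L.lin_indpt B"
    and max: "\<And>B'. B' \<subseteq> S \<Longrightarrow> L.lin_indpt B' \<Longrightarrow> card B' \<le> card B" by blast
  have fB: "finite B" using L.fin_dim_li_fin[OF fin B(2)] B S by blast
  have im: "Fr ` B \<subseteq> {(Fr ^^ i) h | i. i \<ge> 1}"
  proof
    fix y assume "y \<in> Fr ` B"
    then obtain i where "y = Fr ((Fr ^^ i) h)" using B(1) by (auto simp: S_def)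
    then have "y = (Fr ^^ Suc i) h" by simp
    then show "y \<in> {(Fr ^^ i) h | i. i \<ge> 1}" by (intro CollectI exI[of _ "Suc i"]) simp
  qed
  then have sub: "Fr ` B \<subseteq> S" by (auto simp: S_def)
  have li: "L.lin_indpt (Fr ` B)" using frob_lin_indpt[OF fB] B S by blast
  have "card (Fr ` B) = card B"
    using B S by (intro card_image frob_inj_on) auto
  then have "S \<subseteq> L.span (Fr ` B)"
    using subset_span_of_max_card[OF S sub li] max by simp
  moreover have "h \<in> S" unfolding S_def by (intro CollectI exI[of _ 0]) simp
  ultimately have "h \<in> L.span (Fr ` B)" by blast
  then show ?thesis using L.span_is_monotone[OF im] by blast
qed

end

text \<open>The \<open>p^k\<close>-th powers of a fixed basis \<open>B\<close> form a basis for every \<open>k\<close>. Passing from the \<open>k\<close>-th to the next of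
  these bases turns the \<open>p\<close>-map into raising coordinates to the \<open>p\<close>-th power.\<close>

locale toral_lie_basis = toral_lie p m L
  for p m :: nat and L :: "('k::alg_closed_field, 'l) restricted_lie" +
  fixes B :: "'l set"
  assumes fB: "finite B" and basis: "vectorspace.basis class_ring L B"
begin

lemma B_carrier: "B \<subseteq> carrier L" using basis by (simp add: L.basis_def)

lemma card_B: "card B = L.dim"
  using L.dim_basis[OF fB basis] by simp

lemma frob_pow_basis: "L.basis ((Fr ^^ k) ` B) \<and> inj_on (Fr ^^ k) B"
proof (induction k)
  case 0
  then show ?case using basis by (simp add: inj_on_def)
next
  case (Suc k)
  let ?B = "(Fr ^^ k) ` B"
  have im: "(Fr ^^ Suc k) ` B = Fr ` ?B" by (simp add: image_comp)
  have c: "?B \<subseteq> carrier L" using B_carrier frob_pow_closed by auto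
  have inj: "inj_on (Fr ^^ Suc k) B"
    using Suc frob_inj_on[OF c] by (simp add: comp_inj_on)
  have "L.basis (Fr ` ?B)"
  proof (rule L.dim_li_is_basis[OF fin])
    show "Fr ` ?B \<subseteq> carrier L" using c frob_closed by auto
    show "L.lin_indpt (Fr ` ?B)"
      using Suc fB c by (intro frob_lin_indpt) (auto simp: L.basis_def)
    show "L.dim \<le> card (Fr ` ?B)" using card_image[OF inj] card_B im by simp
  qed (use fB in simp)
  then have "L.basis ((Fr ^^ Suc k) ` B)" by (simp only: im)
  with inj show ?case by blast
qed

definition comb :: "nat \<Rightarrow> ('l \<Rightarrow> 'k) \<Rightarrow> 'l" where
  "comb k a = (\<Oplus>\<^bsub>L\<^esub>b\<in>B. a b \<odot>\<^bsub>L\<^esub> (Fr ^^ k) b)"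

lemma terms_closed [simp]: "b \<in> B \<Longrightarrow> (Fr ^^ k) b \<in> carrier L"
  using B_carrier frob_pow_closed by blast

lemma comb_closed: "comb k a \<in> carrier L"
  unfolding comb_def by (intro L.M.finsum_closed) auto

lemma comb_eq_lincomb: "comb k (\<lambda>b. a ((Fr ^^ k) b)) = L.lincomb a ((Fr ^^ k) ` B)"
  unfolding comb_def L.lincomb_def using frob_pow_basis[of k]
  by (subst L.M.finsum_reindex) auto

lemma comb_add: "comb k a \<oplus>\<^bsub>L\<^esub> comb k a' = comb k (\<lambda>b. a b + a' b)"
proof -
  have "comb k (\<lambda>b. a b + a' b) = (\<Oplus>\<^bsub>L\<^esub>b\<in>B. a b \<odot>\<^bsub>L\<^esub> (Fr ^^ k) b \<oplus>\<^bsub>L\<^esub> a' b \<odot>\<^bsub>L\<^esub> (Fr ^^ k) b)"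
    unfolding comb_def
  proof (intro L.M.finsum_cong' refl)
    fix b assume b: "b \<in> B"
    show "(a b + a' b) \<odot>\<^bsub>L\<^esub> (Fr ^^ k) b = a b \<odot>\<^bsub>L\<^esub> (Fr ^^ k) b \<oplus>\<^bsub>L\<^esub> a' b \<odot>\<^bsub>L\<^esub> (Fr ^^ k) b"
      using L.smult_l_distr[of "a b" "a' b" "(Fr ^^ k) b"] b by (simp add: class_ring_simps)
  qed auto
  then show ?thesis unfolding comb_def by (simp add: L.M.finsum_addf Pi_def)
qed

lemma comb_smult: "c \<odot>\<^bsub>L\<^esub> comb k a = comb k (\<lambda>b. c * a b)"
proof -
  have "comb k (\<lambda>b. c * a b) = (\<Oplus>\<^bsub>L\<^esub>b\<in>B. c \<odot>\<^bsub>L\<^esub> (a b \<odot>\<^bsub>L\<^esub> (Fr ^^ k) b))"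
    unfolding comb_def
  proof (intro L.M.finsum_cong' refl)
    fix b assume b: "b \<in> B"
    show "(c * a b) \<odot>\<^bsub>L\<^esub> (Fr ^^ k) b = c \<odot>\<^bsub>L\<^esub> (a b \<odot>\<^bsub>L\<^esub> (Fr ^^ k) b)"
      using L.smult_assoc1[of c "a b" "(Fr ^^ k) b"] b by (simp add: class_ring_simps)
  qed auto
  then show ?thesis unfolding comb_def using fB by (simp add: L.finsum_smult Pi_def)
qed

lemma comb_frob: "Fr (comb k a) = comb (Suc k) (\<lambda>b. a b ^ p)"
proof -
  have "Fr (comb k a) = (\<Oplus>\<^bsub>L\<^esub>b\<in>B. Fr (a b \<odot>\<^bsub>L\<^esub> (Fr ^^ k) b))"
    unfolding comb_def by (rule frob_finsum[OF fB]) auto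
  also have "\<dots> = comb (Suc k) (\<lambda>b. a b ^ p)"
    unfolding comb_def
    by (intro L.M.finsum_cong') (auto simp: frob_smult intro!: frob_closed smult_closed)
  finally show ?thesis .
qed

lemma comb_zeroD:
  assumes "comb k a = \<zero>\<^bsub>L\<^esub>" "b \<in> B"
  shows "a b = 0"
proof (rule ccontr)
  assume ab: "a b \<noteq> 0"
  note inj = frob_pow_basis[of k, THEN conjunct2]
  let ?a = "\<lambda>x. a (inv_into B (Fr ^^ k) x)"
  have "comb k a = comb k (\<lambda>b. ?a ((Fr ^^ k) b))"
    unfolding comb_def by (intro L.M.finsum_cong') (use inj in auto)
  then have "L.lincomb ?a ((Fr ^^ k) ` B) = \<zero>\<^bsub>L\<^esub>"
    using assms(1) comb_eq_lincomb[of k ?a] by simp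
  then have "L.lin_dep ((Fr ^^ k) ` B)"
    using fB assms(2) ab inj
    by (intro L.lin_dep_crit[where A="(Fr ^^ k) ` B" and a="?a" and v="(Fr ^^ k) b"])
       (auto simp: class_ring_simps)
  then show False using frob_pow_basis[of k] by (simp add: L.basis_def)
qed

lemma comb_inj:
  assumes "comb k a = comb k a'" "b \<in> B"
  shows "a b = a' b"
proof -
  have "comb k a' \<oplus>\<^bsub>L\<^esub> comb k (\<lambda>b. a b - a' b) = comb k a"
    by (simp add: comb_add)
  then have "comb k (\<lambda>b. a b - a' b) = \<zero>\<^bsub>L\<^esub>"
    using assms(1) L.M.add.l_cancel_one[of "comb k a'" "comb k (\<lambda>b. a b - a' b)"]
    by (simp add: comb_closed)
  then show ?thesis using comb_zeroD[OF _ assms(2)] by fastforce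
qed

lemma comb_surj:
  assumes "x \<in> carrier L"
  shows "\<exists>a. x = comb k a"
proof -
  have "x \<in> L.span ((Fr ^^ k) ` B)"
    using frob_pow_basis[of k] assms by (simp add: L.basis_def)
  then obtain a where "L.lincomb a ((Fr ^^ k) ` B) = x"
    using L.finite_in_span[of "(Fr ^^ k) ` B" x] fB by fastforce
  then show ?thesis using comb_eq_lincomb[of k a] by metis
qed

text \<open>Coordinates with respect to the basis formed by the \<open>p^k\<close>-th powers of \<open>B\<close>.\<close>

definition coord :: "nat \<Rightarrow> 'l \<Rightarrow> 'l \<Rightarrow> 'k" where
  "coord k x = (SOME a. x = comb k a)"

lemma comb_coord: "x \<in> carrier L \<Longrightarrow> comb k (coord k x) = x"
  unfolding coord_def using someI_ex[OF comb_surj, of x k] by simp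

lemma coord_eqI: "b \<in> B \<Longrightarrow> x = comb k a \<Longrightarrow> coord k x b = a b"
  using comb_inj[of k "coord k x" a b] comb_coord[of x k] comb_closed by simp

lemma coord_add:
  "x \<in> carrier L \<Longrightarrow> y \<in> carrier L \<Longrightarrow> b \<in> B \<Longrightarrow> coord k (x \<oplus>\<^bsub>L\<^esub> y) b = coord k x b + coord k y b"
  by (rule coord_eqI) (simp_all add: comb_coord flip: comb_add)

lemma coord_smult:
  "x \<in> carrier L \<Longrightarrow> b \<in> B \<Longrightarrow> coord k (c \<odot>\<^bsub>L\<^esub> x) b = c * coord k x b"
  by (rule coord_eqI) (simp_all add: comb_coord flip: comb_smult)

lemma coord_frob:
  "x \<in> carrier L \<Longrightarrow> b \<in> B \<Longrightarrow> coord (Suc k) (Fr x) b = coord k x b ^ p"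
  by (rule coord_eqI) (simp_all add: comb_coord flip: comb_frob)

lemma coord_zero: "b \<in> B \<Longrightarrow> coord k \<zero>\<^bsub>L\<^esub> b = 0"
  using coord_smult[of "\<zero>\<^bsub>L\<^esub>" b k 0] by simp

lemma coord_basis:
  assumes "b \<in> B" "c \<in> B"
  shows "coord k ((Fr ^^ k) b) c = (if c = b then 1 else 0)"
proof (rule coord_eqI[OF assms(2)])
  have "comb k (\<lambda>c. if c = b then 1 else 0) = (\<Oplus>\<^bsub>L\<^esub>c\<in>B. if b = c then (Fr ^^ k) c else \<zero>\<^bsub>L\<^esub>)"
    unfolding comb_def
  proof (intro L.M.finsum_cong' refl)
    fix c assume c: "c \<in> B"
    then show "(if c = b then 1 else 0) \<odot>\<^bsub>L\<^esub> (Fr ^^ k) c = (if b = c then (Fr ^^ k) c else \<zero>\<^bsub>L\<^esub>)"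
      using L.smult_l_null[of "(Fr ^^ k) c"] L.smult_one[of "(Fr ^^ k) c"]
      by (auto simp: class_ring_simps)
  qed auto
  also have "\<dots> = (Fr ^^ k) b" using assms(1) fB by (intro L.M.finsum_singleton) auto
  finally show "(Fr ^^ k) b = comb k (\<lambda>c. if c = b then 1 else 0)" by simp
qed

end

section \<open>The truncated polynomial algebra\<close>

lemma CHAR_poly_mapping: "CHAR('m::comm_monoid_add \<Rightarrow>\<^sub>0 'k::comm_ring_1) = CHAR('k)"
proof (rule CHAR_eqI)
  show "of_nat CHAR('k) = (0 :: 'm \<Rightarrow>\<^sub>0 'k)"
    by (simp flip: single_of_nat)
next
  fix n assume "of_nat n = (0 :: 'm \<Rightarrow>\<^sub>0 'k)"
  then have "Poly_Mapping.lookup (of_nat n :: 'm \<Rightarrow>\<^sub>0 'k) 0 = 0" by simp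
  then show "CHAR('k) dvd n" by (simp add: lookup_of_nat of_nat_eq_0_iff_char_dvd)
qed

lemma single_power: "Poly_Mapping.single (M::'a multiset) (1::'k::comm_ring_1) ^ n
    = Poly_Mapping.single (repeat_mset n M) 1"
  by (induction n) (simp_all add: mult_single flip: single_one)

lemma single_0_power: "Poly_Mapping.single 0 (c::'k::comm_ring_1) ^ n
    = (Poly_Mapping.single 0 (c ^ n) :: 'm::comm_monoid_add \<Rightarrow>\<^sub>0 'k)"
  by (induction n) (simp_all add: mult_single)

lemma free_eval_zero: "free_eval \<phi> \<zero>\<^bsub>free_alg S\<^esub> = 0"
  unfolding free_eval_def by (simp add: free_zero)

lemma free_eval_uminus:
  assumes "f \<in> carrier (free_alg S)"
  shows "free_eval \<phi> (\<ominus>\<^bsub>free_alg S\<^esub> f) = - free_eval \<phi> f"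
proof -
  interpret F: ring "free_alg S" by (rule free_alg_ring)
  have "free_eval \<phi> (\<ominus>\<^bsub>free_alg S\<^esub> f \<oplus>\<^bsub>free_alg S\<^esub> f) = 0"
    using assms by (simp add: F.l_neg free_eval_zero)
  then show ?thesis
    using assms by (simp add: free_eval_add[where S=S] eq_neg_iff_add_eq_0)
qed

text \<open>Every degree \<open>j > 0\<close> is uniquely \<open>i * p ^ s\<close> with \<open>i\<close> prime to \<open>p\<close>. Below, \<open>core j\<close> is this \<open>i\<close> and
  \<open>val j\<close> is this \<open>s\<close>.\<close>

definition coprime_part :: "nat \<Rightarrow> nat \<Rightarrow> nat" where "coprime_part p j = j div p ^ multiplicity p j"

context toral_lie_basis
begin

abbreviation "val \<equiv> multiplicity p"
abbreviation "core \<equiv> coprime_part p"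

lemma p_gt_1: "p > 1" using prime_p prime_gt_1_nat by blast

lemma core_val: "core j * p ^ val j = j"
  by (simp add: coprime_part_def multiplicity_dvd)

lemma core_not_dvd: "j > 0 \<Longrightarrow> \<not> p dvd core j"
  unfolding coprime_part_def using multiplicity_decompose[of j p] p_gt_1 by simp

lemma core_pos: "j > 0 \<Longrightarrow> core j > 0"
  using core_val[of j] by (metis mult_zero_left neq0_conv)

lemma core_le: "core j \<le> j"
  by (simp add: coprime_part_def)

lemma val_times: "j > 0 \<Longrightarrow> val (p * j) = Suc (val j)"
  using p_gt_1 by (intro multiplicity_times_same) auto

lemma core_times: "j > 0 \<Longrightarrow> core (p * j) = core j"
  using p_gt_1 by (simp add: coprime_part_def val_times)

lemma val_core_eqI:
  assumes "\<not> p dvd j"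
  shows "val (j * p ^ s) = s \<and> core (j * p ^ s) = j"
proof -
  have j: "j > 0" using assms by (cases j) auto
  have "val (j * p ^ s) = s \<and> core (j * p ^ s) = j"
  proof (induction s)
    case 0
    then show ?case using assms by (simp add: coprime_part_def not_dvd_imp_multiplicity_0)
  next
    case (Suc s)
    have "j * p ^ s > 0" using j p_gt_1 by simp
    then have "val (p * (j * p ^ s)) = Suc s \<and> core (p * (j * p ^ s)) = j"
      using Suc val_times[of "j * p ^ s"] core_times[of "j * p ^ s"] by simp
    moreover have "j * p ^ Suc s = p * (j * p ^ s)" by simp
    ultimately show ?case by metis
  qed
  then show ?thesis .
qed

text \<open>The pair \<open>(b, j)\<close> stands for the element \<open>b t^j\<close>. Degrees divisible by \<open>p\<close> are left out because
  \<open>b^[p^s] t^(j p^s)\<close> is the \<open>p^s\<close>-th power of \<open>b t^j\<close>.\<close>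

definition Gens :: "('l \<times> nat) set" where
  "Gens = B \<times> {j. 0 < j \<and> j \<le> m \<and> \<not> p dvd j}"

text \<open>The least \<open>s\<close> with \<open>j * p ^ s > m\<close>, so that \<open>p ^ height j\<close> is the nilpotency exponent of \<open>b t^j\<close>. Counting the
  smaller exponents instead makes the sum of all heights a count of degrees.\<close>

definition height :: "nat \<Rightarrow> nat" where "height j = card {s. j * p ^ s \<le> m}"

text \<open>Monomials in the generators, encoded by the multiset of their factors, in which no generator reaches its
  nilpotency exponent.\<close>

definition box :: "('l \<times> nat) multiset set" where
  "box = {M. set_mset M \<subseteq> Gens \<and> (\<forall>g. count M g < p ^ height (snd g))}"

lemma finite_Gens: "finite Gens"
  using fB by (auto simp: Gens_def intro: finite_subset[of _ "{..m}"])

lemma finite_levels: "j > 0 \<Longrightarrow> finite {s. j * p ^ s \<le> m}"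
proof (rule finite_subset[of _ "{..m}"])
  assume j: "j > 0"
  show "{s. j * p ^ s \<le> m} \<subseteq> {..m}"
  proof
    fix s assume "s \<in> {s. j * p ^ s \<le> m}"
    moreover have "s < p ^ s" using p_gt_1 by (simp add: power_gt_expt)
    moreover have "p ^ s \<le> j * p ^ s" using j by simp
    ultimately show "s \<in> {..m}" unfolding mem_Collect_eq atMost_iff by linarith
  qed
qed simp

lemma height_le:
  assumes "j * p ^ s > m" shows "height j \<le> s"
proof -
  have "{t. j * p ^ t \<le> m} \<subseteq> {..<s}"
  proof
    fix t assume t: "t \<in> {t. j * p ^ t \<le> m}"
    show "t \<in> {..<s}"
    proof (rule ccontr)
      assume "t \<notin> {..<s}"
      then have "p ^ s \<le> p ^ t" using p_gt_1 by (intro power_increasing) auto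
      then have "j * p ^ s \<le> j * p ^ t" by (rule mult_le_mono2)
      moreover have "j * p ^ t \<le> m" using t by simp
      ultimately show False using assms by linarith
    qed
  qed
  from card_mono[OF _ this] show ?thesis by (simp add: height_def)
qed

lemma level_imp_height:
  assumes "j > 0" "j * p ^ s \<le> m" shows "s < height j"
proof -
  have "{..s} \<subseteq> {t. j * p ^ t \<le> m}"
  proof
    fix t assume "t \<in> {..s}"
    then have "p ^ t \<le> p ^ s" using p_gt_1 by (intro power_increasing) auto
    then have "j * p ^ t \<le> j * p ^ s" by (rule mult_le_mono2)
    then show "t \<in> {t. j * p ^ t \<le> m}" using assms(2) by (metis mem_Collect_eq order_trans)
  qed
  from card_mono[OF finite_levels[OF assms(1)] this] show ?thesis by (simp add: height_def)
qed

lemma height_level: "j > 0 \<Longrightarrow> j * p ^ height j > m"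
  using level_imp_height[of j "height j"] by (meson less_irrefl not_le)

text \<open>The heights count the pairs \<open>(j, s)\<close> with \<open>j\<close> prime to \<open>p\<close> and \<open>j * p ^ s\<close> between \<open>1\<close> and \<open>m\<close>, and each degree in
  this range comes from exactly one pair.\<close>

lemma sum_height: "(\<Sum>j | 0 < j \<and> j \<le> m \<and> \<not> p dvd j. height j) = m"
proof -
  let ?J = "{j. 0 < j \<and> j \<le> m \<and> \<not> p dvd j}"
  have fin: "finite ?J" by (rule finite_subset[of _ "{..m}"]) auto
  have "(\<Sum>j\<in>?J. height j) = card (Sigma ?J (\<lambda>j. {s. j * p ^ s \<le> m}))"
    unfolding height_def using fin finite_levels by (intro card_SigmaI[symmetric]) auto
  also have "\<dots> = card {1..m}"
  proof (rule bij_betw_same_card[OF bij_betw_byWitness[where f' = "\<lambda>i. (core i, val i)"]])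
    show "\<forall>a\<in>Sigma ?J (\<lambda>j. {s. j * p ^ s \<le> m}).
        (core ((\<lambda>(j, s). j * p ^ s) a), val ((\<lambda>(j, s). j * p ^ s) a)) = a"
      using val_core_eqI by auto
    show "\<forall>a'\<in>{1..m}. (\<lambda>(j, s). j * p ^ s) (core a', val a') = a'"
      by (simp add: core_val)
    show "(\<lambda>(j, s). j * p ^ s) ` Sigma ?J (\<lambda>j. {s. j * p ^ s \<le> m}) \<subseteq> {1..m}"
      using p_gt_1 by (auto simp: Suc_le_eq)
    show "(\<lambda>i. (core i, val i)) ` {1..m} \<subseteq> Sigma ?J (\<lambda>j. {s. j * p ^ s \<le> m})"
      using core_not_dvd core_pos core_val by (auto intro: order_trans[OF core_le])
  qed
  finally show ?thesis by simp
qed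

lemma card_box: "finite box \<and> card box = p ^ (m * card B)"
proof -
  let ?P = "PiE Gens (\<lambda>g. {..<p ^ height (snd g)})"
  have cnt: "count (\<Sum>g\<in>Gens. replicate_mset (f g) g) h = (if h \<in> Gens then f h else 0)"
    for f :: "'l \<times> nat \<Rightarrow> nat" and h
  proof -
    have "count (\<Sum>g\<in>Gens. replicate_mset (f g) g) h = (\<Sum>g\<in>Gens. if h = g then f g else 0)"
      unfolding count_sum by (intro sum.cong) auto
    then show ?thesis using finite_Gens by simp
  qed
  have bij: "bij_betw (\<lambda>M. restrict (count M) Gens) box ?P"
  proof (rule bij_betwI[where g = "\<lambda>f. \<Sum>g\<in>Gens. replicate_mset (f g) g"])
    show "(\<lambda>M. restrict (count M) Gens) \<in> box \<rightarrow> ?P" by (auto simp: box_def)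
    show "(\<lambda>f. \<Sum>g\<in>Gens. replicate_mset (f g) g) \<in> ?P \<rightarrow> box"
    proof
      fix f assume f: "f \<in> ?P"
      have "set_mset (\<Sum>g\<in>Gens. replicate_mset (f g) g) \<subseteq> Gens"
      proof
        fix h assume "h \<in> set_mset (\<Sum>g\<in>Gens. replicate_mset (f g) g)"
        then have "count (\<Sum>g\<in>Gens. replicate_mset (f g) g) h \<noteq> 0" by (simp add: count_eq_zero_iff)
        then show "h \<in> Gens" by (simp add: cnt split: if_splits)
      qed
      then show "(\<Sum>g\<in>Gens. replicate_mset (f g) g) \<in> box"
        using f p_gt_1 by (auto simp: box_def cnt PiE_def Pi_def)
    qed
    fix M assume M: "M \<in> box"
    show "(\<Sum>g\<in>Gens. replicate_mset (restrict (count M) Gens g) g) = M"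
    proof (rule multiset_eqI)
      fix h
      show "count (\<Sum>g\<in>Gens. replicate_mset (restrict (count M) Gens g) g) h = count M h"
        unfolding cnt using M by (cases "h \<in> Gens") (auto simp: box_def intro: count_inI)
    qed
  next
    fix f assume f: "f \<in> ?P"
    show "restrict (count (\<Sum>g\<in>Gens. replicate_mset (f g) g)) Gens = f"
      using f by (intro ext) (auto simp: cnt PiE_def extensional_def)
  qed
  have "card ?P = (\<Prod>g\<in>Gens. p ^ height (snd g))"
    using finite_Gens by (simp add: card_PiE)
  also have "\<dots> = p ^ (\<Sum>g\<in>Gens. height (snd g))"
    by (simp add: power_sum)
  also have "(\<Sum>g\<in>Gens. height (snd g)) = m * card B"
  proof -
    have "(\<Sum>g\<in>Gens. height (snd g))
        = (\<Sum>b\<in>B. \<Sum>j | 0 < j \<and> j \<le> m \<and> \<not> p dvd j. height j)"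
      unfolding Gens_def by (simp only: sum.cartesian_product) (simp add: case_prod_beta)
    then show ?thesis by (simp add: sum_height)
  qed
  finally have "card ?P = p ^ (m * card B)" .
  moreover have "finite ?P" using finite_Gens by (intro finite_PiE) auto
  ultimately show ?thesis using bij_betw_finite[OF bij] bij_betw_same_card[OF bij] by simp
qed

lemma box_downward: "M + N \<in> box \<Longrightarrow> M \<in> box"
  by (simp add: box_def) (meson add_lessD1)

lemma empty_in_box: "{#} \<in> box"
  using p_gt_1 by (simp add: box_def)

text \<open>The polynomials in the ideal spanned by the monomials outside the box. The truncated polynomial algebra is
  the quotient by this ideal; it is handled through this predicate, without forming the quotient.\<close>

definition box_null :: "(('l \<times> nat) multiset \<Rightarrow>\<^sub>0 'k) \<Rightarrow> bool" where
  "box_null P \<longleftrightarrow> (\<forall>M\<in>box. Poly_Mapping.lookup P M = 0)"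

lemma box_null_zero: "box_null 0" and box_null_add: "box_null P \<Longrightarrow> box_null Q \<Longrightarrow> box_null (P + Q)"
  and box_null_uminus: "box_null P \<Longrightarrow> box_null (- P)"
  by (simp_all add: box_null_def lookup_add)

lemma box_null_sum: "(\<And>i. i \<in> I \<Longrightarrow> box_null (f i)) \<Longrightarrow> box_null (\<Sum>i\<in>I. f i)"
  by (simp add: box_null_def lookup_sum)

text \<open>The divisors of a monomial in the box are in the box.\<close>

lemma box_null_mult: 
  assumes "box_null P" shows "box_null (P * Q)"
  unfolding box_null_def
proof
  fix M assume M: "M \<in> box"
  have "Poly_Mapping.lookup P l * (\<Sum>q. Poly_Mapping.lookup Q q when M = l + q) = 0" for l
  proof (cases "l \<in> box")
    case True
    then show ?thesis using assms by (simp add: box_null_def)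
  next
    case False
    then have "M \<noteq> l + q" for q using M box_downward by blast
    then show ?thesis by simp
  qed
  then show "Poly_Mapping.lookup (P * Q) M = 0" by (simp only: lookup_mult) simp
qed

definition Y :: "'l \<times> nat \<Rightarrow> (('l \<times> nat) multiset \<Rightarrow>\<^sub>0 'k)" where
  "Y g = Poly_Mapping.single {#g#} 1"

lemma box_null_Y_pow:
  assumes "p ^ height (snd g) \<le> n"
  shows "box_null (Y g ^ n)"
  unfolding box_null_def Y_def single_power lookup_single
proof
  fix M assume M: "M \<in> box"
  have "count (repeat_mset n {#g#}) g = n" by simp
  moreover have "count M g < p ^ height (snd g)" using M by (simp only: box_def mem_Collect_eq)
  then have "count M g < n" using assms by linarith
  ultimately have "repeat_mset n {#g#} \<noteq> M" by fastforce
  then show "((1::'k) when repeat_mset n {#g#} = M) = 0" by simp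
qed

end

section \<open>Evaluation at a weight\<close>

locale toral_weight = toral_lie_basis p m L B
  for p m :: nat and L :: "('k::alg_closed_field, 'l) restricted_lie" and B :: "'l set" +
  fixes lam :: "'l \<Rightarrow> 'k"
  assumes lam_add: "\<And>x y. x \<in> carrier L \<Longrightarrow> y \<in> carrier L \<Longrightarrow> lam (x \<oplus>\<^bsub>L\<^esub> y) = lam x + lam y"
    and lam_smult: "\<And>c x. x \<in> carrier L \<Longrightarrow> lam (c \<odot>\<^bsub>L\<^esub> x) = c * lam x"
    and lam_frob: "\<And>x. x \<in> carrier L \<Longrightarrow> lam x ^ p = lam (p_map L x)"
begin

text \<open>In degree zero \<open>phi\<close> is \<open>lam\<close>. In degree \<open>j\<close> the coefficient is expanded in the basis of \<open>p ^ val j\<close>-th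
  powers of \<open>B\<close>, and a basis element \<open>b^[p ^ val j] t^j\<close>, being the power of \<open>b t^(core j)\<close> with exponent
  \<open>p ^ val j\<close>, goes to the same power of the variable \<open>Y (b, core j)\<close>.\<close>

definition phi :: "(nat \<Rightarrow> 'l) \<Rightarrow> (('l \<times> nat) multiset \<Rightarrow>\<^sub>0 'k)" where
  "phi x = Poly_Mapping.single 0 (lam (x 0)) +
     (\<Sum>j\<in>{1..m}. \<Sum>b\<in>B. Poly_Mapping.single 0 (coord (val j) (x j) b) * Y (b, core j) ^ (p ^ val j))"

lemma phi_add:
  assumes "x \<in> carrier C" "y \<in> carrier C"
  shows "phi (x \<oplus>\<^bsub>C\<^esub> y) = phi x + phi y"
  unfolding phi_def current_add using assms
  by (simp add: current_component lam_add coord_add single_add distrib_right sum.distrib)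

lemma phi_smult:
  assumes "x \<in> carrier C"
  shows "phi (c \<odot>\<^bsub>C\<^esub> x) = Poly_Mapping.single 0 c * phi x"
  unfolding phi_def current_smult using assms
  by (simp add: current_component lam_smult coord_smult distrib_left sum_distrib_left
      mult_single mult.assoc[symmetric])

lemma phi_zero: "phi \<zero>\<^bsub>C\<^esub> = 0"
proof -
  have "\<zero>\<^bsub>C\<^esub> \<in> carrier C" by (simp add: current_carrier current_zero)
  moreover have "\<zero>\<^bsub>C\<^esub> = 0 \<odot>\<^bsub>C\<^esub> \<zero>\<^bsub>C\<^esub>" by (simp add: current_zero current_smult)
  ultimately have "phi \<zero>\<^bsub>C\<^esub> = Poly_Mapping.single 0 0 * phi \<zero>\<^bsub>C\<^esub>" using phi_smult by metis
  then show ?thesis by simp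
qed

text \<open>Both sides are sums over the degrees \<open>i\<close> of \<open>x\<close>, the Frobenius being additive. A degree \<open>i\<close> with \<open>p * i \<le> m\<close>
  contributes the same to both, by the choice of bases. A degree with \<open>p * i > m\<close> contributes nothing to the
  \<open>p\<close>-map and, to the \<open>p\<close>-th power, only monomials outside the box.\<close>

lemma phi_frob:
  assumes x: "x \<in> carrier C"
  shows "box_null (phi x ^ p - phi (p_map C x))"
proof -
  let ?s = "\<lambda>c::'k. Poly_Mapping.single 0 c :: ('l \<times> nat) multiset \<Rightarrow>\<^sub>0 'k"
  \<comment> \<open>The contribution of degree \<open>i\<close> of \<open>x\<close> to the \<open>p\<close>-th power.\<close>
  define \<tau> where "\<tau> = (\<lambda>i. \<Sum>b\<in>B. ?s (coord (val i) (x i) b ^ p) * Y (b, core i) ^ (p ^ Suc (val i)))"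
  have P: "prime CHAR(('l \<times> nat) multiset \<Rightarrow>\<^sub>0 'k)" and pP: "p = CHAR(('l \<times> nat) multiset \<Rightarrow>\<^sub>0 'k)"
    using prime_p char by (simp_all add: CHAR_poly_mapping)
  have "phi x ^ p = ?s (lam (x 0) ^ p) + (\<Sum>i\<in>{1..m}. \<tau> i)"
    unfolding phi_def \<tau>_def freshmans_dream[OF P pP] freshmans_dream_sum[OF P pP]
      power_mult_distrib single_0_power
    by (simp add: power_mult[symmetric] mult.commute[of _ p])
  moreover have "phi (p_map C x) = ?s (lam (x 0) ^ p) + (\<Sum>i | 1 \<le> i \<and> p * i \<le> m. \<tau> i)"
  proof -
    have "(\<Sum>j\<in>{1..m}. \<Sum>b\<in>B. ?s (coord (val j) (p_map C x j) b) * Y (b, core j) ^ (p ^ val j))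
      = (\<Sum>j\<in>{1..m}. if p dvd j then \<tau> (j div p) else 0)"
    proof (intro sum.cong refl)
      fix j assume j: "j \<in> {1..m}"
      show "(\<Sum>b\<in>B. ?s (coord (val j) (p_map C x j) b) * Y (b, core j) ^ (p ^ val j))
        = (if p dvd j then \<tau> (j div p) else 0)"
      proof (cases "p dvd j")
        case True
        then obtain i where i: "j = p * i" by blast
        then have "i > 0" using j by (cases i) auto
        then show ?thesis
          using True i j x p_gt_1
          by (simp add: \<tau>_def current_p_map val_times core_times coord_frob current_component)
      next
        case False
        then show ?thesis using j by (simp add: current_p_map coord_zero)
      qed
    qed
    also have "\<dots> = (\<Sum>j\<in>(*) p ` {i. 1 \<le> i \<and> p * i \<le> m}. \<tau> (j div p))"
    proof (rule sum.mono_neutral_cong_right)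
      show "(*) p ` {i. 1 \<le> i \<and> p * i \<le> m} \<subseteq> {1..m}" using p_gt_1 by (auto simp: Suc_le_eq)
      show "\<forall>j\<in>{1..m} - (*) p ` {i. 1 \<le> i \<and> p * i \<le> m}. (if p dvd j then \<tau> (j div p) else 0) = 0"
      proof
        fix j assume j: "j \<in> {1..m} - (*) p ` {i. 1 \<le> i \<and> p * i \<le> m}"
        have "\<not> p dvd j"
        proof
          assume "p dvd j"
          then obtain i where "j = p * i" by blast
          moreover from this have "1 \<le> i" using j by (cases i) auto
          ultimately show False using j by auto
        qed
        then show "(if p dvd j then \<tau> (j div p) else 0) = 0" by simp
      qed
    qed auto
    also have "\<dots> = (\<Sum>i | 1 \<le> i \<and> p * i \<le> m. \<tau> i)"
      using p_gt_1 by (subst sum.reindex) (auto simp: inj_on_def)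
    finally show ?thesis
      using x by (simp add: phi_def current_p_map[of x] lam_frob current_component)
  qed
  moreover have "(\<Sum>i\<in>{1..m}. \<tau> i) = (\<Sum>i | 1 \<le> i \<and> p * i \<le> m. \<tau> i)
      + (\<Sum>i | 1 \<le> i \<and> i \<le> m \<and> p * i > m. \<tau> i)"
  proof -
    have le: "i \<le> p * i" for i using p_gt_1 by simp
    have un: "{1..m} = {i. 1 \<le> i \<and> p * i \<le> m} \<union> {i. 1 \<le> i \<and> i \<le> m \<and> p * i > m}"
      by (auto intro: order_trans[OF le])
    have "finite {1..m}" by simp
    then have "finite {i. 1 \<le> i \<and> p * i \<le> m}" "finite {i. 1 \<le> i \<and> i \<le> m \<and> p * i > m}"
      unfolding un by auto
    then show ?thesis unfolding un by (intro sum.union_disjoint) auto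
  qed
  moreover have "box_null (\<Sum>i | 1 \<le> i \<and> i \<le> m \<and> p * i > m. \<tau> i)"
  proof (rule box_null_sum)
    fix i assume "i \<in> {i. 1 \<le> i \<and> i \<le> m \<and> p * i > m}"
    then have "core i * p ^ Suc (val i) > m"
      using core_val[of i] by (simp add: mult.left_commute)
    then have "p ^ height (core i) \<le> p ^ Suc (val i)"
      using height_le p_gt_1 by (intro power_increasing) auto
    then have "box_null (Y (b, core i) ^ (p ^ Suc (val i)))" for b
      by (intro box_null_Y_pow) simp
    then show "box_null (\<tau> i)"
      unfolding \<tau>_def by (intro box_null_sum) (subst mult.commute, intro box_null_mult)
  qed
  ultimately show ?thesis by (simp only: add_diff_cancel_left add_diff_cancel_left')
qed

abbreviation "ev \<equiv> free_eval phi"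

lemma box_null_ideal: "ideal {f \<in> carrier F. box_null (ev f)} F"
proof (rule idealI[OF F.ring_axioms])
  show "subgroup {f \<in> carrier F. box_null (ev f)} (add_monoid F)"
  proof (rule subgroup.intro)
    fix f assume f: "f \<in> {f \<in> carrier F. box_null (ev f)}"
    then have "\<ominus>\<^bsub>F\<^esub> f \<in> {f \<in> carrier F. box_null (ev f)}"
      by (simp add: free_eval_uminus box_null_uminus)
    then show "inv\<^bsub>add_monoid F\<^esub> f \<in> {f \<in> carrier F. box_null (ev f)}"
      by (simp only: a_inv_def)
  qed (auto simp: free_eval_add[where S="carrier C"] box_null_add box_null_zero free_eval_zero)
next
  fix a x assume "a \<in> {f \<in> carrier F. box_null (ev f)}" "x \<in> carrier F"
  then show "x \<otimes>\<^bsub>F\<^esub> a \<in> {f \<in> carrier F. box_null (ev f)}" "a \<otimes>\<^bsub>F\<^esub> x \<in> {f \<in> carrier F. box_null (ev f)}"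
    using box_null_mult[of "ev a" "ev x"]
    by (auto simp: free_eval_mult[where S="carrier C"] mult.commute)
qed

lemma current_zero_closed: "\<zero>\<^bsub>C\<^esub> \<in> carrier C"
  by (simp add: current_carrier current_zero)

text \<open>The linear and bracket relations are preserved exactly, and the \<open>p\<close>-power relations by \<open>phi_frob\<close> up to
  monomials outside the box. So evaluation induces a homomorphism from the restricted enveloping algebra to the
  truncated polynomial algebra.\<close>

theorem box_null_ev_of_cls_zero:
  assumes "f \<in> carrier F" "cls f = \<zero>\<^bsub>A\<^esub>"
  shows "box_null (ev f)"
proof -
  note simps = free_eval_minus[where S="carrier C"] free_eval_add[where S="carrier C"]
    free_eval_mult[where S="carrier C"] free_eval_pow[where S="carrier C"]
    free_gen_closed free_const_closed add_closed bracket_closed p_map_closed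
    restricted_data.smult_closed[OF restricted_data_axioms] F.minus_closed current_zero_closed
  have "f \<in> {f \<in> carrier F. box_null (ev f)}"
  proof (rule cls_zero_imp_mem[OF box_null_ideal _ _ assms])
    show "env_rels \<subseteq> {f \<in> carrier F. box_null (ev f)}"
    proof
      fix f assume f: "f \<in> env_rels"
      then have fc: "f \<in> carrier F" using env_rels_closed by blast
      have "ev f = 0"
        using f unfolding env_rels_def
        by (auto simp: simps phi_add phi_smult current_bracket phi_zero)
      then show "f \<in> {f \<in> carrier F. box_null (ev f)}" using fc box_null_zero by simp
    qed
    fix x assume "x \<in> carrier C"
    then show "free_gen x [^]\<^bsub>F\<^esub> p \<ominus>\<^bsub>F\<^esub> free_gen (p_map C x) \<in> {f \<in> carrier F. box_null (ev f)}"
      using phi_frob by (simp add: simps)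
  qed
  then show ?thesis by simp
qed

end

context left_module
begin

lemma smult_zero_right: "a \<in> carrier R \<Longrightarrow> a \<odot>\<^bsub>M\<^esub> \<zero>\<^bsub>M\<^esub> = \<zero>\<^bsub>M\<^esub>"
  using smult_r_distr[of a "\<zero>\<^bsub>M\<^esub>" "\<zero>\<^bsub>M\<^esub>"] smult_closed[of a "\<zero>\<^bsub>M\<^esub>"]
    M.add.l_cancel_one[of "a \<odot>\<^bsub>M\<^esub> \<zero>\<^bsub>M\<^esub>" "a \<odot>\<^bsub>M\<^esub> \<zero>\<^bsub>M\<^esub>"] by simp

lemma smult_zero_left: "x \<in> carrier M \<Longrightarrow> \<zero>\<^bsub>R\<^esub> \<odot>\<^bsub>M\<^esub> x = \<zero>\<^bsub>M\<^esub>"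
  using smult_l_distr[of "\<zero>\<^bsub>R\<^esub>" "\<zero>\<^bsub>R\<^esub>" x] smult_closed[of "\<zero>\<^bsub>R\<^esub>" x]
    M.add.l_cancel_one[of "\<zero>\<^bsub>R\<^esub> \<odot>\<^bsub>M\<^esub> x" "\<zero>\<^bsub>R\<^esub> \<odot>\<^bsub>M\<^esub> x"] by simp

lemma smult_uminus_left:
  "a \<in> carrier R \<Longrightarrow> x \<in> carrier M \<Longrightarrow> (\<ominus>\<^bsub>R\<^esub> a) \<odot>\<^bsub>M\<^esub> x = \<ominus>\<^bsub>M\<^esub> (a \<odot>\<^bsub>M\<^esub> x)"
  using smult_l_distr[of "\<ominus>\<^bsub>R\<^esub> a" a x] smult_zero_left[of x] smult_closed[of a x]
    smult_closed[of "\<ominus>\<^bsub>R\<^esub> a" x]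
    M.minus_equality[of "(\<ominus>\<^bsub>R\<^esub> a) \<odot>\<^bsub>M\<^esub> x" "a \<odot>\<^bsub>M\<^esub> x"] by (simp add: R.l_neg)

lemma smult_minus_left:
  "a \<in> carrier R \<Longrightarrow> b \<in> carrier R \<Longrightarrow> x \<in> carrier M
    \<Longrightarrow> (a \<ominus>\<^bsub>R\<^esub> b) \<odot>\<^bsub>M\<^esub> x = a \<odot>\<^bsub>M\<^esub> x \<ominus>\<^bsub>M\<^esub> b \<odot>\<^bsub>M\<^esub> x"
  by (simp add: a_minus_def smult_l_distr smult_uminus_left)

lemma submodule_intro:
  assumes "N \<subseteq> carrier M" "\<zero>\<^bsub>M\<^esub> \<in> N" "\<And>x y. x \<in> N \<Longrightarrow> y \<in> N \<Longrightarrow> x \<oplus>\<^bsub>M\<^esub> y \<in> N"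
    and sm: "\<And>a x. a \<in> carrier R \<Longrightarrow> x \<in> N \<Longrightarrow> a \<odot>\<^bsub>M\<^esub> x \<in> N"
  shows "Module.submodule N R M"
proof (intro Module.submodule.intro Module.submodule_axioms.intro subgroup.intro)
  fix x assume x: "x \<in> N"
  then have "(\<ominus>\<^bsub>R\<^esub> \<one>\<^bsub>R\<^esub>) \<odot>\<^bsub>M\<^esub> x \<in> N" using sm by simp
  then have "\<ominus>\<^bsub>M\<^esub> x \<in> N" using x assms(1) by (auto simp: smult_uminus_left smult_one subset_iff)
  then show "inv\<^bsub>add_monoid M\<^esub> x \<in> N" by (simp only: a_inv_def)
qed (use assms in auto)

lemma submodule_dest:
  assumes "Module.submodule N R M"
  shows "N \<subseteq> carrier M" "\<zero>\<^bsub>M\<^esub> \<in> N" "\<And>x y. x \<in> N \<Longrightarrow> y \<in> N \<Longrightarrow> x \<oplus>\<^bsub>M\<^esub> y \<in> N"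
    and "\<And>a x. a \<in> carrier R \<Longrightarrow> x \<in> N \<Longrightarrow> a \<odot>\<^bsub>M\<^esub> x \<in> N"
    and "\<And>x y. x \<in> N \<Longrightarrow> y \<in> N \<Longrightarrow> x \<ominus>\<^bsub>M\<^esub> y \<in> N"
proof -
  interpret N: Module.submodule N R M by (rule assms)
  show *: "N \<subseteq> carrier M" "\<zero>\<^bsub>M\<^esub> \<in> N" "\<And>x y. x \<in> N \<Longrightarrow> y \<in> N \<Longrightarrow> x \<oplus>\<^bsub>M\<^esub> y \<in> N"
    and "\<And>a x. a \<in> carrier R \<Longrightarrow> x \<in> N \<Longrightarrow> a \<odot>\<^bsub>M\<^esub> x \<in> N"
    using N.subset N.one_closed N.m_closed N.smult_closed by auto
  fix x y assume "x \<in> N" "y \<in> N"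
  moreover have "\<ominus>\<^bsub>M\<^esub> y \<in> N" using N.m_inv_closed[OF \<open>y \<in> N\<close>] by (simp only: a_inv_def)
  ultimately show "x \<ominus>\<^bsub>M\<^esub> y \<in> N" unfolding a_minus_def using *(3) by blast
qed

end

section \<open>The torus acts on the cover by the weight\<close>

lemma lookup_mult_empty:
  fixes P Q :: "'a multiset \<Rightarrow>\<^sub>0 'k::comm_ring_1"
  shows "Poly_Mapping.lookup (P * Q) {#} = Poly_Mapping.lookup P {#} * Poly_Mapping.lookup Q {#}"
proof -
  have "Poly_Mapping.lookup P l * (\<Sum>q. Poly_Mapping.lookup Q q when {#} = l + q)
      = (Poly_Mapping.lookup P l * Poly_Mapping.lookup Q {#} when l = {#})" for l
  proof (cases "l = {#}")
    case True
    have "(\<Sum>q. Poly_Mapping.lookup Q q when {#} = l + q) = (\<Sum>q. Poly_Mapping.lookup Q q when {#} = q)"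
      using True by simp
    then show ?thesis using True by (simp only: Sum_any_when_equal' when_simps simp_thms)
  qed simp
  then show ?thesis by (simp add: lookup_mult)
qed

lemma lookup_single_0_mult:
  fixes Q :: "'a multiset \<Rightarrow>\<^sub>0 'k::comm_ring_1"
  shows "Poly_Mapping.lookup (Poly_Mapping.single 0 c * Q) M = c * Poly_Mapping.lookup Q M"
proof -
  have "Poly_Mapping.lookup (Poly_Mapping.single 0 c) l * (\<Sum>q. Poly_Mapping.lookup Q q when M = l + q)
      = (c * Poly_Mapping.lookup Q M when l = 0)" for l
  proof (cases "l = 0")
    case True
    have "(\<Sum>q. Poly_Mapping.lookup Q q when M = l + q) = (\<Sum>q. Poly_Mapping.lookup Q q when M = q)"
      using True by simp
    then show ?thesis using True by (simp only: Sum_any_when_equal' when_simps simp_thms lookup_single_eq)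
  qed (simp add: lookup_single)
  then show ?thesis by (simp add: lookup_mult)
qed

context toral_weight
begin

lemma t_power_closed: "h \<in> carrier L \<Longrightarrow> i \<le> m \<Longrightarrow> t_power L h i \<in> carrier C"
  by (auto simp: current_carrier t_power_def)

lemma current_induct [consumes 1, case_names zero add t_power]:
  assumes x: "x \<in> carrier C"
    and z: "P \<zero>\<^bsub>C\<^esub>"
    and a: "\<And>x y. x \<in> carrier C \<Longrightarrow> y \<in> carrier C \<Longrightarrow> P x \<Longrightarrow> P y \<Longrightarrow> P (x \<oplus>\<^bsub>C\<^esub> y)"
    and t: "\<And>h i. h \<in> carrier L \<Longrightarrow> i \<le> m \<Longrightarrow> P (t_power L h i)"
  shows "P x"
proof -
  \<comment> \<open>The part of \<open>x\<close> of degree less than \<open>n\<close>, grown one degree at a time.\<close>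
  define part where "part = (\<lambda>n i. if i < n then x i else \<zero>\<^bsub>L\<^esub>)"
  have pc: "part n \<in> carrier C" for n
    using x by (auto simp: part_def current_carrier)
  have "P (part n)" if "n \<le> Suc m" for n
    using that
  proof (induction n)
    case 0
    then show ?case using z by (simp add: part_def current_zero)
  next
    case (Suc n)
    have "P (part n \<oplus>\<^bsub>C\<^esub> t_power L (x n) n)"
      using Suc x pc t_power_closed t current_component by (intro a) auto
    also have "part n \<oplus>\<^bsub>C\<^esub> t_power L (x n) n = part (Suc n)"
      using current_component[OF x] by (auto simp: part_def current_add t_power_def fun_eq_iff less_Suc_eq)
    finally show ?case .
  qed
  moreover have "part (Suc m) = x"
    using x by (auto simp: part_def current_carrier fun_eq_iff less_Suc_eq_le not_le)
  ultimately show ?thesis using order_refl by metis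
qed

text \<open>The character of the free algebra through which the enveloping algebra acts on the one-dimensional module; see
  \<open>cls_K\<close>.\<close>

definition eps :: "((nat \<Rightarrow> 'l) list \<Rightarrow> 'k) \<Rightarrow> 'k" where
  "eps f = Poly_Mapping.lookup (ev f) {#}"

lemma lookup_phi_empty: "Poly_Mapping.lookup (phi x) {#} = lam (x 0)"
proof -
  have "Poly_Mapping.lookup (Y g ^ n) {#} = 0" if "n > 0" for g n
  proof -
    have "repeat_mset n {#g#} \<noteq> {#}" using that by simp
    then show ?thesis unfolding Y_def single_power lookup_single by simp
  qed
  then have "Poly_Mapping.lookup (Y g ^ (p ^ k)) {#} = 0" for g k
    using p_gt_1 by simp
  moreover have "Poly_Mapping.lookup (Poly_Mapping.single (0 :: ('l \<times> nat) multiset) (lam (x 0))) {#} = lam (x 0)"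
    by (simp add: lookup_single)
  ultimately show ?thesis
    by (simp add: phi_def lookup_add lookup_sum lookup_single_0_mult)
qed

lemma eps_const: "eps (free_const c) = c"
  by (simp add: eps_def lookup_single)

lemma eps_add: "f \<in> carrier F \<Longrightarrow> g \<in> carrier F \<Longrightarrow> eps (f \<oplus>\<^bsub>F\<^esub> g) = eps f + eps g"
  by (simp add: eps_def free_eval_add lookup_add)

lemma eps_gen: "f \<in> carrier F \<Longrightarrow> eps (free_gen x \<otimes>\<^bsub>F\<^esub> f) = lam (x 0) * eps f"
  by (simp add: eps_def free_eval_gen_mult lookup_mult_empty lookup_phi_empty)

end

locale toral_cover = toral_weight p m L B lam
  for p m :: nat and L :: "('k::alg_closed_field, 'l) restricted_lie" and B :: "'l set"
    and lam :: "'l \<Rightarrow> 'k" +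
  fixes K :: "(((nat \<Rightarrow> 'l) list \<Rightarrow> 'k) set set, 'v) module"
    and Q :: "(((nat \<Rightarrow> 'l) list \<Rightarrow> 'k) set set, 'q) module"
    and \<pi> :: "'q \<Rightarrow> 'v"
  assumes weight: "weight_module p m L lam K"
    and cover: "projective_cover A Q \<pi> K"
begin

sublocale KM: left_module A K
  using weight by (simp add: weight_module_def Let_def)

sublocale QM: left_module A Q
  using cover by (simp add: projective_cover_def projective_module_def)

lemma pi_hom: "\<pi> \<in> LinearCombinations.module_hom A Q K"
  and pi_surj: "\<pi> ` carrier Q = carrier K"
  using cover by (auto simp: projective_cover_def)

lemma pi_closed: "x \<in> carrier Q \<Longrightarrow> \<pi> x \<in> carrier K"
  and pi_add: "x \<in> carrier Q \<Longrightarrow> y \<in> carrier Q \<Longrightarrow> \<pi> (x \<oplus>\<^bsub>Q\<^esub> y) = \<pi> x \<oplus>\<^bsub>K\<^esub> \<pi> y"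
  and pi_smult: "a \<in> carrier A \<Longrightarrow> x \<in> carrier Q \<Longrightarrow> \<pi> (a \<odot>\<^bsub>Q\<^esub> x) = a \<odot>\<^bsub>K\<^esub> \<pi> x"
  using pi_hom by (auto simp: LinearCombinations.module_hom_def)

text \<open>The minimality of the cover, in the form used throughout: a submodule that meets every fibre of \<open>\<pi>\<close> is
  everything.\<close>

lemma superfluous:
  assumes N: "Module.submodule N A Q" and ex: "\<And>x. x \<in> carrier Q \<Longrightarrow> \<exists>n\<in>N. \<pi> n = \<pi> x"
  shows "N = carrier Q"
proof -
  note N' = QM.submodule_dest[OF N]
  have "N <+>\<^bsub>Q\<^esub> a_kernel Q K \<pi> = carrier Q"
  proof
    show "N <+>\<^bsub>Q\<^esub> a_kernel Q K \<pi> \<subseteq> carrier Q"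
      using N'(1) by (auto simp: set_add_def' a_kernel_def')
    show "carrier Q \<subseteq> N <+>\<^bsub>Q\<^esub> a_kernel Q K \<pi>"
    proof
      fix x assume x: "x \<in> carrier Q"
      obtain n where n: "n \<in> N" "\<pi> n = \<pi> x" using ex[OF x] by blast
      then have nc: "n \<in> carrier Q" using N'(1) by blast
      have eq: "n \<oplus>\<^bsub>Q\<^esub> (x \<ominus>\<^bsub>Q\<^esub> n) = x"
        using QM.M.a_lcomm[of n x "\<ominus>\<^bsub>Q\<^esub> n"] x nc by (simp add: a_minus_def QM.M.r_neg)
      then have "\<pi> x = \<pi> n \<oplus>\<^bsub>K\<^esub> \<pi> (x \<ominus>\<^bsub>Q\<^esub> n)"
        using pi_add[of n "x \<ominus>\<^bsub>Q\<^esub> n"] x nc by simp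
      then have "\<pi> (x \<ominus>\<^bsub>Q\<^esub> n) = \<zero>\<^bsub>K\<^esub>"
        using n(2) x nc pi_closed[of x] pi_closed[of "x \<ominus>\<^bsub>Q\<^esub> n"]
          KM.M.add.l_cancel_one[of "\<pi> x" "\<pi> (x \<ominus>\<^bsub>Q\<^esub> n)"] by simp
      then have "x \<ominus>\<^bsub>Q\<^esub> n \<in> a_kernel Q K \<pi>"
        using x nc by (simp add: a_kernel_def')
      then have "n \<oplus>\<^bsub>Q\<^esub> (x \<ominus>\<^bsub>Q\<^esub> n) \<in> N <+>\<^bsub>Q\<^esub> a_kernel Q K \<pi>"
        unfolding set_add_def' using n(1) by blast
      then show "x \<in> N <+>\<^bsub>Q\<^esub> a_kernel Q K \<pi>" unfolding eq .
    qed
  qed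
  then show ?thesis using cover N by (simp add: projective_cover_def)
qed

definition v0 :: 'v where
  "v0 = (SOME v. v \<in> carrier K \<and> v \<noteq> \<zero>\<^bsub>K\<^esub> \<and> carrier K = {scal c \<odot>\<^bsub>K\<^esub> v | c. True})"

lemma v0: "v0 \<in> carrier K" "v0 \<noteq> \<zero>\<^bsub>K\<^esub>" "carrier K = {scal c \<odot>\<^bsub>K\<^esub> v0 | c. True}"
proof -
  have "\<exists>v. v \<in> carrier K \<and> v \<noteq> \<zero>\<^bsub>K\<^esub> \<and> carrier K = {scal c \<odot>\<^bsub>K\<^esub> v | c. True}"
    using weight by (auto simp: weight_module_def Let_def)
  from someI_ex[OF this, folded v0_def]
  show "v0 \<in> carrier K" "v0 \<noteq> \<zero>\<^bsub>K\<^esub>" "carrier K = {scal c \<odot>\<^bsub>K\<^esub> v0 | c. True}" by blast+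
qed

definition q0 :: 'q where "q0 = (SOME q. q \<in> carrier Q \<and> \<pi> q = v0)"

lemma q0: "q0 \<in> carrier Q" "\<pi> q0 = v0"
proof -
  have "v0 \<in> \<pi> ` carrier Q" using v0(1) by (simp only: pi_surj)
  then have "\<exists>q. q \<in> carrier Q \<and> \<pi> q = v0" by (elim imageE) metis
  from someI_ex[OF this, folded q0_def] show "q0 \<in> carrier Q" "\<pi> q0 = v0" by blast+
qed

lemma scal_eq_zeroD:
  assumes "scal c \<odot>\<^bsub>K\<^esub> v0 = \<zero>\<^bsub>K\<^esub>" shows "c = 0"
proof (rule ccontr)
  assume c: "c \<noteq> 0"
  have "v0 = scal (inverse c * c) \<odot>\<^bsub>K\<^esub> v0" using c v0(1) by (simp add: scal_one KM.smult_one)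
  also have "\<dots> = scal (inverse c) \<odot>\<^bsub>K\<^esub> (scal c \<odot>\<^bsub>K\<^esub> v0)"
    unfolding scal_mult using v0(1) by (intro KM.smult_assoc) auto
  also have "\<dots> = \<zero>\<^bsub>K\<^esub>" unfolding assms by (rule KM.smult_zero_right) simp
  finally show False using v0(2) by simp
qed

lemma scal_eqD:
  assumes "scal c \<odot>\<^bsub>K\<^esub> v0 = scal d \<odot>\<^bsub>K\<^esub> v0" shows "c = d"
proof -
  have "scal (c - d) \<odot>\<^bsub>K\<^esub> v0 = scal c \<odot>\<^bsub>K\<^esub> v0 \<ominus>\<^bsub>K\<^esub> scal d \<odot>\<^bsub>K\<^esub> v0"
    using scal_add[of c "-d"] v0(1)
    by (simp add: scal_minus KM.smult_l_distr KM.smult_uminus_left a_minus_def)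
  also have "\<dots> = \<zero>\<^bsub>K\<^esub>" using assms v0(1) by (simp add: KM.M.minus_eq_zero_iff KM.smult_closed)
  finally show ?thesis using scal_eq_zeroD by fastforce
qed

lemma inc_K:
  assumes "x \<in> carrier C" "k \<in> carrier K"
  shows "inc x \<odot>\<^bsub>K\<^esub> k = scal (lam (x 0)) \<odot>\<^bsub>K\<^esub> k"
  using assms
proof (induction x rule: current_induct)
  case zero
  have "lam \<zero>\<^bsub>L\<^esub> = 0" using lam_smult[of "\<zero>\<^bsub>L\<^esub>" 0] by simp
  moreover have "\<zero>\<^bsub>C\<^esub> 0 = \<zero>\<^bsub>L\<^esub>" by (simp add: current_zero)
  ultimately show ?case unfolding inc_zero by (simp only: scal_zero)
next
  case (add x y)
  have "(x \<oplus>\<^bsub>C\<^esub> y) 0 = x 0 \<oplus>\<^bsub>L\<^esub> y 0" by (simp add: current_add)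
  then show ?case using add
    by (simp add: inc_add KM.smult_l_distr scal_add lam_add current_component)
next
  case (t_power h i)
  have l0: "lam \<zero>\<^bsub>L\<^esub> = 0" using lam_smult[of "\<zero>\<^bsub>L\<^esub>" 0] by simp
  have W: "inc (t_power L h 0) \<odot>\<^bsub>K\<^esub> k = scal (lam h) \<odot>\<^bsub>K\<^esub> k
      \<and> (\<forall>i\<in>{1..m}. inc (t_power L h i) \<odot>\<^bsub>K\<^esub> k = \<zero>\<^bsub>K\<^esub>)"
    using weight t_power(1,3) by (simp add: weight_module_def Let_def)
  show ?case
  proof (cases "i = 0")
    case True
    then show ?thesis using W by (simp add: t_power_def)
  next
    case False
    then have "inc (t_power L h i) \<odot>\<^bsub>K\<^esub> k = \<zero>\<^bsub>K\<^esub>" using W t_power(2) by simp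
    moreover have "t_power L h i 0 = \<zero>\<^bsub>L\<^esub>" using False by (simp add: t_power_def)
    ultimately show ?thesis using t_power(3) by (simp add: l0 scal_zero KM.smult_zero_left)
  qed
qed

lemma cls_K:
  assumes "f \<in> carrier F" "k \<in> carrier K"
  shows "cls f \<odot>\<^bsub>K\<^esub> k = scal (eps f) \<odot>\<^bsub>K\<^esub> k"
  using assms
proof (induction f rule: free_alg_induct)
  case (const c)
  then show ?case by (simp add: eps_const scal_eq)
next
  case (add f g)
  then show ?case by (simp add: eps_add scal_add KM.smult_l_distr)
next
  case (gen x f)
  have "cls (free_gen x \<otimes>\<^bsub>F\<^esub> f) \<odot>\<^bsub>K\<^esub> k = inc x \<odot>\<^bsub>K\<^esub> (scal (eps f) \<odot>\<^bsub>K\<^esub> k)"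
    using gen by (simp add: free_gen_closed KM.smult_assoc flip: inc_eq)
  also have "\<dots> = scal (lam (x 0)) \<odot>\<^bsub>K\<^esub> (scal (eps f) \<odot>\<^bsub>K\<^esub> k)"
    using gen by (intro inc_K) (auto simp: KM.smult_closed)
  also have "\<dots> = scal (eps (free_gen x \<otimes>\<^bsub>F\<^esub> f)) \<odot>\<^bsub>K\<^esub> k"
    using gen by (simp add: eps_gen scal_mult KM.smult_assoc)
  finally show ?case .
qed

text \<open>The submodule generated by a lift of the basis vector \<open>v0\<close> maps onto the one-dimensional module \<open>K\<close>.\<close>

lemma Q_cyclic:
  assumes "x \<in> carrier Q"
  shows "\<exists>f\<in>carrier F. x = cls f \<odot>\<^bsub>Q\<^esub> q0"
proof -
  let ?N = "{a \<odot>\<^bsub>Q\<^esub> q0 | a. a \<in> carrier A}"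
  have "?N = carrier Q"
  proof (rule superfluous)
    show "Module.submodule ?N A Q"
    proof (rule QM.submodule_intro)
      show "?N \<subseteq> carrier Q" using q0 QM.smult_closed by auto
      show "\<zero>\<^bsub>Q\<^esub> \<in> ?N" 
        using QM.smult_zero_left[OF q0(1)] by (intro CollectI exI[of _ "\<zero>\<^bsub>A\<^esub>"]) auto
      fix x y assume "x \<in> ?N" "y \<in> ?N"
      then obtain a b where "x = a \<odot>\<^bsub>Q\<^esub> q0" "y = b \<odot>\<^bsub>Q\<^esub> q0" "a \<in> carrier A" "b \<in> carrier A" by blast
      then show "x \<oplus>\<^bsub>Q\<^esub> y \<in> ?N"
        using q0 QM.smult_l_distr[of a b q0] by (intro CollectI exI[of _ "a \<oplus>\<^bsub>A\<^esub> b"]) auto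
    next
      fix a x assume a: "a \<in> carrier A" "x \<in> ?N"
      then obtain b where "x = b \<odot>\<^bsub>Q\<^esub> q0" "b \<in> carrier A" by blast
      then show "a \<odot>\<^bsub>Q\<^esub> x \<in> ?N"
        using a q0 QM.smult_assoc[of a b q0] by (intro CollectI exI[of _ "a \<otimes>\<^bsub>A\<^esub> b"]) auto
    qed
    fix x assume "x \<in> carrier Q"
    then obtain c where "\<pi> x = scal c \<odot>\<^bsub>K\<^esub> v0" using pi_closed v0(3) by blast
    then have "\<pi> (scal c \<odot>\<^bsub>Q\<^esub> q0) = \<pi> x" using q0 by (simp add: pi_smult)
    then show "\<exists>n\<in>?N. \<pi> n = \<pi> x" 
      by (intro bexI[of _ "scal c \<odot>\<^bsub>Q\<^esub> q0"]) auto
  qed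
  then obtain a where "a \<in> carrier A" "x = a \<odot>\<^bsub>Q\<^esub> q0" using assms by blast
  then show ?thesis using cls_surj[of a] by blast
qed

text \<open>Subtracting the eigenvalue gives an element that annihilates \<open>K\<close>. The map \<open>shifted\<close> is linear and
  still turns the \<open>p\<close>-map into \<open>p\<close>-th powers, because \<open>lam\<close> does.\<close>

definition shifted :: "'l \<Rightarrow> ((nat \<Rightarrow> 'l) list \<Rightarrow> 'k) set set" where
  "shifted h = inc (t_power L h 0) \<ominus>\<^bsub>A\<^esub> scal (lam h)"

lemma t0_closed [simp]: "h \<in> carrier L \<Longrightarrow> t_power L h 0 \<in> carrier C"
  by (simp add: t_power_closed)

lemma shifted_closed [simp]: "h \<in> carrier L \<Longrightarrow> shifted h \<in> carrier A"
  by (simp add: shifted_def)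

lemma shifted_K: "h \<in> carrier L \<Longrightarrow> k \<in> carrier K \<Longrightarrow> shifted h \<odot>\<^bsub>K\<^esub> k = \<zero>\<^bsub>K\<^esub>"
proof -
  assume h: "h \<in> carrier L" and k: "k \<in> carrier K"
  have "t_power L h 0 0 = h" by (simp add: t_power_def)
  then show ?thesis using inc_K[of "t_power L h 0" k] h k
    by (simp add: shifted_def KM.smult_minus_left KM.M.minus_eq_zero_iff KM.smult_closed)
qed

lemma shifted_add:
  assumes "g \<in> carrier L" "h \<in> carrier L"
  shows "shifted (g \<oplus>\<^bsub>L\<^esub> h) = shifted g \<oplus>\<^bsub>A\<^esub> shifted h"
proof -
  have "t_power L (g \<oplus>\<^bsub>L\<^esub> h) 0 = t_power L g 0 \<oplus>\<^bsub>C\<^esub> t_power L h 0"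
    by (auto simp: t_power_def current_add)
  then show ?thesis using assms
    by (simp add: shifted_def inc_add lam_add scal_add a_minus_def A.minus_add A.a_ac)
qed

lemma shifted_smult:
  assumes "h \<in> carrier L"
  shows "shifted (c \<odot>\<^bsub>L\<^esub> h) = scal c \<otimes>\<^bsub>A\<^esub> shifted h"
proof -
  have "t_power L (c \<odot>\<^bsub>L\<^esub> h) 0 = c \<odot>\<^bsub>C\<^esub> t_power L h 0"
    by (auto simp: t_power_def current_smult)
  then show ?thesis using assms
    by (simp add: shifted_def inc_smult lam_smult scal_mult a_minus_def A.r_distr A.r_minus)
qed

lemma shifted_frob:
  assumes "h \<in> carrier L"
  shows "shifted (Fr h) = shifted h [^]\<^bsub>A\<^esub> p"
proof -
  have "p_map C (t_power L h 0) = t_power L (Fr h) 0"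
    using p_gt_1 by (auto simp: t_power_def current_p_map fun_eq_iff elim!: dvdE)
  then show ?thesis using assms
    by (simp add: shifted_def A_frob_minus inc_pow frob_closed flip: scal_pow lam_frob)
qed

text \<open>The \<open>x\<close> for which \<open>shifted x\<close> lies in \<open>shifted h\<close> times the annihilator of \<open>K\<close> form a subspace of \<open>L\<close>. It
  contains the proper \<open>p\<close>-power iterates of \<open>h\<close>, whose images under \<open>shifted\<close> are \<open>p\<close>-th powers, and hence
  it contains \<open>h\<close>, which lies in their span.\<close>

lemma shifted_factor:
  assumes h: "h \<in> carrier L"
  shows "\<exists>u\<in>carrier A. (\<forall>k\<in>carrier K. u \<odot>\<^bsub>K\<^esub> k = \<zero>\<^bsub>K\<^esub>) \<and> shifted h = shifted h \<otimes>\<^bsub>A\<^esub> u"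
proof -
  \<comment> \<open>The goal is that \<open>h\<close> itself belongs to this subspace.\<close>
  define \<Lambda> where "\<Lambda> = {x \<in> carrier L. \<exists>u\<in>carrier A. (\<forall>k\<in>carrier K. u \<odot>\<^bsub>K\<^esub> k = \<zero>\<^bsub>K\<^esub>) \<and> shifted x = shifted h \<otimes>\<^bsub>A\<^esub> u}"
  have \<Lambda>: "x \<in> \<Lambda>" if "x \<in> carrier L" "u \<in> carrier A" "\<forall>k\<in>carrier K. u \<odot>\<^bsub>K\<^esub> k = \<zero>\<^bsub>K\<^esub>" "shifted x = shifted h \<otimes>\<^bsub>A\<^esub> u" for x u
    using that by (auto simp: \<Lambda>_def)
  \<comment> \<open>As \<open>p\<close> is at least two, splitting off one factor from a \<open>p\<close>-th power leaves a positive power, which kills \<open>K\<close>.\<close>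
  obtain p' where p': "p = Suc (Suc p')" using p_gt_1 by (metis One_nat_def less_iff_Suc_add add_Suc plus_nat.add_0)
  have pow: "shifted x [^]\<^bsub>A\<^esub> p = shifted x \<otimes>\<^bsub>A\<^esub> (shifted x [^]\<^bsub>A\<^esub> Suc p')" if "x \<in> carrier L" for x
  proof -
    have "shifted x [^]\<^bsub>A\<^esub> p = shifted x [^]\<^bsub>A\<^esub> Suc (Suc p')"
      using p' by (rule arg_cong)
    also have "\<dots> = shifted x \<otimes>\<^bsub>A\<^esub> (shifted x [^]\<^bsub>A\<^esub> Suc p')"
      using that by (intro A.nat_pow_Suc2) simp
    finally show ?thesis .
  qed
  have kill: "(shifted x [^]\<^bsub>A\<^esub> Suc p') \<odot>\<^bsub>K\<^esub> k = \<zero>\<^bsub>K\<^esub>" if "x \<in> carrier L" "k \<in> carrier K" for x k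
    using that by (simp add: KM.smult_assoc shifted_K KM.smult_zero_right)
  have orbit: "(Fr ^^ Suc i) h \<in> \<Lambda>" for i
  proof (induction i)
    case 0
    have "shifted (Fr h) = shifted h \<otimes>\<^bsub>A\<^esub> (shifted h [^]\<^bsub>A\<^esub> Suc p')" using pow[OF h] shifted_frob[OF h] by simp
    then have "Fr h \<in> \<Lambda>" using kill[OF h] h by (intro \<Lambda>[of _ "shifted h [^]\<^bsub>A\<^esub> Suc p'"]) (auto intro: frob_closed)
    then show ?case by simp
  next
    case (Suc i)
    let ?x = "(Fr ^^ Suc i) h"
    obtain u where x: "?x \<in> carrier L" and u: "u \<in> carrier A" "\<forall>k\<in>carrier K. u \<odot>\<^bsub>K\<^esub> k = \<zero>\<^bsub>K\<^esub>" "shifted ?x = shifted h \<otimes>\<^bsub>A\<^esub> u"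
      using Suc unfolding \<Lambda>_def by blast
    have "shifted (Fr ?x) = (shifted h \<otimes>\<^bsub>A\<^esub> u) \<otimes>\<^bsub>A\<^esub> (shifted ?x [^]\<^bsub>A\<^esub> Suc p')"
      unfolding shifted_frob[OF x] pow[OF x] using u(3) by simp
    also have "\<dots> = shifted h \<otimes>\<^bsub>A\<^esub> (u \<otimes>\<^bsub>A\<^esub> (shifted ?x [^]\<^bsub>A\<^esub> Suc p'))"
      using h u(1) shifted_closed[OF x] by (intro A.m_assoc A.nat_pow_closed) auto
    finally have "Fr ?x \<in> \<Lambda>"
    proof (rule \<Lambda>[rotated 3])
      show "Fr ?x \<in> carrier L" using x by (rule frob_closed)
      show "u \<otimes>\<^bsub>A\<^esub> (shifted ?x [^]\<^bsub>A\<^esub> Suc p') \<in> carrier A"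
        using u(1) shifted_closed[OF x] by (intro A.m_closed A.nat_pow_closed)
      show "\<forall>k\<in>carrier K. (u \<otimes>\<^bsub>A\<^esub> (shifted ?x [^]\<^bsub>A\<^esub> Suc p')) \<odot>\<^bsub>K\<^esub> k = \<zero>\<^bsub>K\<^esub>"
      proof
        fix k assume k: "k \<in> carrier K"
        have "(u \<otimes>\<^bsub>A\<^esub> (shifted ?x [^]\<^bsub>A\<^esub> Suc p')) \<odot>\<^bsub>K\<^esub> k = u \<odot>\<^bsub>K\<^esub> ((shifted ?x [^]\<^bsub>A\<^esub> Suc p') \<odot>\<^bsub>K\<^esub> k)"
          using u(1) shifted_closed[OF x] k by (intro KM.smult_assoc A.nat_pow_closed)
        then show "(u \<otimes>\<^bsub>A\<^esub> (shifted ?x [^]\<^bsub>A\<^esub> Suc p')) \<odot>\<^bsub>K\<^esub> k = \<zero>\<^bsub>K\<^esub>"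
          unfolding kill[OF x k] using u(1) by (simp only: KM.smult_zero_right)
      qed
    qed
    then show ?case by simp
  qed
  have "submodule class_ring \<Lambda> L"
  proof
    show "\<Lambda> \<subseteq> carrier L" by (auto simp: \<Lambda>_def)
    have "shifted \<zero>\<^bsub>L\<^esub> = \<zero>\<^bsub>A\<^esub>" using shifted_smult[of "\<zero>\<^bsub>L\<^esub>" 0] by (simp add: scal_zero)
    then show "\<zero>\<^bsub>L\<^esub> \<in> \<Lambda>" using h by (intro \<Lambda>[of _ "\<zero>\<^bsub>A\<^esub>"]) (auto simp: KM.smult_zero_left)
  next
    fix x z assume "x \<in> \<Lambda>" "z \<in> \<Lambda>"
    then obtain u w where "x \<in> carrier L" "u \<in> carrier A" "\<forall>k\<in>carrier K. u \<odot>\<^bsub>K\<^esub> k = \<zero>\<^bsub>K\<^esub>" "shifted x = shifted h \<otimes>\<^bsub>A\<^esub> u"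
      "z \<in> carrier L" "w \<in> carrier A" "\<forall>k\<in>carrier K. w \<odot>\<^bsub>K\<^esub> k = \<zero>\<^bsub>K\<^esub>" "shifted z = shifted h \<otimes>\<^bsub>A\<^esub> w"
      unfolding \<Lambda>_def by blast
    then show "x \<oplus>\<^bsub>L\<^esub> z \<in> \<Lambda>"
      using h by (intro \<Lambda>[of _ "u \<oplus>\<^bsub>A\<^esub> w"]) (auto simp: shifted_add A.r_distr KM.smult_l_distr)
  next
    fix c x assume "x \<in> \<Lambda>"
    then obtain u where "x \<in> carrier L" "u \<in> carrier A" "\<forall>k\<in>carrier K. u \<odot>\<^bsub>K\<^esub> k = \<zero>\<^bsub>K\<^esub>" "shifted x = shifted h \<otimes>\<^bsub>A\<^esub> u"
      unfolding \<Lambda>_def by blast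
    then show "c \<odot>\<^bsub>L\<^esub> x \<in> \<Lambda>"
      using h by (intro \<Lambda>[of _ "scal c \<otimes>\<^bsub>A\<^esub> u"])
        (auto simp: shifted_smult A.m_lcomm KM.smult_assoc KM.smult_zero_right)
  qed
  moreover have "{(Fr ^^ i) h | i. i \<ge> 1} \<subseteq> \<Lambda>"
  proof
    fix x assume "x \<in> {(Fr ^^ i) h | i. i \<ge> 1}"
    then obtain i where "x = (Fr ^^ i) h" "i \<ge> 1" by blast
    then show "x \<in> \<Lambda>" using orbit[of "i - 1"] by simp
  qed
  ultimately have "L.span {(Fr ^^ i) h | i. i \<ge> 1} \<subseteq> \<Lambda>" by (intro L.span_is_subset)
  then have "h \<in> \<Lambda>" using mem_span_frob_orbit[OF h] by blast
  then show ?thesis by (simp add: \<Lambda>_def)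
qed

text \<open>A form of Nakayama's lemma: \<open>1 - u\<close> acts on \<open>K\<close> as the identity, so its image in \<open>Q\<close> maps onto \<open>K\<close>; the
  image is a submodule because the algebra is commutative.\<close>

lemma one_minus_surj:
  assumes u: "u \<in> carrier A" "\<forall>k\<in>carrier K. u \<odot>\<^bsub>K\<^esub> k = \<zero>\<^bsub>K\<^esub>" and x: "x \<in> carrier Q"
  shows "\<exists>z\<in>carrier Q. x = (\<one>\<^bsub>A\<^esub> \<ominus>\<^bsub>A\<^esub> u) \<odot>\<^bsub>Q\<^esub> z"
proof -
  let ?a = "\<one>\<^bsub>A\<^esub> \<ominus>\<^bsub>A\<^esub> u"
  let ?N = "{?a \<odot>\<^bsub>Q\<^esub> z | z. z \<in> carrier Q}"
  have a: "?a \<in> carrier A" using u by simp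
  have "?N = carrier Q"
  proof (rule superfluous)
    show "Module.submodule ?N A Q"
    proof (rule QM.submodule_intro)
      show "?N \<subseteq> carrier Q" using a QM.smult_closed by auto
      show "\<zero>\<^bsub>Q\<^esub> \<in> ?N" 
        using QM.smult_zero_right[OF a] by (intro CollectI exI[of _ "\<zero>\<^bsub>Q\<^esub>"]) auto
      fix x z assume "x \<in> ?N" "z \<in> ?N"
      then obtain x' z' where "x = ?a \<odot>\<^bsub>Q\<^esub> x'" "z = ?a \<odot>\<^bsub>Q\<^esub> z'" "x' \<in> carrier Q" "z' \<in> carrier Q" by blast
      then show "x \<oplus>\<^bsub>Q\<^esub> z \<in> ?N"
        using a by (intro CollectI exI[of _ "x' \<oplus>\<^bsub>Q\<^esub> z'"]) (auto simp: QM.smult_r_distr)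
    next
      fix b x assume b: "b \<in> carrier A" "x \<in> ?N"
      then obtain x' where x': "x = ?a \<odot>\<^bsub>Q\<^esub> x'" "x' \<in> carrier Q" by blast
      have "b \<odot>\<^bsub>Q\<^esub> x = ?a \<odot>\<^bsub>Q\<^esub> (b \<odot>\<^bsub>Q\<^esub> x')"
        using a b x' A_comm[OF a b(1)] by (simp flip: QM.smult_assoc)
      then show "b \<odot>\<^bsub>Q\<^esub> x \<in> ?N"
        using b x' by (intro CollectI exI[of _ "b \<odot>\<^bsub>Q\<^esub> x'"]) (auto simp: QM.smult_closed)
    qed
    fix x assume x: "x \<in> carrier Q"
    have "\<pi> (?a \<odot>\<^bsub>Q\<^esub> x) = \<pi> x"
      using x u a pi_closed[OF x]
      by (simp add: pi_smult KM.smult_minus_left KM.smult_one) (simp add: a_minus_def)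
    then show "\<exists>n\<in>?N. \<pi> n = \<pi> x" using x by blast
  qed
  then show ?thesis using x by blast
qed

text \<open>Since \<open>shifted h\<close> is its own multiple by some \<open>u\<close> that kills \<open>K\<close>, it kills the image of \<open>1 - u\<close>, which is
  all of \<open>Q\<close>.\<close>

theorem shifted_Q:
  assumes h: "h \<in> carrier L" and x: "x \<in> carrier Q"
  shows "shifted h \<odot>\<^bsub>Q\<^esub> x = \<zero>\<^bsub>Q\<^esub>"
proof -
  obtain u where u: "u \<in> carrier A" "\<forall>k\<in>carrier K. u \<odot>\<^bsub>K\<^esub> k = \<zero>\<^bsub>K\<^esub>" "shifted h = shifted h \<otimes>\<^bsub>A\<^esub> u"
    using shifted_factor[OF h] by blast
  obtain z where z: "z \<in> carrier Q" "x = (\<one>\<^bsub>A\<^esub> \<ominus>\<^bsub>A\<^esub> u) \<odot>\<^bsub>Q\<^esub> z"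
    using one_minus_surj[OF u(1,2) x] by blast
  have "shifted h \<otimes>\<^bsub>A\<^esub> (\<one>\<^bsub>A\<^esub> \<ominus>\<^bsub>A\<^esub> u) = shifted h \<ominus>\<^bsub>A\<^esub> shifted h \<otimes>\<^bsub>A\<^esub> u"
    using h u(1) by (simp add: a_minus_def A.r_distr A.r_minus)
  also have "\<dots> = \<zero>\<^bsub>A\<^esub>" using h u(1,3) by (metis A.m_closed A.minus_eq_zero_iff shifted_closed)
  finally show ?thesis using h u(1) z by (simp add: QM.smult_zero_left flip: QM.smult_assoc)
qed

end

section \<open>The annihilator of the generator of the cover\<close>

context toral_weight
begin

text \<open>A series with constant term one is invertible modulo the monomials outside the box.\<close>

lemma box_null_cancel:
  assumes PQ: "box_null (P * Q)" and Q: "Poly_Mapping.lookup Q {#} = 1"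
  shows "box_null P"
proof -
  have "M \<in> box \<longrightarrow> Poly_Mapping.lookup P M = 0" for M
  proof (induction "size M" arbitrary: M rule: less_induct)
    case less
    show ?case
    proof
      assume M: "M \<in> box"
      have "Poly_Mapping.lookup P l * (\<Sum>q. Poly_Mapping.lookup Q q when M = l + q)
          = (Poly_Mapping.lookup P M when l = M)" for l
      proof (cases "l = M")
        case True
        have "(\<Sum>q. Poly_Mapping.lookup Q q when M = l + q) = (\<Sum>q. Poly_Mapping.lookup Q q when q = {#})"
          using True by (intro Sum_any.cong when_cong) auto
        then show ?thesis using True Q by (simp only: Sum_any_when_equal when_simps simp_thms mult_1_right)
      next
        case False
        show ?thesis
        proof (cases "\<exists>q. M = l + q")
          case True
          then obtain q where q: "M = l + q" by blast
          then have "q \<noteq> {#}" using False by auto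
          then have "size l < size M" using q by (simp add: nonempty_has_size)
          then have "Poly_Mapping.lookup P l = 0" using less box_downward M q by blast
          then show ?thesis using False by simp
        next
          case no: False
          then have "M \<noteq> l + q" for q by blast
          then show ?thesis using False by simp
        qed
      qed
      then have "Poly_Mapping.lookup (P * Q) M = Poly_Mapping.lookup P M"
        by (simp only: lookup_mult Sum_any_when_equal)
      then show "Poly_Mapping.lookup P M = 0" using PQ M by (simp add: box_null_def)
    qed
  qed
  then show ?thesis by (simp add: box_null_def)
qed

definition gen_elem :: "'l \<times> nat \<Rightarrow> nat \<Rightarrow> 'l" where
  "gen_elem g = t_power L (fst g) (snd g)"

lemma Gens_D: "g \<in> Gens \<Longrightarrow> fst g \<in> B \<and> fst g \<in> carrier L \<and> 0 < snd g \<and> snd g \<le> m \<and> \<not> p dvd snd g"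
  using B_carrier by (auto simp: Gens_def)

lemma gen_elem_closed: "g \<in> Gens \<Longrightarrow> gen_elem g \<in> carrier C"
  using Gens_D unfolding gen_elem_def by (intro t_power_closed) auto

lemma phi_gen_elem:
  assumes g: "g \<in> Gens"
  shows "phi (gen_elem g) = Y g"
proof -
  obtain b j where bj: "g = (b, j)" by (cases g)
  note G = Gens_D[OF g, unfolded bj fst_conv snd_conv]
  have vj: "val j = 0" "core j = j"
    using val_core_eqI[of j 0] G by auto
  have l0: "lam \<zero>\<^bsub>L\<^esub> = 0" using lam_smult[of "\<zero>\<^bsub>L\<^esub>" 0] by simp
  have "(\<Sum>i\<in>{1..m}. \<Sum>c\<in>B. Poly_Mapping.single 0 (coord (val i) (gen_elem g i) c) * Y (c, core i) ^ (p ^ val i))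
      = (\<Sum>i\<in>{j}. \<Sum>c\<in>B. Poly_Mapping.single 0 (coord (val i) (gen_elem g i) c) * Y (c, core i) ^ (p ^ val i))"
    using G by (intro sum.mono_neutral_right) (auto simp: gen_elem_def bj t_power_def coord_zero)
  also have "\<dots> = (\<Sum>c\<in>B. Poly_Mapping.single 0 (coord 0 b c) * Y (c, j))"
    by (simp add: vj gen_elem_def bj t_power_def)
  also have "\<dots> = (\<Sum>c\<in>B. if c = b then Y (c, j) else 0)"
    using coord_basis[of b _ 0] G by (intro sum.cong) auto
  also have "\<dots> = Y (b, j)" using G fB by simp
  finally show ?thesis
    using G by (simp add: phi_def gen_elem_def bj t_power_def l0)
qed

lemma map_gen_elem_lists: "set xs \<subseteq> Gens \<Longrightarrow> map gen_elem xs \<in> lists (carrier C)"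
  by (induction xs) (simp_all add: gen_elem_closed)

text \<open>A word in the free algebra whose evaluation is the monomial \<open>M\<close>. The order of its letters is arbitrary, the
  enveloping algebra being commutative.\<close>

definition box_word :: "('l \<times> nat) multiset \<Rightarrow> (nat \<Rightarrow> 'l) list" where
  "box_word M = map gen_elem (SOME xs. mset xs = M)"

lemma some_mset: "mset (SOME xs. mset xs = M) = M"
  by (rule someI_ex) (rule ex_mset)

lemma box_set: "M \<in> box \<Longrightarrow> set (SOME xs. mset xs = M) \<subseteq> Gens"
  using arg_cong[OF some_mset[of M], of set_mset] by (simp add: box_def)

lemma prod_Y: "prod_list (map Y xs) = Poly_Mapping.single (mset xs) 1"
  by (induction xs) (simp_all add: Y_def mult_single add.commute)

lemma prod_box_word:
  assumes "M \<in> box"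
  shows "prod_list (map phi (box_word M)) = Poly_Mapping.single M 1"
proof -
  have "map phi (box_word M) = map Y (SOME xs. mset xs = M)"
    using box_set[OF assms] phi_gen_elem by (auto simp: box_word_def)
  then show ?thesis by (simp add: prod_Y some_mset)
qed

lemma box_word_inj: "inj_on box_word box"
proof (rule inj_onI)
  fix M N assume "M \<in> box" "N \<in> box" "box_word M = box_word N"
  then have "Poly_Mapping.single M (1::'k) = Poly_Mapping.single N 1"
    using prod_box_word[of M] prod_box_word[of N] by simp
  then have "Poly_Mapping.lookup (Poly_Mapping.single M (1::'k)) M = Poly_Mapping.lookup (Poly_Mapping.single N 1) M"
    by simp
  then show "M = N" by (simp add: lookup_single when_def split: if_splits)
qed

lemma box_word_lists: "M \<in> box \<Longrightarrow> box_word M \<in> lists (carrier C)"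
  unfolding box_word_def by (intro map_gen_elem_lists box_set)

text \<open>The span of the monomials in the box, as elements of the free algebra.\<close>

definition reduced :: "((nat \<Rightarrow> 'l) list \<Rightarrow> 'k) set" where
  "reduced = {r. \<forall>w. r w \<noteq> 0 \<longrightarrow> w \<in> box_word ` box}"

lemma reduced_support: "r \<in> reduced \<Longrightarrow> {w. r w \<noteq> 0} \<subseteq> box_word ` box"
  by (auto simp: reduced_def)

lemma reduced_closed: "r \<in> reduced \<Longrightarrow> r \<in> carrier F"
proof -
  assume "r \<in> reduced"
  from reduced_support[OF this] have "{w. r w \<noteq> 0} \<subseteq> box_word ` box" .
  moreover have "finite (box_word ` box)" using card_box by simp
  moreover have "box_word ` box \<subseteq> lists (carrier C)" by (intro image_subsetI box_word_lists)
  ultimately show ?thesis unfolding free_carrier by (meson finite_subset order_trans)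
qed

lemma ev_reduced:
  assumes r: "r \<in> reduced"
  shows "ev r = (\<Sum>M\<in>box. Poly_Mapping.single M (r (box_word M)))"
proof -
  have "ev r = (\<Sum>w\<in>box_word ` box. Poly_Mapping.single 0 (r w) * prod_list (map phi w))"
    using card_box reduced_support[OF r] by (intro free_eval_superset) auto
  also have "\<dots> = (\<Sum>M\<in>box. Poly_Mapping.single 0 (r (box_word M)) * Poly_Mapping.single M 1)"
    by (subst sum.reindex[OF box_word_inj]) (simp add: prod_box_word)
  finally show ?thesis by (simp add: mult_single)
qed

lemma lookup_ev_reduced:
  assumes "r \<in> reduced" "M \<in> box"
  shows "Poly_Mapping.lookup (ev r) M = r (box_word M)"
proof -
  have "Poly_Mapping.lookup (ev r) M = (\<Sum>N\<in>box. if N = M then r (box_word N) else 0)"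
    unfolding ev_reduced[OF assms(1)] lookup_sum
    by (intro sum.cong) (auto simp: lookup_single when_def)
  then show ?thesis using assms(2) card_box by simp
qed

lemma box_null_reduced:
  assumes "r \<in> reduced" "box_null (ev r)"
  shows "r = \<zero>\<^bsub>F\<^esub>"
proof
  fix w
  show "r w = \<zero>\<^bsub>F\<^esub> w"
    using assms lookup_ev_reduced[OF assms(1)] by (auto simp: free_zero reduced_def box_null_def)
qed

definition aprod :: "(nat \<Rightarrow> 'l) list \<Rightarrow> ((nat \<Rightarrow> 'l) list \<Rightarrow> 'k) set set" where
  "aprod xs = foldr (\<lambda>x a. inc x \<otimes>\<^bsub>A\<^esub> a) xs \<one>\<^bsub>A\<^esub>"

lemma aprod_simps [simp]: "aprod [] = \<one>\<^bsub>A\<^esub>" "aprod (x # xs) = inc x \<otimes>\<^bsub>A\<^esub> aprod xs"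
  by (simp_all add: aprod_def)

lemma aprod_closed: "xs \<in> lists (carrier C) \<Longrightarrow> aprod xs \<in> carrier A"
  by (induction xs) auto

lemma aprod_append:
  "xs \<in> lists (carrier C) \<Longrightarrow> ys \<in> lists (carrier C) \<Longrightarrow> aprod (xs @ ys) = aprod xs \<otimes>\<^bsub>A\<^esub> aprod ys"
  by (induction xs) (auto simp: aprod_closed A.m_assoc)

lemma aprod_perm:
  "xs \<in> lists (carrier C) \<Longrightarrow> mset xs = mset ys \<Longrightarrow> aprod xs = aprod ys"
proof (induction xs arbitrary: ys)
  case Nil
  then show ?case by simp
next
  case (Cons x xs)
  have "x \<in> set ys" using Cons(3) by (metis list.set_intros(1) set_mset_mset)
  then obtain us vs where ys: "ys = us @ x # vs" by (meson split_list)
  then have "mset xs = mset (us @ vs)" using Cons(3) by simp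
  then have "aprod xs = aprod (us @ vs)" using Cons(1)[of "us @ vs"] Cons(2) by simp
  moreover have c: "us \<in> lists (carrier C)" "vs \<in> lists (carrier C)" "x \<in> carrier C"
    using arg_cong[OF Cons(3), of set_mset] Cons(2) by (auto simp: ys)
  ultimately have "aprod xs = aprod us \<otimes>\<^bsub>A\<^esub> aprod vs"
    by (simp add: aprod_append)
  then show ?case using c by (simp add: ys aprod_append aprod_closed A.m_lcomm)
qed

lemma aprod_replicate: "x \<in> carrier C \<Longrightarrow> aprod (replicate n x) = inc x [^]\<^bsub>A\<^esub> n"
  by (induction n) (simp_all add: A.m_comm)

lemma cls_word:
  assumes "w \<in> lists (carrier C)"
  shows "(\<lambda>u. if u = w then c else 0) \<in> carrier F
    \<and> cls (\<lambda>u. if u = w then c else 0) = scal c \<otimes>\<^bsub>A\<^esub> aprod w"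
  using assms
proof (induction w)
  case Nil
  have "(\<lambda>u. if u = [] then c else 0) = (free_const c :: (nat \<Rightarrow> 'l) list \<Rightarrow> 'k)"
    by (simp add: free_const_def)
  then show ?case by (simp add: free_const_closed flip: scal_eq)
next
  case (Cons x w)
  let ?f = "(\<lambda>u. if u = w then c else 0)"
  have f: "?f \<in> carrier F" "cls ?f = scal c \<otimes>\<^bsub>A\<^esub> aprod w" and x: "x \<in> carrier C" using Cons by auto
  have eq: "(\<lambda>u. if u = x # w then c else 0) = free_gen x \<otimes>\<^bsub>F\<^esub> ?f"
    by (auto simp: free_gen_mult fun_eq_iff neq_Nil_conv)
  have "cls (free_gen x \<otimes>\<^bsub>F\<^esub> ?f) = inc x \<otimes>\<^bsub>A\<^esub> (scal c \<otimes>\<^bsub>A\<^esub> aprod w)"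
    using f x by (simp add: inc_eq free_gen_closed)
  also have "\<dots> = scal c \<otimes>\<^bsub>A\<^esub> aprod (x # w)"
    using Cons x by (simp add: A.m_lcomm aprod_closed)
  finally show ?case unfolding eq using f x by (simp add: F.m_closed free_gen_closed)
qed

text \<open>Iterating the relation \<open>x^p = x^[p]\<close>, as long as the degree stays at most \<open>m\<close>.\<close>

lemma inc_t_power_pow:
  assumes "h \<in> carrier L" "i > 0" "i * p ^ k \<le> m"
  shows "inc (t_power L h i) [^]\<^bsub>A\<^esub> (p ^ k) = inc (t_power L ((Fr ^^ k) h) (i * p ^ k))"
  using assms(3)
proof (induction k)
  case 0
  then show ?case using assms by (simp add: t_power_closed)
next
  case (Suc k)
  have le: "i * p ^ k \<le> i * p ^ Suc k" using p_gt_1 by simp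
  then have le': "i * p ^ k \<le> m" using Suc(2) by linarith
  have "i \<le> m" by (rule order_trans[OF _ le']) (use p_gt_1 in simp)
  then have c: "t_power L h i \<in> carrier C" using assms by (intro t_power_closed)
  have c': "t_power L ((Fr ^^ k) h) (i * p ^ k) \<in> carrier C"
    using assms le' by (intro t_power_closed frob_pow_closed)
  have "inc (t_power L h i) [^]\<^bsub>A\<^esub> (p ^ Suc k) = (inc (t_power L h i) [^]\<^bsub>A\<^esub> (p ^ k)) [^]\<^bsub>A\<^esub> p"
    using c by (simp add: A.nat_pow_pow mult.commute)
  also have "\<dots> = inc (p_map C (t_power L ((Fr ^^ k) h) (i * p ^ k)))"
    using Suc le' c' by (simp add: inc_pow)
  also have "p_map C (t_power L ((Fr ^^ k) h) (i * p ^ k)) = t_power L ((Fr ^^ Suc k) h) (i * p ^ Suc k)"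
    using Suc(2) p_gt_1 by (auto simp: current_p_map t_power_def fun_eq_iff mult.left_commute elim!: dvdE)
  finally show ?case .
qed

lemma inc_gen_elem_nilpotent:
  assumes g: "g \<in> Gens"
  shows "inc (gen_elem g) [^]\<^bsub>A\<^esub> (p ^ height (snd g)) = \<zero>\<^bsub>A\<^esub>"
proof -
  obtain b j where bj: "g = (b, j)" by (cases g)
  note G = Gens_D[OF g, unfolded bj fst_conv snd_conv]
  have "height j > 0" using level_imp_height[of j 0] G by simp
  then obtain k where k: "height j = Suc k" by (cases "height j") auto
  have le: "j * p ^ k \<le> m"
  proof (rule ccontr)
    assume "\<not> j * p ^ k \<le> m"
    then have "height j \<le> k" by (intro height_le) simp
    then show False using k by simp
  qed
  have gt: "j * p ^ Suc k > m" using height_level[of j] G k by simp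
  have c': "t_power L ((Fr ^^ k) b) (j * p ^ k) \<in> carrier C"
    using G le by (intro t_power_closed frob_pow_closed) auto
  have "p_map C (t_power L ((Fr ^^ k) b) (j * p ^ k)) = \<zero>\<^bsub>C\<^esub>"
    using gt p_gt_1
    by (auto simp: current_p_map t_power_def current_zero fun_eq_iff mult.left_commute elim!: dvdE)
  then have "inc (t_power L ((Fr ^^ k) b) (j * p ^ k)) [^]\<^bsub>A\<^esub> p = \<zero>\<^bsub>A\<^esub>"
    using c' by (simp add: inc_pow inc_zero)
  moreover have "inc (gen_elem g) [^]\<^bsub>A\<^esub> (p ^ height (snd g)) = (inc (gen_elem g) [^]\<^bsub>A\<^esub> (p ^ k)) [^]\<^bsub>A\<^esub> p"
    using gen_elem_closed[OF g] by (simp add: A.nat_pow_pow bj k mult.commute)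
  ultimately show ?thesis
    using inc_t_power_pow[of b j k] G le by (simp add: gen_elem_def bj)
qed

text \<open>A product of generators leaves the box only when the exponent of the new factor reaches its nilpotency exponent,
  and then the product contains a vanishing power.\<close>

lemma box_insert:
  assumes M: "M \<in> box" and g: "g \<in> Gens"
  shows "inc (gen_elem g) \<otimes>\<^bsub>A\<^esub> aprod (box_word M) =
    (if add_mset g M \<in> box then aprod (box_word (add_mset g M)) else \<zero>\<^bsub>A\<^esub>)"
proof -
  let ?xs = "SOME xs. mset xs = M"
  have l: "map gen_elem (g # ?xs) \<in> lists (carrier C)"
    using box_set[OF M] g by (intro map_gen_elem_lists) simp
  have eq: "inc (gen_elem g) \<otimes>\<^bsub>A\<^esub> aprod (box_word M) = aprod (map gen_elem (g # ?xs))"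
    by (simp add: box_word_def)
  show ?thesis
  proof (cases "add_mset g M \<in> box")
    case True
    have "aprod (map gen_elem (g # ?xs)) = aprod (box_word (add_mset g M))"
      unfolding box_word_def
      by (rule aprod_perm[OF l], unfold mset_map some_mset) (simp add: some_mset)
    then show ?thesis using True eq by simp
  next
    case False
    moreover have "set_mset (add_mset g M) \<subseteq> Gens" using M g by (simp add: box_def)
    ultimately obtain h where h: "\<not> count (add_mset g M) h < p ^ height (snd h)"
      unfolding box_def by blast
    moreover have "count M h < p ^ height (snd h)" using M by (simp only: box_def mem_Collect_eq)
    ultimately have "h = g" by (cases "h = g") auto
    with h have "count (add_mset g M) g \<ge> p ^ height (snd g)" by simp
    then have "replicate_mset (p ^ height (snd g)) g \<subseteq># add_mset g M"
      by (simp only: count_le_replicate_mset_subset_eq)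
    then obtain N where N: "add_mset g M = replicate_mset (p ^ height (snd g)) g + N"
      by (metis subset_mset.less_eqE)
    obtain ys where ys: "mset ys = N" using ex_mset by blast
    have "set_mset N \<subseteq> Gens"
      using arg_cong[OF N, of set_mset] M g by (auto simp: box_def)
    then have ysc: "map gen_elem ys \<in> lists (carrier C)" using ys by (intro map_gen_elem_lists) auto
    have "aprod (map gen_elem (g # ?xs)) = aprod (replicate (p ^ height (snd g)) (gen_elem g) @ map gen_elem ys)"
    proof (rule aprod_perm[OF l])
      have "mset (g # ?xs) = mset (replicate (p ^ height (snd g)) g @ ys)"
        using N by (simp add: some_mset ys)
      then have "image_mset gen_elem (mset (g # ?xs)) = image_mset gen_elem (mset (replicate (p ^ height (snd g)) g @ ys))"
        by (rule arg_cong)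
      then show "mset (map gen_elem (g # ?xs)) = mset (replicate (p ^ height (snd g)) (gen_elem g) @ map gen_elem ys)"
        by (simp add: image_replicate_mset)
    qed
    also have "\<dots> = inc (gen_elem g) [^]\<^bsub>A\<^esub> (p ^ height (snd g)) \<otimes>\<^bsub>A\<^esub> aprod (map gen_elem ys)"
      using gen_elem_closed[OF g] ysc by (subst aprod_append) (auto simp: aprod_replicate)
    also have "\<dots> = \<zero>\<^bsub>A\<^esub>"
      using inc_gen_elem_nilpotent[OF g] aprod_closed[OF ysc] by simp
    finally show ?thesis using False eq by simp
  qed
qed

end

context toral_cover
begin

text \<open>By projectivity the surjection \<open>a \<mapsto> a q0\<close> from the regular module onto \<open>Q\<close> has a section, and \<open>e\<close> is the
  image of \<open>q0\<close> under it.\<close>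

lemma cover_section:
  "\<exists>e\<in>carrier A. e \<odot>\<^bsub>Q\<^esub> q0 = q0 \<and> (\<forall>a\<in>carrier A. a \<odot>\<^bsub>Q\<^esub> q0 = \<zero>\<^bsub>Q\<^esub> \<longrightarrow> a \<otimes>\<^bsub>A\<^esub> e = \<zero>\<^bsub>A\<^esub>)"
proof -
  \<comment> \<open>The regular module, carried by the constant functions.\<close>
  define RM :: "(((nat \<Rightarrow> 'l) list \<Rightarrow> 'k) set set, 'q \<Rightarrow> ((nat \<Rightarrow> 'l) list \<Rightarrow> 'k) set set) module"
    where "RM = \<lparr>carrier = {\<lambda>_. a | a. a \<in> carrier A}, mult = undefined, one = undefined,
      zero = (\<lambda>_. \<zero>\<^bsub>A\<^esub>), add = (\<lambda>f g x. f x \<oplus>\<^bsub>A\<^esub> g x), smult = (\<lambda>a f x. a \<otimes>\<^bsub>A\<^esub> f x)\<rparr>"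
  have RM: "left_module A RM"
  proof (intro left_module.intro left_module_axioms.intro A.ring_axioms abelian_groupI)
    fix f assume "f \<in> carrier RM"
    then obtain a where "a \<in> carrier A" "f = (\<lambda>_. a)" by (auto simp: RM_def)
    then show "\<exists>g\<in>carrier RM. g \<oplus>\<^bsub>RM\<^esub> f = \<zero>\<^bsub>RM\<^esub>"
      by (intro bexI[of _ "\<lambda>_. \<ominus>\<^bsub>A\<^esub> a"]) (auto simp: RM_def A.l_neg)
  qed (auto simp: RM_def A.a_ac A.m_assoc A.l_distr A.r_distr)
  \<comment> \<open>The functions in the carrier are constant, so the argument \<open>undefined\<close> is immaterial.\<close>
  let ?g = "\<lambda>f. f undefined \<odot>\<^bsub>Q\<^esub> q0"
  have g: "?g \<in> LinearCombinations.module_hom A RM Q"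
    unfolding LinearCombinations.module_hom_def
    by (auto simp: RM_def QM.smult_closed q0 QM.smult_l_distr QM.smult_assoc)
  have "?g ` carrier RM = carrier Q"
  proof
    show "carrier Q \<subseteq> ?g ` carrier RM"
    proof
      fix x assume "x \<in> carrier Q"
      then obtain f where "f \<in> carrier F" "x = cls f \<odot>\<^bsub>Q\<^esub> q0" using Q_cyclic by blast
      then show "x \<in> ?g ` carrier RM" by (intro image_eqI[of _ _ "\<lambda>_. cls f"]) (auto simp: RM_def)
    qed
  qed (auto simp: RM_def QM.smult_closed q0)
  moreover have "(\<lambda>x. x) \<in> LinearCombinations.module_hom A Q Q"
    by (simp add: LinearCombinations.module_hom_def)
  moreover note RM g QM.left_module_axioms
  moreover have proj: "\<And>(M :: (((nat \<Rightarrow> 'l) list \<Rightarrow> 'k) set set, 'q \<Rightarrow> ((nat \<Rightarrow> 'l) list \<Rightarrow> 'k) set set) module)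
      (N :: (((nat \<Rightarrow> 'l) list \<Rightarrow> 'k) set set, 'q) module) f g.
        left_module A M \<Longrightarrow> left_module A N \<Longrightarrow>
        g \<in> LinearCombinations.module_hom A M N \<Longrightarrow> g ` carrier M = carrier N \<Longrightarrow>
        f \<in> LinearCombinations.module_hom A Q N \<Longrightarrow>
        \<exists>h \<in> LinearCombinations.module_hom A Q M. \<forall>x\<in>carrier Q. g (h x) = f x"
    using cover unfolding projective_cover_def projective_module_def by blast
  ultimately obtain s where s: "s \<in> LinearCombinations.module_hom A Q RM"
    and gs: "\<forall>x\<in>carrier Q. ?g (s x) = x" by blast
  have "s q0 \<in> carrier RM" using s q0 by (auto simp: LinearCombinations.module_hom_def)
  then obtain e where e: "e \<in> carrier A" "s q0 = (\<lambda>_. e)" by (auto simp: RM_def)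
  have sm: "s (a \<odot>\<^bsub>Q\<^esub> x) = a \<odot>\<^bsub>RM\<^esub> s x" if "a \<in> carrier A" "x \<in> carrier Q" for a x
    using s that by (auto simp: LinearCombinations.module_hom_def)
  have s0: "s \<zero>\<^bsub>Q\<^esub> = (\<lambda>_. \<zero>\<^bsub>A\<^esub>)"
    using sm[of "\<zero>\<^bsub>A\<^esub>" q0] q0 e by (simp add: QM.smult_zero_left RM_def)
  have "a \<otimes>\<^bsub>A\<^esub> e = \<zero>\<^bsub>A\<^esub>" if "a \<in> carrier A" "a \<odot>\<^bsub>Q\<^esub> q0 = \<zero>\<^bsub>Q\<^esub>" for a
    using sm[of a q0] that q0 e s0 by (simp add: RM_def fun_eq_iff)
  moreover have "e \<odot>\<^bsub>Q\<^esub> q0 = q0" using gs q0 e by auto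
  ultimately show ?thesis using e by blast
qed

text \<open>Let \<open>f\<close> represent an element annihilating \<open>q0\<close> and \<open>g\<close> the element \<open>e\<close> of \<open>cover_section\<close>. Their product
  vanishes, so the evaluation of \<open>f g\<close> is a combination of monomials outside the box. As \<open>e\<close> fixes \<open>q0\<close>, it acts on \<open>K\<close> by one; hence the
  evaluation of \<open>g\<close> has constant term one and can be cancelled.\<close>

lemma annihilator_box_null:
  assumes f: "f \<in> carrier F" and z: "cls f \<odot>\<^bsub>Q\<^esub> q0 = \<zero>\<^bsub>Q\<^esub>"
  shows "box_null (ev f)"
proof -
  obtain e where e: "e \<in> carrier A" "e \<odot>\<^bsub>Q\<^esub> q0 = q0"
    and ann: "\<forall>a\<in>carrier A. a \<odot>\<^bsub>Q\<^esub> q0 = \<zero>\<^bsub>Q\<^esub> \<longrightarrow> a \<otimes>\<^bsub>A\<^esub> e = \<zero>\<^bsub>A\<^esub>"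
    using cover_section by blast
  obtain g where g: "g \<in> carrier F" "e = cls g" using cls_surj[OF e(1)] by blast
  have "scal (eps g) \<odot>\<^bsub>K\<^esub> v0 = scal 1 \<odot>\<^bsub>K\<^esub> v0"
    using arg_cong[OF e(2), of \<pi>] e(1) q0 v0(1) g
    by (simp add: pi_smult cls_K scal_one KM.smult_one)
  then have "eps g = 1" by (rule scal_eqD)
  moreover have "cls (f \<otimes>\<^bsub>F\<^esub> g) = \<zero>\<^bsub>A\<^esub>" using ann f z g by simp
  then have "box_null (ev (f \<otimes>\<^bsub>F\<^esub> g))" using f g by (intro box_null_ev_of_cls_zero) auto
  ultimately show ?thesis
    using box_null_cancel[of "ev f" "ev g"] f g by (simp add: free_eval_mult eps_def)
qed

definition spanned :: "'q set" where
  "spanned = {cls r \<odot>\<^bsub>Q\<^esub> q0 | r. r \<in> reduced}"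

lemma spannedI: "r \<in> reduced \<Longrightarrow> cls r \<odot>\<^bsub>Q\<^esub> q0 \<in> spanned"
  unfolding spanned_def by blast

lemma spanned_closed: "spanned \<subseteq> carrier Q"
  using reduced_closed QM.smult_closed q0 by (auto simp: spanned_def)

lemma spanned_add:
  assumes "x \<in> spanned" "z \<in> spanned"
  shows "x \<oplus>\<^bsub>Q\<^esub> z \<in> spanned"
proof -
  obtain r s where rs: "r \<in> reduced" "s \<in> reduced" "x = cls r \<odot>\<^bsub>Q\<^esub> q0" "z = cls s \<odot>\<^bsub>Q\<^esub> q0"
    using assms by (auto simp: spanned_def)
  have "r \<oplus>\<^bsub>F\<^esub> s \<in> reduced"
    unfolding reduced_def free_add
  proof (intro CollectI allI impI)
    fix w assume "r w + s w \<noteq> 0"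
    then have "r w \<noteq> 0 \<or> s w \<noteq> 0" by auto
    then show "w \<in> box_word ` box" using rs by (auto simp: reduced_def)
  qed
  moreover have "x \<oplus>\<^bsub>Q\<^esub> z = cls (r \<oplus>\<^bsub>F\<^esub> s) \<odot>\<^bsub>Q\<^esub> q0"
    using rs reduced_closed q0 by (simp add: QM.smult_l_distr)
  ultimately show ?thesis by (auto simp: spanned_def)
qed

lemma spanned_scal:
  assumes "x \<in> spanned"
  shows "scal c \<odot>\<^bsub>Q\<^esub> x \<in> spanned"
proof -
  obtain r where r: "r \<in> reduced" "x = cls r \<odot>\<^bsub>Q\<^esub> q0"
    using assms by (auto simp: spanned_def)
  have "free_const c \<otimes>\<^bsub>F\<^esub> r \<in> reduced"
    using r by (auto simp: reduced_def free_const_mult)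
  moreover have "scal c \<odot>\<^bsub>Q\<^esub> x = cls (free_const c \<otimes>\<^bsub>F\<^esub> r) \<odot>\<^bsub>Q\<^esub> q0"
    using r reduced_closed q0 by (simp add: scal_eq free_const_closed QM.smult_assoc)
  ultimately show ?thesis by (auto simp: spanned_def)
qed

lemma spanned_word:
  assumes "M \<in> box"
  shows "aprod (box_word M) \<odot>\<^bsub>Q\<^esub> q0 \<in> spanned"
proof -
  have "(\<lambda>u. if u = box_word M then 1 else 0) \<in> reduced"
    using assms by (auto simp: reduced_def)
  from spannedI[OF this]
  have "cls (\<lambda>u. if u = box_word M then 1 else 0) \<odot>\<^bsub>Q\<^esub> q0 \<in> spanned" .
  moreover have "cls (\<lambda>u. if u = box_word M then 1 else 0) = aprod (box_word M)"
    using cls_word[OF box_word_lists[OF assms], of 1] aprod_closed[OF box_word_lists[OF assms]]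
    by (simp add: scal_one)
  ultimately show ?thesis by simp
qed

lemma spanned_zero: "\<zero>\<^bsub>Q\<^esub> \<in> spanned"
proof -
  have "\<zero>\<^bsub>F\<^esub> \<in> reduced" by (simp add: reduced_def free_zero)
  from spannedI[OF this] have "cls \<zero>\<^bsub>F\<^esub> \<odot>\<^bsub>Q\<^esub> q0 \<in> spanned" .
  moreover have "cls \<zero>\<^bsub>F\<^esub> \<odot>\<^bsub>Q\<^esub> q0 = \<zero>\<^bsub>Q\<^esub>" using q0 by (simp add: QM.smult_zero_left)
  ultimately show ?thesis by simp
qed

text \<open>The elements of the algebra under which the span of the monomials in the box is stable. They form a subalgebra;
  that it is the whole algebra is checked on generators.\<close>

definition preserving :: "((nat \<Rightarrow> 'l) list \<Rightarrow> 'k) set set set" where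
  "preserving = {a \<in> carrier A. \<forall>x\<in>spanned. a \<odot>\<^bsub>Q\<^esub> x \<in> spanned}"

lemma preserving_mult: "a \<in> preserving \<Longrightarrow> b \<in> preserving \<Longrightarrow> a \<otimes>\<^bsub>A\<^esub> b \<in> preserving"
  using spanned_closed by (auto simp: preserving_def QM.smult_assoc subset_iff)

lemma preserving_add: "a \<in> preserving \<Longrightarrow> b \<in> preserving \<Longrightarrow> a \<oplus>\<^bsub>A\<^esub> b \<in> preserving"
  using spanned_closed spanned_add by (auto simp: preserving_def QM.smult_l_distr subset_iff)

lemma preserving_scal: "scal c \<in> preserving"
  using spanned_scal by (simp add: preserving_def)

lemma preserving_zero: "\<zero>\<^bsub>A\<^esub> \<in> preserving"
  using preserving_scal[of 0] by (simp add: scal_zero)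

lemma preserving_pow: "a \<in> preserving \<Longrightarrow> a [^]\<^bsub>A\<^esub> (n::nat) \<in> preserving"
  using preserving_scal[of 1] by (induction n) (auto simp: scal_one intro: preserving_mult)

lemma preserving_gen_elem:
  assumes g: "g \<in> Gens"
  shows "inc (gen_elem g) \<in> preserving"
proof -
  have gc: "inc (gen_elem g) \<in> carrier A" using gen_elem_closed[OF g] by simp
  have "inc (gen_elem g) \<odot>\<^bsub>Q\<^esub> x \<in> spanned" if x: "x \<in> spanned" for x
  proof -
    obtain r where r: "r \<in> reduced" "x = cls r \<odot>\<^bsub>Q\<^esub> q0" using x by (auto simp: spanned_def)
    have part: "(\<lambda>w. if w \<in> W then r w else 0) \<in> carrier F \<and>
        inc (gen_elem g) \<odot>\<^bsub>Q\<^esub> (cls (\<lambda>w. if w \<in> W then r w else 0) \<odot>\<^bsub>Q\<^esub> q0) \<in> spanned"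
      if "finite W" "W \<subseteq> box_word ` box" for W
      using that
    proof (induction W rule: finite_induct)
      case empty
      have "(\<lambda>w. if w \<in> {} then r w else 0) = \<zero>\<^bsub>F\<^esub>" by (simp add: fun_eq_iff free_zero)
      then show ?case
        using gc q0 spanned_zero by (simp add: QM.smult_zero_left QM.smult_zero_right)
    next
      case (insert w W)
      let ?s = "\<lambda>u. if u \<in> W then r u else 0" and ?t = "\<lambda>u. if u = w then r w else 0"
      have "w \<in> box_word ` box" using insert.prems by blast
      then obtain M where M: "M \<in> box" "w = box_word M" by (elim imageE) blast
      note ww = box_word_lists[OF M(1), folded M(2)]
      have s: "?s \<in> carrier F" "inc (gen_elem g) \<odot>\<^bsub>Q\<^esub> (cls ?s \<odot>\<^bsub>Q\<^esub> q0) \<in> spanned" using insert by auto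
      have t: "?t \<in> carrier F" "cls ?t = scal (r w) \<otimes>\<^bsub>A\<^esub> aprod w" using cls_word[OF ww, of "r w"] by auto
      have eq: "(\<lambda>u. if u \<in> insert w W then r u else 0) = ?t \<oplus>\<^bsub>F\<^esub> ?s"
        using insert by (auto simp: free_add fun_eq_iff)
      have "inc (gen_elem g) \<odot>\<^bsub>Q\<^esub> (cls ?t \<odot>\<^bsub>Q\<^esub> q0) = scal (r w) \<odot>\<^bsub>Q\<^esub> ((inc (gen_elem g) \<otimes>\<^bsub>A\<^esub> aprod w) \<odot>\<^bsub>Q\<^esub> q0)"
        using gc t q0 aprod_closed[OF ww] by (simp add: A.m_lcomm flip: QM.smult_assoc)
      also have "\<dots> \<in> spanned"
        using box_insert[OF M(1) g] spanned_word spanned_zero q0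
        by (intro spanned_scal) (simp add: M(2) QM.smult_zero_left)
      finally have tt: "inc (gen_elem g) \<odot>\<^bsub>Q\<^esub> (cls ?t \<odot>\<^bsub>Q\<^esub> q0) \<in> spanned" .
      have "inc (gen_elem g) \<odot>\<^bsub>Q\<^esub> (cls (?t \<oplus>\<^bsub>F\<^esub> ?s) \<odot>\<^bsub>Q\<^esub> q0)
          = inc (gen_elem g) \<odot>\<^bsub>Q\<^esub> (cls ?t \<odot>\<^bsub>Q\<^esub> q0) \<oplus>\<^bsub>Q\<^esub> inc (gen_elem g) \<odot>\<^bsub>Q\<^esub> (cls ?s \<odot>\<^bsub>Q\<^esub> q0)"
        using gc s(1) t(1) q0 by (simp add: QM.smult_l_distr QM.smult_r_distr QM.smult_closed)
      then show ?case unfolding eq using s t tt spanned_add by simp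
    qed
    have "(\<lambda>w. if w \<in> box_word ` box then r w else 0) = r"
      using r by (auto simp: reduced_def fun_eq_iff)
    then show ?thesis using part[of "box_word ` box"] card_box r by simp
  qed
  then show ?thesis using gc by (simp add: preserving_def)
qed

text \<open>In degree zero the torus acts by scalars. In degree \<open>j > 0\<close> the element \<open>h\<close> is a combination of \<open>p ^ val j\<close>-th
  powers of basis elements, and so \<open>h t^j\<close> is a combination of such powers of the generators \<open>b t^(core j)\<close>.\<close>

lemma preserving_t_power:
  assumes h: "h \<in> carrier L" and j: "j \<le> m"
  shows "inc (t_power L h j) \<in> preserving"
proof (cases "j = 0")
  case True
  have "inc (t_power L h 0) \<odot>\<^bsub>Q\<^esub> x \<in> spanned" if x: "x \<in> spanned" for x
  proof -
    have xc: "x \<in> carrier Q" using x spanned_closed by blast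
    have "inc (t_power L h 0) \<odot>\<^bsub>Q\<^esub> x \<ominus>\<^bsub>Q\<^esub> scal (lam h) \<odot>\<^bsub>Q\<^esub> x = \<zero>\<^bsub>Q\<^esub>"
      using shifted_Q[OF h xc] h xc by (simp add: shifted_def QM.smult_minus_left)
    then have "inc (t_power L h 0) \<odot>\<^bsub>Q\<^esub> x = scal (lam h) \<odot>\<^bsub>Q\<^esub> x"
      using h xc by (simp add: QM.M.minus_eq_zero_iff QM.smult_closed)
    then show ?thesis using spanned_scal[OF x] by simp
  qed
  then show ?thesis using True h by (simp add: preserving_def)
next
  case False
  then have pos: "j > 0" by simp
  have basis_case: "inc (t_power L ((Fr ^^ val j) b) j) \<in> preserving" if b: "b \<in> B" for b
  proof -
    have "(b, core j) \<in> Gens"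
      using b pos j core_pos[of j] core_not_dvd[of j] core_le[of j] by (auto simp: Gens_def)
    from preserving_pow[OF preserving_gen_elem[OF this], of "p ^ val j"]
    show ?thesis
      using inc_t_power_pow[of b "core j" "val j"] B_carrier b core_pos[OF pos] core_val[of j] j
      by (auto simp: gen_elem_def)
  qed
  have t_smult: "t_power L (c \<odot>\<^bsub>L\<^esub> g) j = c \<odot>\<^bsub>C\<^esub> t_power L g j" for c g
    by (auto simp: t_power_def current_smult)
  have t_add: "t_power L (g \<oplus>\<^bsub>L\<^esub> g') j = t_power L g j \<oplus>\<^bsub>C\<^esub> t_power L g' j" for g g'
    by (auto simp: t_power_def current_add)
  have t_zero: "t_power L \<zero>\<^bsub>L\<^esub> j = \<zero>\<^bsub>C\<^esub>"
    by (auto simp: t_power_def current_zero)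
  obtain a where a: "h = comb (val j) a" using comb_surj[OF h] by blast
  have "inc (t_power L (\<Oplus>\<^bsub>L\<^esub>b\<in>S. a b \<odot>\<^bsub>L\<^esub> (Fr ^^ val j) b) j) \<in> preserving" if "S \<subseteq> B" for S
    using finite_subset[OF that fB] that
  proof (induction S rule: finite_induct)
    case empty
    then show ?case by (simp add: t_zero inc_zero preserving_zero)
  next
    case (insert b S)
    have S: "(\<lambda>b. a b \<odot>\<^bsub>L\<^esub> (Fr ^^ val j) b) \<in> S \<rightarrow> carrier L" using insert by auto
    have "inc (t_power L (a b \<odot>\<^bsub>L\<^esub> (Fr ^^ val j) b) j) \<in> preserving"
      unfolding t_smult using insert j
      by (subst inc_smult) (auto intro!: t_power_closed preserving_mult preserving_scal basis_case)
    then show ?case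
      using insert S j
      by (simp add: t_add inc_add t_power_closed L.M.finsum_closed preserving_add)
  qed
  from this[of B] show ?thesis by (simp add: a comb_def)
qed

lemma preserving_all: "a \<in> carrier A \<Longrightarrow> a \<in> preserving"
proof (induction a rule: alg_induct)
  case (inc x a)
  have "inc x \<in> preserving" using inc(1)
  proof (induction x rule: current_induct)
    case zero
    then show ?case by (simp add: inc_zero preserving_zero)
  next
    case (add x y)
    then show ?case by (simp add: inc_add preserving_add)
  qed (rule preserving_t_power)
  then show ?case using inc preserving_mult by blast
qed (auto intro: preserving_scal preserving_add)

lemma spanned_all:
  assumes "x \<in> carrier Q"
  shows "\<exists>r\<in>reduced. x = cls r \<odot>\<^bsub>Q\<^esub> q0"
proof -
  obtain f where f: "f \<in> carrier F" "x = cls f \<odot>\<^bsub>Q\<^esub> q0" using Q_cyclic[OF assms] by blast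
  have "box_word {#} = []" using some_mset[of "{#}"] by (simp add: box_word_def)
  then have "q0 \<in> spanned" using spanned_word[OF empty_in_box] q0 by (simp add: QM.smult_one)
  then have "x \<in> spanned" using preserving_all[of "cls f"] f by (auto simp: preserving_def)
  then show ?thesis by (auto simp: spanned_def)
qed

text \<open>Modulo the annihilator every element is a combination of the monomials in the box, and such a combination is
  determined by its evaluation. So \<open>Q\<close> is isomorphic to the truncated polynomial algebra.\<close>

theorem annihilator_iff:
  assumes f: "f \<in> carrier F"
  shows "cls f \<odot>\<^bsub>Q\<^esub> q0 = \<zero>\<^bsub>Q\<^esub> \<longleftrightarrow> box_null (ev f)"
proof
  assume z: "box_null (ev f)"
  obtain r where r: "r \<in> reduced" "cls f \<odot>\<^bsub>Q\<^esub> q0 = cls r \<odot>\<^bsub>Q\<^esub> q0"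
    using spanned_all[of "cls f \<odot>\<^bsub>Q\<^esub> q0"] f q0 by (auto simp: QM.smult_closed)
  note rc = reduced_closed[OF r(1)]
  have "cls (f \<ominus>\<^bsub>F\<^esub> r) \<odot>\<^bsub>Q\<^esub> q0 = \<zero>\<^bsub>Q\<^esub>"
    using f r rc q0 by (simp add: cls_minus QM.smult_minus_left QM.M.minus_eq_zero_iff QM.smult_closed)
  then have "box_null (ev (f \<ominus>\<^bsub>F\<^esub> r))" using f rc by (intro annihilator_box_null) auto
  then have "box_null (ev r)" using z f rc by (auto simp: free_eval_minus box_null_def lookup_minus)
  then have "r = \<zero>\<^bsub>F\<^esub>" by (rule box_null_reduced[OF r(1)])
  then show "cls f \<odot>\<^bsub>Q\<^esub> q0 = \<zero>\<^bsub>Q\<^esub>" using r q0 by (simp add: QM.smult_zero_left)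
qed (rule annihilator_box_null[OF f])

end

context left_module
begin

section \<open>Quotient modules\<close>

definition quot :: "'m set \<Rightarrow> 'm set \<Rightarrow> ('a, 'm set) module" where
  "quot N S = quotient_module (M\<lparr>carrier := N\<rparr>) S"

definition coset_of :: "'m set \<Rightarrow> 'm \<Rightarrow> 'm set" where
  "coset_of S x = (\<lambda>s. s \<oplus>\<^bsub>M\<^esub> x) ` S"

lemma quot_simps:
  "carrier (quot N S) = coset_of S ` N"
  "\<zero>\<^bsub>quot N S\<^esub> = S"
  "X \<oplus>\<^bsub>quot N S\<^esub> X' = {x \<oplus>\<^bsub>M\<^esub> x' | x x'. x \<in> X \<and> x' \<in> X'}"
  "a \<odot>\<^bsub>quot N S\<^esub> X = (\<Union>x\<in>X. coset_of S (a \<odot>\<^bsub>M\<^esub> x))"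
  unfolding quot_def quotient_module_def
  by (auto simp: A_RCOSETS_def RCOSETS_def a_r_coset_def r_coset_def coset_of_def set_add_def set_mult_def
      UNION_singleton_eq_range)

context
  fixes S assumes S: "Module.submodule S R M"
begin

lemma coset_of_eq_iff:
  assumes "x \<in> carrier M" "z \<in> carrier M"
  shows "coset_of S x = coset_of S z \<longleftrightarrow> x \<ominus>\<^bsub>M\<^esub> z \<in> S"
proof
  note S' = submodule_dest[OF S]
  assume "coset_of S x = coset_of S z"
  moreover have "x \<in> coset_of S x" unfolding coset_of_def
    by (rule image_eqI[of _ _ "\<zero>\<^bsub>M\<^esub>"]) (use assms S' in auto)
  ultimately obtain s where "s \<in> S" "x = s \<oplus>\<^bsub>M\<^esub> z" by (auto simp: coset_of_def)
  then show "x \<ominus>\<^bsub>M\<^esub> z \<in> S"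
    using assms S'(1) by (auto simp: a_minus_def M.a_assoc M.r_neg subset_iff)
next
  note S' = submodule_dest[OF S]
  assume d: "x \<ominus>\<^bsub>M\<^esub> z \<in> S"
  have sub: "coset_of S a \<subseteq> coset_of S b" if "a \<in> carrier M" "b \<in> carrier M" "a \<ominus>\<^bsub>M\<^esub> b \<in> S" for a b
  proof
    fix w assume "w \<in> coset_of S a"
    then obtain s where s: "s \<in> S" "w = s \<oplus>\<^bsub>M\<^esub> a" by (auto simp: coset_of_def)
    have "w = (s \<oplus>\<^bsub>M\<^esub> (a \<ominus>\<^bsub>M\<^esub> b)) \<oplus>\<^bsub>M\<^esub> b"
      using s that S'(1) by (auto simp: a_minus_def M.a_assoc M.l_neg subset_iff)
    then show "w \<in> coset_of S b" unfolding coset_of_def using S'(3) s that by blast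
  qed
  have "z \<ominus>\<^bsub>M\<^esub> x = (\<ominus>\<^bsub>R\<^esub> \<one>\<^bsub>R\<^esub>) \<odot>\<^bsub>M\<^esub> (x \<ominus>\<^bsub>M\<^esub> z)"
    using assms by (simp add: smult_uminus_left smult_one a_minus_def M.minus_add M.a_comm)
  then have "z \<ominus>\<^bsub>M\<^esub> x \<in> S" using S'(4) d by simp
  then show "coset_of S x = coset_of S z" using sub assms d by blast
qed

lemma coset_of_zero: "coset_of S \<zero>\<^bsub>M\<^esub> = S"
  using submodule_dest(1)[OF S] by (force simp: coset_of_def image_iff subset_iff)

lemma quot_add:
  assumes "x \<in> carrier M" "z \<in> carrier M"
  shows "coset_of S x \<oplus>\<^bsub>quot N S\<^esub> coset_of S z = coset_of S (x \<oplus>\<^bsub>M\<^esub> z)"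
proof
  note S' = submodule_dest[OF S]
  show "coset_of S x \<oplus>\<^bsub>quot N S\<^esub> coset_of S z \<subseteq> coset_of S (x \<oplus>\<^bsub>M\<^esub> z)"
  proof
    fix w assume "w \<in> coset_of S x \<oplus>\<^bsub>quot N S\<^esub> coset_of S z"
    then obtain s t where st: "s \<in> S" "t \<in> S" "w = (s \<oplus>\<^bsub>M\<^esub> x) \<oplus>\<^bsub>M\<^esub> (t \<oplus>\<^bsub>M\<^esub> z)"
      by (auto simp: quot_simps coset_of_def)
    have "s \<in> carrier M" "t \<in> carrier M" using st S' by auto
    then have "w = (s \<oplus>\<^bsub>M\<^esub> t) \<oplus>\<^bsub>M\<^esub> (x \<oplus>\<^bsub>M\<^esub> z)"
      using st assms by (simp add: M.a_ac)
    then show "w \<in> coset_of S (x \<oplus>\<^bsub>M\<^esub> z)" using S'(3) st by (auto simp: coset_of_def)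
  qed
  show "coset_of S (x \<oplus>\<^bsub>M\<^esub> z) \<subseteq> coset_of S x \<oplus>\<^bsub>quot N S\<^esub> coset_of S z"
  proof
    fix w assume "w \<in> coset_of S (x \<oplus>\<^bsub>M\<^esub> z)"
    then obtain s where s: "s \<in> S" "w = s \<oplus>\<^bsub>M\<^esub> (x \<oplus>\<^bsub>M\<^esub> z)" by (auto simp: coset_of_def)
    then have "s \<in> carrier M" using S' by auto
    then have "w = (s \<oplus>\<^bsub>M\<^esub> x) \<oplus>\<^bsub>M\<^esub> (\<zero>\<^bsub>M\<^esub> \<oplus>\<^bsub>M\<^esub> z)" using s assms by (simp add: M.a_assoc)
    then show "w \<in> coset_of S x \<oplus>\<^bsub>quot N S\<^esub> coset_of S z"
      unfolding quot_simps coset_of_def using s(1) S'(2) by blast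
  qed
qed

lemma quot_smult:
  assumes "x \<in> carrier M" "a \<in> carrier R"
  shows "a \<odot>\<^bsub>quot N S\<^esub> coset_of S x = coset_of S (a \<odot>\<^bsub>M\<^esub> x)"
proof -
  note S' = submodule_dest[OF S]
  have "coset_of S (a \<odot>\<^bsub>M\<^esub> z) = coset_of S (a \<odot>\<^bsub>M\<^esub> x)" if "z \<in> coset_of S x" for z
  proof -
    obtain s where s: "s \<in> S" "z = s \<oplus>\<^bsub>M\<^esub> x" using \<open>z \<in> coset_of S x\<close> by (auto simp: coset_of_def)
    then have sc: "s \<in> carrier M" using S' by auto
    have "a \<odot>\<^bsub>M\<^esub> z \<ominus>\<^bsub>M\<^esub> a \<odot>\<^bsub>M\<^esub> x = a \<odot>\<^bsub>M\<^esub> s"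
      using s sc assms by (simp add: smult_r_distr smult_closed a_minus_def M.a_assoc M.r_neg)
    then have "a \<odot>\<^bsub>M\<^esub> z \<ominus>\<^bsub>M\<^esub> a \<odot>\<^bsub>M\<^esub> x \<in> S" using S'(4) s assms by simp
    then show ?thesis using s sc assms by (subst coset_of_eq_iff) (auto simp: smult_closed)
  qed
  moreover have "coset_of S x \<noteq> {}" using S'(2) by (auto simp: coset_of_def)
  ultimately show ?thesis unfolding quot_simps by auto
qed

lemma quot_left_module:
  assumes N: "Module.submodule N R M"
  shows "left_module R (quot N S)"
proof -
  note N' = submodule_dest[OF N] and S' = submodule_dest[OF S]
  have nc: "x \<in> carrier M" if "x \<in> N" for x using that N' by blast
  show ?thesis
  proof (intro left_module.intro left_module_axioms.intro R.ring_axioms abelian_groupI)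
    show "\<zero>\<^bsub>quot N S\<^esub> \<in> carrier (quot N S)"
      unfolding quot_simps using N'(2) coset_of_zero by blast
    fix X assume X: "X \<in> carrier (quot N S)"
    then obtain x where x: "x \<in> N" "X = coset_of S x" by (auto simp: quot_simps)
    have z: "\<zero>\<^bsub>quot N S\<^esub> = coset_of S \<zero>\<^bsub>M\<^esub>" by (simp add: quot_simps coset_of_zero)
    show "\<zero>\<^bsub>quot N S\<^esub> \<oplus>\<^bsub>quot N S\<^esub> X = X"
      using x nc[of x] by (simp only: z x(2) quot_add M.zero_closed M.l_zero)
    show "\<exists>Z\<in>carrier (quot N S). Z \<oplus>\<^bsub>quot N S\<^esub> X = \<zero>\<^bsub>quot N S\<^esub>"
    proof
      have "\<zero>\<^bsub>M\<^esub> \<ominus>\<^bsub>M\<^esub> x \<in> N" using N'(5)[OF N'(2) x(1)] .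
      then have "\<ominus>\<^bsub>M\<^esub> x \<in> N" using x nc[of x] by (simp add: a_minus_def)
      then show "coset_of S (\<ominus>\<^bsub>M\<^esub> x) \<in> carrier (quot N S)" by (simp add: quot_simps)
      show "coset_of S (\<ominus>\<^bsub>M\<^esub> x) \<oplus>\<^bsub>quot N S\<^esub> X = \<zero>\<^bsub>quot N S\<^esub>"
        using x nc[of x] by (simp add: z quot_add M.l_neg)
    qed
    show "\<one>\<^bsub>R\<^esub> \<odot>\<^bsub>quot N S\<^esub> X = X" using x nc[of x] by (simp add: quot_smult smult_one)
    {
      fix a assume a: "a \<in> carrier R"
      show "a \<odot>\<^bsub>quot N S\<^esub> X \<in> carrier (quot N S)"
        using x nc[of x] a N'(4)[OF a x(1)] by (simp add: quot_smult) (simp add: quot_simps)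
      fix b assume b: "b \<in> carrier R"
      show "(a \<oplus>\<^bsub>R\<^esub> b) \<odot>\<^bsub>quot N S\<^esub> X = a \<odot>\<^bsub>quot N S\<^esub> X \<oplus>\<^bsub>quot N S\<^esub> b \<odot>\<^bsub>quot N S\<^esub> X"
        using x nc[of x] a b by (simp add: quot_smult quot_add smult_closed smult_l_distr)
      show "(a \<otimes>\<^bsub>R\<^esub> b) \<odot>\<^bsub>quot N S\<^esub> X = a \<odot>\<^bsub>quot N S\<^esub> (b \<odot>\<^bsub>quot N S\<^esub> X)"
        using x nc[of x] a b by (simp add: quot_smult smult_closed smult_assoc)
    }
    fix Y assume Y: "Y \<in> carrier (quot N S)"
    then obtain y where y: "y \<in> N" "Y = coset_of S y" by (auto simp: quot_simps)
    show "X \<oplus>\<^bsub>quot N S\<^esub> Y \<in> carrier (quot N S)"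
      using x y nc[of x] nc[of y] N'(3)[OF x(1) y(1)] by (simp add: quot_add) (simp add: quot_simps)
    show "X \<oplus>\<^bsub>quot N S\<^esub> Y = Y \<oplus>\<^bsub>quot N S\<^esub> X"
      using x y nc[of x] nc[of y] by (simp add: quot_add M.a_comm)
    {
      fix a assume a: "a \<in> carrier R"
      show "a \<odot>\<^bsub>quot N S\<^esub> (X \<oplus>\<^bsub>quot N S\<^esub> Y) = a \<odot>\<^bsub>quot N S\<^esub> X \<oplus>\<^bsub>quot N S\<^esub> a \<odot>\<^bsub>quot N S\<^esub> Y"
        using x y nc[of x] nc[of y] a by (simp add: quot_smult quot_add smult_closed smult_r_distr)
    }
    fix Z assume Z: "Z \<in> carrier (quot N S)"
    then obtain z where z: "z \<in> N" "Z = coset_of S z" by (auto simp: quot_simps)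
    show "X \<oplus>\<^bsub>quot N S\<^esub> Y \<oplus>\<^bsub>quot N S\<^esub> Z = X \<oplus>\<^bsub>quot N S\<^esub> (Y \<oplus>\<^bsub>quot N S\<^esub> Z)"
      using x y z nc[of x] nc[of y] nc[of z] by (simp add: quot_add M.a_assoc)
  qed
qed

end

end

section \<open>Coordinates on the cover\<close>

context toral_weight
begin

definition trunc :: "(('l \<times> nat) multiset \<Rightarrow>\<^sub>0 'k) \<Rightarrow> (('l \<times> nat) multiset \<Rightarrow>\<^sub>0 'k)" where
  "trunc P = (\<Sum>M\<in>box. Poly_Mapping.single M (Poly_Mapping.lookup P M))"

lemma lookup_trunc:
  "Poly_Mapping.lookup (trunc P) M = (if M \<in> box then Poly_Mapping.lookup P M else 0)"
proof -
  have "Poly_Mapping.lookup (trunc P) M = (\<Sum>N\<in>box. if N = M then Poly_Mapping.lookup P N else 0)"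
    unfolding trunc_def lookup_sum by (intro sum.cong) (auto simp: lookup_single when_def)
  then show ?thesis using card_box by simp
qed

lemma trunc_eq_iff: "trunc P = trunc P' \<longleftrightarrow> box_null (P - P')"
proof
  assume "trunc P = trunc P'"
  then have eq: "Poly_Mapping.lookup (trunc P) M = Poly_Mapping.lookup (trunc P') M" for M by simp
  show "box_null (P - P')"
    unfolding box_null_def lookup_minus using eq by (metis lookup_trunc right_minus_eq)
next
  assume "box_null (P - P')"
  then show "trunc P = trunc P'"
    by (intro poly_mapping_eqI) (auto simp: box_null_def lookup_minus lookup_trunc)
qed

abbreviation "scale \<equiv> \<lambda>c P. (Poly_Mapping.single 0 c :: ('l \<times> nat) multiset \<Rightarrow>\<^sub>0 'k) * P"

sublocale VS: vector_space scale
  by unfold_locales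
     (simp_all add: distrib_left distrib_right single_add mult_single mult.assoc[symmetric])

definition monomials :: "(('l \<times> nat) multiset \<Rightarrow>\<^sub>0 'k) set" where
  "monomials = (\<lambda>M. Poly_Mapping.single M 1) ` box"

lemma inj_monomials: "inj_on (\<lambda>M. Poly_Mapping.single M (1::'k)) box"
proof (rule inj_onI)
  fix M N :: "('l \<times> nat) multiset"
  assume "Poly_Mapping.single M (1::'k) = Poly_Mapping.single N 1"
  then have "Poly_Mapping.lookup (Poly_Mapping.single M (1::'k)) M = Poly_Mapping.lookup (Poly_Mapping.single N 1) M"
    by simp
  then show "M = N" by (simp add: lookup_single when_def split: if_splits)
qed

lemma card_monomials: "finite monomials" "card monomials = p ^ (m * card B)"
  unfolding monomials_def using card_box card_image[OF inj_monomials] by auto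

lemma independent_monomials: "VS.independent monomials"
proof
  assume "VS.dependent monomials"
  then obtain u v where v: "v \<in> monomials" "u v \<noteq> 0" and z: "(\<Sum>v\<in>monomials. scale (u v) v) = 0"
    unfolding VS.dependent_finite[OF card_monomials(1)] by blast
  obtain M where M: "M \<in> box" "v = Poly_Mapping.single M 1" using v(1) by (auto simp: monomials_def)
  have "0 = Poly_Mapping.lookup (\<Sum>v\<in>monomials. scale (u v) v) M" using z by simp
  also have "\<dots> = (\<Sum>N\<in>box. if N = M then u v else 0)"
    unfolding monomials_def sum.reindex[OF inj_monomials] lookup_sum M(2)
    by (intro sum.cong) (auto simp: mult_single lookup_single when_def)
  also have "\<dots> = u v" using M(1) card_box by simp
  finally show False using v(2) by simp
qed

lemma trunc_in_span: "trunc P \<in> VS.span monomials"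
proof -
  have "Poly_Mapping.single M c = scale c (Poly_Mapping.single M 1)" for M and c :: 'k
    by (simp add: mult_single)
  then show ?thesis unfolding trunc_def monomials_def
    by (metis (no_types, lifting) VS.span_base VS.span_scale VS.span_sum imageI)
qed

end

context toral_cover
begin

text \<open>A linear isomorphism from \<open>Q\<close> onto the span of the monomials in the box: an element \<open>f q0\<close> goes to the
  part of the evaluation of \<open>f\<close> inside the box. It serves to measure dimensions of subspaces of \<open>Q\<close> in a vector
  space on a type.\<close>

definition box_coeffs :: "'q \<Rightarrow> (('l \<times> nat) multiset \<Rightarrow>\<^sub>0 'k)" where
  "box_coeffs x = trunc (ev (SOME f. f \<in> carrier F \<and> x = cls f \<odot>\<^bsub>Q\<^esub> q0))"

lemma box_coeffs_cls:
  assumes f: "f \<in> carrier F"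
  shows "box_coeffs (cls f \<odot>\<^bsub>Q\<^esub> q0) = trunc (ev f)"
proof -
  define g where "g = (SOME g. g \<in> carrier F \<and> cls f \<odot>\<^bsub>Q\<^esub> q0 = cls g \<odot>\<^bsub>Q\<^esub> q0)"
  have "\<exists>g. g \<in> carrier F \<and> cls f \<odot>\<^bsub>Q\<^esub> q0 = cls g \<odot>\<^bsub>Q\<^esub> q0" using f by blast
  from someI_ex[OF this, folded g_def]
  have g: "g \<in> carrier F" "cls f \<odot>\<^bsub>Q\<^esub> q0 = cls g \<odot>\<^bsub>Q\<^esub> q0" by auto
  have "cls (g \<ominus>\<^bsub>F\<^esub> f) \<odot>\<^bsub>Q\<^esub> q0 = \<zero>\<^bsub>Q\<^esub>"
    using f g q0 by (simp add: cls_minus QM.smult_minus_left QM.M.minus_eq_zero_iff QM.smult_closed)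
  then have "box_null (ev g - ev f)"
    using f g annihilator_iff[of "g \<ominus>\<^bsub>F\<^esub> f"] by (simp add: free_eval_minus)
  then show ?thesis unfolding box_coeffs_def g_def[symmetric] by (simp add: trunc_eq_iff)
qed

lemma lookup_box_coeffs:
  "f \<in> carrier F \<Longrightarrow> M \<in> box \<Longrightarrow>
    Poly_Mapping.lookup (box_coeffs (cls f \<odot>\<^bsub>Q\<^esub> q0)) M = Poly_Mapping.lookup (ev f) M"
  by (simp add: box_coeffs_cls lookup_trunc)

lemma box_coeffs_add:
  assumes "x \<in> carrier Q" "z \<in> carrier Q"
  shows "box_coeffs (x \<oplus>\<^bsub>Q\<^esub> z) = box_coeffs x + box_coeffs z"
proof -
  obtain f g where fg: "f \<in> carrier F" "g \<in> carrier F" "x = cls f \<odot>\<^bsub>Q\<^esub> q0" "z = cls g \<odot>\<^bsub>Q\<^esub> q0"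
    using Q_cyclic assms by meson
  have "x \<oplus>\<^bsub>Q\<^esub> z = cls (f \<oplus>\<^bsub>F\<^esub> g) \<odot>\<^bsub>Q\<^esub> q0" using fg q0 by (simp add: QM.smult_l_distr)
  then have "box_coeffs (x \<oplus>\<^bsub>Q\<^esub> z) = trunc (ev (f \<oplus>\<^bsub>F\<^esub> g))" using fg by (simp only: box_coeffs_cls F.a_closed)
  then show ?thesis using fg
    by (intro poly_mapping_eqI) (simp add: box_coeffs_cls free_eval_add lookup_add lookup_trunc)
qed

lemma box_coeffs_scal:
  assumes "x \<in> carrier Q"
  shows "box_coeffs (scal c \<odot>\<^bsub>Q\<^esub> x) = scale c (box_coeffs x)"
proof -
  obtain f where f: "f \<in> carrier F" "x = cls f \<odot>\<^bsub>Q\<^esub> q0"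
    using Q_cyclic assms by meson
  have "scal c \<odot>\<^bsub>Q\<^esub> x = cls (free_const c \<otimes>\<^bsub>F\<^esub> f) \<odot>\<^bsub>Q\<^esub> q0"
    using f q0 by (simp add: scal_eq free_const_closed QM.smult_assoc)
  then have "box_coeffs (scal c \<odot>\<^bsub>Q\<^esub> x) = trunc (ev (free_const c \<otimes>\<^bsub>F\<^esub> f))"
    using f by (simp only: box_coeffs_cls F.m_closed free_const_closed)
  then show ?thesis using f
    by (intro poly_mapping_eqI)
       (simp add: box_coeffs_cls free_const_closed free_eval_mult lookup_single_0_mult lookup_trunc)
qed

lemma box_coeffs_zero_iff:
  assumes "x \<in> carrier Q" shows "box_coeffs x = 0 \<longleftrightarrow> x = \<zero>\<^bsub>Q\<^esub>"
proof -
  obtain f where f: "f \<in> carrier F" "x = cls f \<odot>\<^bsub>Q\<^esub> q0"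
    using Q_cyclic assms by meson
  have "trunc 0 = 0" by (simp add: trunc_def)
  then have "box_coeffs x = 0 \<longleftrightarrow> box_null (ev f)"
    using trunc_eq_iff[of "ev f" 0] f by (simp add: box_coeffs_cls)
  then show ?thesis using annihilator_iff f by simp
qed

lemma box_coeffs_inj:
  assumes "x \<in> carrier Q" "z \<in> carrier Q" "box_coeffs x = box_coeffs z"
  shows "x = z"
proof -
  have "box_coeffs (x \<ominus>\<^bsub>Q\<^esub> z) + box_coeffs z = box_coeffs x"
    using box_coeffs_add[of "x \<ominus>\<^bsub>Q\<^esub> z" z] assms by (simp add: a_minus_def QM.M.a_assoc QM.M.l_neg)
  then have "box_coeffs (x \<ominus>\<^bsub>Q\<^esub> z) = 0" using assms by simp
  then show ?thesis using assms box_coeffs_zero_iff by (simp add: QM.M.minus_eq_zero_iff)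
qed

lemma box_coeffs_image: "box_coeffs ` carrier Q = VS.span monomials"
proof
  show "box_coeffs ` carrier Q \<subseteq> VS.span monomials"
    using trunc_in_span by (auto simp: box_coeffs_def)
  show "VS.span monomials \<subseteq> box_coeffs ` carrier Q"
  proof (rule VS.span_minimal)
    show "monomials \<subseteq> box_coeffs ` carrier Q"
    proof
      fix P assume "P \<in> monomials"
      then obtain M where M: "M \<in> box" "P = Poly_Mapping.single M 1" by (auto simp: monomials_def)
      let ?r = "\<lambda>u. if u = box_word M then 1 else 0"
      have r: "?r \<in> reduced" using M by (auto simp: reduced_def)
      have "trunc (ev ?r) = P"
        using lookup_ev_reduced[OF r] box_word_inj M
        by (intro poly_mapping_eqI) (auto simp: lookup_trunc lookup_single when_def inj_on_def)
      then have "P = box_coeffs (cls ?r \<odot>\<^bsub>Q\<^esub> q0)" using reduced_closed[OF r] by (simp add: box_coeffs_cls)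
      then show "P \<in> box_coeffs ` carrier Q" using reduced_closed[OF r] q0 by (auto simp: QM.smult_closed)
    qed
    show "VS.subspace (box_coeffs ` carrier Q)"
    proof (rule VS.subspaceI)
      show "0 \<in> box_coeffs ` carrier Q" using box_coeffs_zero_iff[of "\<zero>\<^bsub>Q\<^esub>"] by (metis QM.M.zero_closed imageI)
      show "P + P' \<in> box_coeffs ` carrier Q" if "P \<in> box_coeffs ` carrier Q" "P' \<in> box_coeffs ` carrier Q" for P P'
        using that by (auto simp flip: box_coeffs_add)
      show "scale c P \<in> box_coeffs ` carrier Q" if "P \<in> box_coeffs ` carrier Q" for c P
        using that by (auto simp: QM.smult_closed simp flip: box_coeffs_scal)
    qed
  qed
qed

text \<open>Elements of \<open>Q\<close> that vanish to order \<open>k\<close> in the generators of positive degree.\<close>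

definition order_ge :: "nat \<Rightarrow> 'q set" where
  "order_ge k = {x \<in> carrier Q. \<forall>M\<in>box. size M < k \<longrightarrow> Poly_Mapping.lookup (box_coeffs x) M = 0}"

text \<open>Multiplication by a polynomial without constant term raises the order of vanishing.\<close>

lemma order_ge_shift:
  assumes f: "f \<in> carrier F" "eps f = 0" and x: "x \<in> order_ge k"
  shows "cls f \<odot>\<^bsub>Q\<^esub> x \<in> order_ge (Suc k)"
proof -
  have xc: "x \<in> carrier Q" using x by (simp add: order_ge_def)
  obtain g where g: "g \<in> carrier F" "x = cls g \<odot>\<^bsub>Q\<^esub> q0"
    using Q_cyclic[OF xc] by blast
  have eq: "cls f \<odot>\<^bsub>Q\<^esub> x = cls (f \<otimes>\<^bsub>F\<^esub> g) \<odot>\<^bsub>Q\<^esub> q0" using f g q0 by (simp add: QM.smult_assoc)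
  have "Poly_Mapping.lookup (ev g * ev f) M = 0" if M: "M \<in> box" "size M < Suc k" for M
  proof -
    have "Poly_Mapping.lookup (ev g) l * (\<Sum>q. Poly_Mapping.lookup (ev f) q when M = l + q) = 0" for l
    proof (cases "l = M")
      case True
      have "(\<Sum>q. Poly_Mapping.lookup (ev f) q when M = l + q) = (\<Sum>q. Poly_Mapping.lookup (ev f) q when q = {#})"
        using True by (intro Sum_any.cong when_cong) auto
      then show ?thesis using f(2) by (simp add: eps_def)
    next
      case False
      show ?thesis
      proof (cases "\<exists>q. M = l + q")
        case True
        then obtain q where q: "M = l + q" by blast
        then have "q \<noteq> {#}" using False by auto
        then have "size l < k" using q M(2) by (simp add: nonempty_has_size)
        moreover have "l \<in> box" using M(1) q box_downward by blast
        ultimately have "Poly_Mapping.lookup (ev g) l = 0"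
          using x g lookup_box_coeffs[of g l] by (simp add: order_ge_def)
        then show ?thesis by simp
      next
        case no: False
        then have "M \<noteq> l + q" for q by blast
        then show ?thesis by simp
      qed
    qed
    then show ?thesis by (simp only: lookup_mult) simp
  qed
  moreover have "Poly_Mapping.lookup (box_coeffs (cls (f \<otimes>\<^bsub>F\<^esub> g) \<odot>\<^bsub>Q\<^esub> q0)) M
      = Poly_Mapping.lookup (ev g * ev f) M" if "M \<in> box" for M
    using lookup_box_coeffs[of "f \<otimes>\<^bsub>F\<^esub> g" M] that f g by (simp add: free_eval_mult mult.commute)
  moreover have "cls (f \<otimes>\<^bsub>F\<^esub> g) \<odot>\<^bsub>Q\<^esub> q0 \<in> carrier Q"
    using f g q0 by (intro QM.smult_closed) auto
  ultimately show ?thesis unfolding eq order_ge_def by simp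
qed

lemma order_ge_trivial: "\<exists>k. order_ge k \<subseteq> {\<zero>\<^bsub>Q\<^esub>}"
proof
  let ?k = "Suc (Max (size ` box))"
  show "order_ge ?k \<subseteq> {\<zero>\<^bsub>Q\<^esub>}"
  proof
    fix x assume x: "x \<in> order_ge ?k"
    then have xc: "x \<in> carrier Q" by (simp add: order_ge_def)
    have "Poly_Mapping.lookup (box_coeffs x) M = 0" for M
    proof (cases "M \<in> box")
      case True
      then have "size M < ?k" using card_box by (simp add: less_Suc_eq_le)
      then show ?thesis using x True by (simp add: order_ge_def)
    qed (simp add: box_coeffs_def lookup_trunc)
    then have "box_coeffs x = 0" by (intro poly_mapping_eqI) simp
    then show "x \<in> {\<zero>\<^bsub>Q\<^esub>}" using box_coeffs_zero_iff xc by simp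
  qed
qed

text \<open>Among the elements of \<open>N\<close> outside \<open>S\<close> let \<open>u\<close> have maximal order. An element of the algebra that
  acts by zero on \<open>K\<close> raises the order and preserves \<open>N\<close>, so it maps \<open>u\<close> into \<open>S\<close>.\<close>

lemma eigenvector_modulo:
  assumes S: "Module.submodule S A Q" and N: "Module.submodule N A Q" and lt: "\<not> N \<subseteq> S"
  shows "\<exists>u\<in>N - S. \<forall>f\<in>carrier F. cls f \<odot>\<^bsub>Q\<^esub> u \<ominus>\<^bsub>Q\<^esub> scal (eps f) \<odot>\<^bsub>Q\<^esub> u \<in> S"
proof -
  note S' = QM.submodule_dest[OF S] and N' = QM.submodule_dest[OF N]
  obtain k0 where k0: "order_ge k0 \<subseteq> {\<zero>\<^bsub>Q\<^esub>}" using order_ge_trivial by blast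
  define P where "P = (\<lambda>k. (N - S) \<inter> order_ge k \<noteq> {})"
  have "P 0" using lt N'(1) by (auto simp: P_def order_ge_def)
  moreover have "\<not> P k0" using k0 S'(2) by (auto simp: P_def)
  ultimately obtain k where k: "P k" "\<not> P (Suc k)" by (metis dec_induct le0)
  then obtain u where u: "u \<in> N" "u \<notin> S" "u \<in> order_ge k" by (auto simp: P_def)
  have uc: "u \<in> carrier Q" using u N' by blast
  have "cls f \<odot>\<^bsub>Q\<^esub> u \<ominus>\<^bsub>Q\<^esub> scal (eps f) \<odot>\<^bsub>Q\<^esub> u \<in> S" if f: "f \<in> carrier F" for f
  proof -
    let ?g = "f \<ominus>\<^bsub>F\<^esub> free_const (eps f)"
    have g: "?g \<in> carrier F" "eps ?g = 0"
      using f by (simp_all add: free_const_closed eps_def free_eval_minus lookup_minus lookup_single)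
    have "cls ?g \<odot>\<^bsub>Q\<^esub> u \<in> order_ge (Suc k)" using order_ge_shift[OF g u(3)] .
    moreover have "cls ?g \<odot>\<^bsub>Q\<^esub> u \<in> N" using N'(4) g u by simp
    ultimately have "cls ?g \<odot>\<^bsub>Q\<^esub> u \<in> S" using k(2) by (auto simp: P_def)
    moreover have "cls ?g \<odot>\<^bsub>Q\<^esub> u = cls f \<odot>\<^bsub>Q\<^esub> u \<ominus>\<^bsub>Q\<^esub> scal (eps f) \<odot>\<^bsub>Q\<^esub> u"
      using f uc by (simp add: cls_minus free_const_closed QM.smult_minus_left scal_eq)
    ultimately show ?thesis by simp
  qed
  then show ?thesis using u by blast
qed

end

section \<open>Composition series of the cover\<close>

context toral_cover
begin

text \<open>The situation of one step of a composition series: \<open>u\<close> spans an eigenline modulo \<open>S\<close>.\<close>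

definition extend :: "'q set \<Rightarrow> 'q \<Rightarrow> 'q set" where
  "extend S u = {s \<oplus>\<^bsub>Q\<^esub> scal c \<odot>\<^bsub>Q\<^esub> u | s c. s \<in> S}"

context
  fixes S :: "'q set" and u :: 'q
  assumes S: "Module.submodule S A Q" and u: "u \<in> carrier Q" "u \<notin> S"
    and eig: "\<And>f. f \<in> carrier F \<Longrightarrow> cls f \<odot>\<^bsub>Q\<^esub> u \<ominus>\<^bsub>Q\<^esub> scal (eps f) \<odot>\<^bsub>Q\<^esub> u \<in> S"
begin

abbreviation "line c \<equiv> QM.coset_of S (scal c \<odot>\<^bsub>Q\<^esub> u)"

lemma su_closed [simp]: "scal c \<odot>\<^bsub>Q\<^esub> u \<in> carrier Q"
  using u by (simp add: QM.smult_closed)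

lemma line_inj: "line c = line d \<longleftrightarrow> c = d"
proof
  assume "line c = line d"
  then have d: "scal c \<odot>\<^bsub>Q\<^esub> u \<ominus>\<^bsub>Q\<^esub> scal d \<odot>\<^bsub>Q\<^esub> u \<in> S"
    using QM.coset_of_eq_iff[OF S] by simp
  show "c = d"
  proof (rule ccontr)
    assume "c \<noteq> d"
    then have "u = scal (inverse (c - d) * (c - d)) \<odot>\<^bsub>Q\<^esub> u"
      using u by (simp add: scal_one QM.smult_one)
    also have "\<dots> = scal (inverse (c - d)) \<odot>\<^bsub>Q\<^esub> (scal (c - d) \<odot>\<^bsub>Q\<^esub> u)"
      unfolding scal_mult using u by (simp add: QM.smult_assoc)
    also have "scal (c - d) = scal c \<ominus>\<^bsub>A\<^esub> scal d"
      using scal_add[of c "- d"] by (simp add: scal_minus a_minus_def)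
    also have "(scal c \<ominus>\<^bsub>A\<^esub> scal d) \<odot>\<^bsub>Q\<^esub> u = scal c \<odot>\<^bsub>Q\<^esub> u \<ominus>\<^bsub>Q\<^esub> scal d \<odot>\<^bsub>Q\<^esub> u"
      using u by (simp add: QM.smult_minus_left)
    finally have "u = scal (inverse (c - d)) \<odot>\<^bsub>Q\<^esub> (scal c \<odot>\<^bsub>Q\<^esub> u \<ominus>\<^bsub>Q\<^esub> scal d \<odot>\<^bsub>Q\<^esub> u)" .
    then have "u \<in> S" using QM.submodule_dest(4)[OF S _ d, of "scal (inverse (c - d))"] by simp
    then show False using u by simp
  qed
qed simp

lemma line_zero: "line 0 = S"
  using u QM.coset_of_zero[OF S] by (simp add: scal_zero QM.smult_zero_left)

lemma line_add: "line c \<oplus>\<^bsub>QM.quot N S\<^esub> line d = line (c + d)"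
  using u by (simp add: QM.quot_add[OF S] scal_add QM.smult_l_distr)

lemma line_smult:
  assumes f: "f \<in> carrier F"
  shows "cls f \<odot>\<^bsub>QM.quot N S\<^esub> line c = line (eps f * c)"
proof -
  have "cls f \<odot>\<^bsub>Q\<^esub> (scal c \<odot>\<^bsub>Q\<^esub> u) \<ominus>\<^bsub>Q\<^esub> scal (eps f * c) \<odot>\<^bsub>Q\<^esub> u
      = scal c \<odot>\<^bsub>Q\<^esub> (cls f \<odot>\<^bsub>Q\<^esub> u \<ominus>\<^bsub>Q\<^esub> scal (eps f) \<odot>\<^bsub>Q\<^esub> u)"
  proof -
    have 1: "cls f \<odot>\<^bsub>Q\<^esub> (scal c \<odot>\<^bsub>Q\<^esub> u) = scal c \<odot>\<^bsub>Q\<^esub> (cls f \<odot>\<^bsub>Q\<^esub> u)"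
      using f u by (simp add: scal_central flip: QM.smult_assoc)
    have 2: "scal (eps f * c) \<odot>\<^bsub>Q\<^esub> u = scal c \<odot>\<^bsub>Q\<^esub> (scal (eps f) \<odot>\<^bsub>Q\<^esub> u)"
      using u by (simp add: mult.commute scal_mult QM.smult_assoc)
    have 3: "scal c \<odot>\<^bsub>Q\<^esub> (x \<ominus>\<^bsub>Q\<^esub> z) = scal c \<odot>\<^bsub>Q\<^esub> x \<ominus>\<^bsub>Q\<^esub> scal c \<odot>\<^bsub>Q\<^esub> z"
      if "x \<in> carrier Q" "z \<in> carrier Q" for x z
    proof -
      have "scal c \<odot>\<^bsub>Q\<^esub> x = scal c \<odot>\<^bsub>Q\<^esub> (x \<ominus>\<^bsub>Q\<^esub> z) \<oplus>\<^bsub>Q\<^esub> scal c \<odot>\<^bsub>Q\<^esub> z"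
        using that by (simp add: a_minus_def QM.M.a_assoc QM.M.l_neg flip: QM.smult_r_distr)
      then show ?thesis
        using that by (simp add: a_minus_def QM.M.a_assoc QM.M.r_neg QM.smult_closed)
    qed
    show ?thesis unfolding 1 2 using f u by (subst 3) (auto simp: QM.smult_closed)
  qed
  also have "\<dots> \<in> S" using eig[OF f] QM.submodule_dest(4)[OF S] by simp
  finally show ?thesis
    using f u QM.coset_of_eq_iff[OF S] by (simp add: QM.quot_smult[OF S] QM.smult_closed)
qed

lemma extend_mem: "x \<in> extend S u \<longleftrightarrow> x \<in> carrier Q \<and> (\<exists>c. QM.coset_of S x = line c)"
proof
  note S' = QM.submodule_dest[OF S]
  assume "x \<in> extend S u"
  then obtain s c where sc: "s \<in> S" "x = s \<oplus>\<^bsub>Q\<^esub> scal c \<odot>\<^bsub>Q\<^esub> u" by (auto simp: extend_def)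
  then have s: "s \<in> carrier Q" using S' by blast
  have "x \<ominus>\<^bsub>Q\<^esub> scal c \<odot>\<^bsub>Q\<^esub> u = s"
    using s sc by (simp add: a_minus_def QM.M.a_assoc QM.M.r_neg)
  then have "QM.coset_of S x = line c" using s sc QM.coset_of_eq_iff[OF S] by simp
  then show "x \<in> carrier Q \<and> (\<exists>c. QM.coset_of S x = line c)" using s sc by auto
next
  assume x: "x \<in> carrier Q \<and> (\<exists>c. QM.coset_of S x = line c)"
  then obtain c where c: "QM.coset_of S x = line c" by blast
  then have "x \<ominus>\<^bsub>Q\<^esub> scal c \<odot>\<^bsub>Q\<^esub> u \<in> S" using QM.coset_of_eq_iff[OF S] x by simp
  moreover have "x = (x \<ominus>\<^bsub>Q\<^esub> scal c \<odot>\<^bsub>Q\<^esub> u) \<oplus>\<^bsub>Q\<^esub> scal c \<odot>\<^bsub>Q\<^esub> u"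
    using x by (simp add: a_minus_def QM.M.a_assoc QM.M.l_neg)
  ultimately show "x \<in> extend S u" unfolding extend_def by blast
qed

lemma extend_submodule: "Module.submodule (extend S u) A Q"
proof (rule QM.submodule_intro)
  show "extend S u \<subseteq> carrier Q" using extend_mem by blast
  show "\<zero>\<^bsub>Q\<^esub> \<in> extend S u"
    using line_zero QM.coset_of_zero[OF S] extend_mem[of "\<zero>\<^bsub>Q\<^esub>"] by auto
  fix x z assume "x \<in> extend S u" "z \<in> extend S u"
  then obtain c d where "x \<in> carrier Q" "z \<in> carrier Q" "QM.coset_of S x = line c" "QM.coset_of S z = line d"
    using extend_mem by blast
  then show "x \<oplus>\<^bsub>Q\<^esub> z \<in> extend S u"
    using line_add[of "carrier Q" c d] QM.quot_add[OF S, of x z "carrier Q"] extend_mem[of "x \<oplus>\<^bsub>Q\<^esub> z"] by auto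
next
  fix a x assume a: "a \<in> carrier A" and "x \<in> extend S u"
  then obtain c where x: "x \<in> carrier Q" "QM.coset_of S x = line c" using extend_mem by blast
  obtain f where f: "f \<in> carrier F" "a = cls f" using cls_surj[OF a] by blast
  have "QM.coset_of S (a \<odot>\<^bsub>Q\<^esub> x) = line (eps f * c)"
    using QM.quot_smult[OF S x(1) a, of "carrier Q"] line_smult[OF f(1), of "carrier Q" c] x f by simp
  then show "a \<odot>\<^bsub>Q\<^esub> x \<in> extend S u" using extend_mem a x QM.smult_closed by blast
qed

lemma extend_super: "S \<subseteq> extend S u" "u \<in> extend S u"
proof
  fix s assume s: "s \<in> S"
  then have "QM.coset_of S s = line 0"
    unfolding line_zero using QM.coset_of_eq_iff[OF S, of s "\<zero>\<^bsub>Q\<^esub>"] QM.coset_of_zero[OF S] QM.submodule_dest[OF S]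
    by (auto simp: a_minus_def)
  then show "s \<in> extend S u" using extend_mem QM.submodule_dest(1)[OF S] s by blast
next
  have "QM.coset_of S u = line 1" using u by (simp add: scal_one QM.smult_one)
  then show "u \<in> extend S u" using extend_mem u by blast
qed

lemma carrier_quot_extend: "carrier (QM.quot (extend S u) S) = range line"
proof
  show "carrier (QM.quot (extend S u) S) \<subseteq> range line"
    unfolding QM.quot_simps using extend_mem by auto
  have "scal c \<odot>\<^bsub>Q\<^esub> u \<in> extend S u" for c
    unfolding extend_mem using su_closed by blast
  then show "range line \<subseteq> carrier (QM.quot (extend S u) S)"
    unfolding QM.quot_simps by (intro image_subsetI imageI)
qed

text \<open>Both modules are lines on which \<open>A\<close> acts through the character \<open>eps\<close>.\<close>

lemma quot_extend_iso: "module_iso A (QM.quot (extend S u) S) K"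
proof -
  define \<phi> where "\<phi> = (\<lambda>X. scal (THE c. X = line c) \<odot>\<^bsub>K\<^esub> v0)"
  have \<phi>: "\<phi> (line c) = scal c \<odot>\<^bsub>K\<^esub> v0" for c
    by (simp add: \<phi>_def line_inj)
  have "\<phi> \<in> LinearCombinations.module_hom A (QM.quot (extend S u) S) K"
    unfolding LinearCombinations.module_hom_def carrier_quot_extend
  proof (intro CollectI conjI allI impI)
    show "\<phi> \<in> range line \<rightarrow> carrier K" using v0(1) by (auto simp: \<phi> KM.smult_closed)
    fix X Z assume "X \<in> range line \<and> Z \<in> range line"
    then obtain c d where cd: "X = line c" "Z = line d" by blast
    have "\<phi> (X \<oplus>\<^bsub>QM.quot (extend S u) S\<^esub> Z) = scal (c + d) \<odot>\<^bsub>K\<^esub> v0"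
      unfolding cd line_add \<phi> ..
    then show "\<phi> (X \<oplus>\<^bsub>QM.quot (extend S u) S\<^esub> Z) = \<phi> X \<oplus>\<^bsub>K\<^esub> \<phi> Z"
      unfolding cd \<phi> using v0(1) by (simp add: scal_add KM.smult_l_distr)
  next
    fix a X assume aX: "a \<in> carrier A \<and> X \<in> range line"
    then obtain c where c: "X = line c" by blast
    obtain f where f: "f \<in> carrier F" "a = cls f" using cls_surj aX by blast
    show "\<phi> (a \<odot>\<^bsub>QM.quot (extend S u) S\<^esub> X) = a \<odot>\<^bsub>K\<^esub> \<phi> X"
    proof -
      have "\<phi> (a \<odot>\<^bsub>QM.quot (extend S u) S\<^esub> X) = scal (eps f * c) \<odot>\<^bsub>K\<^esub> v0"
        unfolding c f(2) line_smult[OF f(1)] \<phi> ..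
      then show ?thesis
        unfolding c \<phi> f(2) using f(1) v0(1)
        by (simp add: cls_K KM.smult_closed scal_mult KM.smult_assoc)
    qed
  qed
  moreover have "bij_betw \<phi> (carrier (QM.quot (extend S u) S)) (carrier K)"
    unfolding carrier_quot_extend
  proof (rule bij_betw_imageI)
    show "inj_on \<phi> (range line)" by (rule inj_onI) (auto simp: \<phi> dest: scal_eqD)
    show "\<phi> ` range line = carrier K" unfolding v0(3) by (auto simp: \<phi> image_iff)
  qed
  ultimately show ?thesis unfolding module_iso_def by blast
qed

lemma line_span:
  assumes N: "left_module A (QM.quot N S)" and T: "Module.submodule T A (QM.quot N S)"
    and c: "line c \<in> T" "c \<noteq> 0"
  shows "range line \<subseteq> T"
proof
  fix X assume "X \<in> range line"
  then obtain d where d: "X = line d" by blast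
  have "line d = scal (d * inverse c) \<odot>\<^bsub>QM.quot N S\<^esub> line c"
  proof -
    have eq: "d * inverse c * c = d" using c by simp
    show ?thesis
      using line_smult[where f="free_const (d * inverse c)" and N=N and c=c, OF free_const_closed,
          unfolded eps_const eq]
      by (simp only: scal_eq)
  qed
  then show "X \<in> T" using left_module.submodule_dest(4)[OF N T _ c(1)] d by simp
qed

lemma quot_extend_simple: "simple_module A (QM.quot (extend S u) S)"
proof -
  let ?q = "QM.quot (extend S u) S"
  have lm: "left_module A ?q" by (rule QM.quot_left_module[OF S extend_submodule])
  have "carrier ?q \<noteq> {\<zero>\<^bsub>?q\<^esub>}"
  proof
    assume "carrier ?q = {\<zero>\<^bsub>?q\<^esub>}"
    moreover have "line 1 \<in> carrier ?q" unfolding carrier_quot_extend by (rule rangeI)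
    ultimately have "line 1 = \<zero>\<^bsub>?q\<^esub>" by simp
    also have "\<dots> = line 0" unfolding QM.quot_simps(2) line_zero ..
    finally have "line 1 = line 0" .
    then show False unfolding line_inj by simp
  qed
  moreover have "T = {\<zero>\<^bsub>?q\<^esub>} \<or> T = carrier ?q" if T: "Module.submodule T A ?q" for T
  proof (cases "T \<subseteq> {\<zero>\<^bsub>?q\<^esub>}")
    case True
    then show ?thesis using left_module.submodule_dest(2)[OF lm T] by blast
  next
    case False
    then obtain X where X: "X \<in> T" "X \<noteq> \<zero>\<^bsub>?q\<^esub>" by blast
    then obtain c where c: "X = line c"
      using left_module.submodule_dest(1)[OF lm T] carrier_quot_extend by blast
    have "c \<noteq> 0" using X(2) line_zero unfolding c QM.quot_simps(2) by auto
    have "line c \<in> T" using X(1) unfolding c .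
    from line_span[OF lm T this \<open>c \<noteq> 0\<close>] have "range line \<subseteq> T" .
    moreover have "T \<subseteq> range line"
      using left_module.submodule_dest(1)[OF lm T] unfolding carrier_quot_extend .
    ultimately show ?thesis unfolding carrier_quot_extend by (intro disjI2 equalityI)
  qed
  ultimately show ?thesis using lm unfolding simple_module_def by blast
qed

text \<open>The line spanned by \<open>u\<close> is a nonzero submodule of the simple quotient.\<close>

lemma simple_imp_extend:
  assumes N: "Module.submodule N A Q" and sub: "S \<subseteq> N" and uN: "u \<in> N"
    and simple: "simple_module A (QM.quot N S)"
  shows "N = extend S u"
proof -
  let ?q = "QM.quot N S"
  note N' = QM.submodule_dest[OF N]
  have lm: "left_module A ?q" by (rule QM.quot_left_module[OF S N])
  have su: "scal c \<odot>\<^bsub>Q\<^esub> u \<in> N" for c using N'(4) uN by simp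
  have T: "Module.submodule (range line) A ?q"
  proof (rule left_module.submodule_intro[OF lm])
    show "range line \<subseteq> carrier ?q" unfolding QM.quot_simps using su by auto
    show "\<zero>\<^bsub>?q\<^esub> \<in> range line" unfolding QM.quot_simps using line_zero by blast
    show "X \<oplus>\<^bsub>?q\<^esub> Z \<in> range line" if "X \<in> range line" "Z \<in> range line" for X Z
      using that by (auto simp: line_add)
    show "a \<odot>\<^bsub>?q\<^esub> X \<in> range line" if "a \<in> carrier A" "X \<in> range line" for a X
      using that cls_surj[of a] by (auto simp: line_smult)
  qed
  have "range line \<noteq> {\<zero>\<^bsub>?q\<^esub>}"
  proof
    assume "range line = {\<zero>\<^bsub>?q\<^esub>}"
    then have "line 1 = line 0" by (metis rangeI singletonD)
    then show False unfolding line_inj by simp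
  qed
  then have "range line = carrier ?q" using simple T unfolding simple_module_def by blast
  have "N \<subseteq> extend S u"
  proof
    fix x assume x: "x \<in> N"
    then have "QM.coset_of S x \<in> carrier ?q" unfolding QM.quot_simps by (rule imageI)
    then have "QM.coset_of S x \<in> range line" unfolding \<open>range line = carrier ?q\<close> .
    then have "\<exists>c. QM.coset_of S x = line c" by (elim imageE) (rule exI)
    moreover have "x \<in> carrier Q" using N'(1) x by (rule subsetD)
    ultimately show "x \<in> extend S u" unfolding extend_mem by simp
  qed
  moreover have "extend S u \<subseteq> N"
    using su N'(3) sub by (auto simp: extend_def)
  ultimately show ?thesis by blast
qed

lemma box_coeffs_extend:
  assumes Bs: "VS.independent Bs" "VS.span Bs = box_coeffs ` S" "finite Bs"
  shows "VS.independent (insert (box_coeffs u) Bs)" "VS.span (insert (box_coeffs u) Bs) = box_coeffs ` extend S u"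
    and "card (insert (box_coeffs u) Bs) = Suc (card Bs)"
proof -
  note S' = QM.submodule_dest[OF S]
  have nin: "box_coeffs u \<notin> VS.span Bs"
  proof
    assume "box_coeffs u \<in> VS.span Bs"
    then obtain s where s: "s \<in> S" "box_coeffs u = box_coeffs s" using Bs by auto
    then have "u = s" using box_coeffs_inj u S'(1) by blast
    then show False using s u by simp
  qed
  then show "VS.independent (insert (box_coeffs u) Bs)" using Bs by (intro VS.independent_insertI)
  have "box_coeffs u \<notin> Bs" using nin VS.span_base by blast
  then show "card (insert (box_coeffs u) Bs) = Suc (card Bs)" using Bs by simp
  show "VS.span (insert (box_coeffs u) Bs) = box_coeffs ` extend S u"
  proof
    show "VS.span (insert (box_coeffs u) Bs) \<subseteq> box_coeffs ` extend S u"
    proof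
      fix P assume "P \<in> VS.span (insert (box_coeffs u) Bs)"
      then obtain c where "P - scale c (box_coeffs u) \<in> box_coeffs ` S"
        unfolding VS.span_insert Bs by blast
      then obtain s where s: "s \<in> S" "P - scale c (box_coeffs u) = box_coeffs s" by blast
      then have "P = box_coeffs s + box_coeffs (scal c \<odot>\<^bsub>Q\<^esub> u)" using u by (simp add: box_coeffs_scal algebra_simps)
      also have "\<dots> = box_coeffs (s \<oplus>\<^bsub>Q\<^esub> scal c \<odot>\<^bsub>Q\<^esub> u)" using s S'(1) by (subst box_coeffs_add) auto
      finally show "P \<in> box_coeffs ` extend S u" using s by (auto simp: extend_def)
    qed
    show "box_coeffs ` extend S u \<subseteq> VS.span (insert (box_coeffs u) Bs)"
    proof
      fix P assume "P \<in> box_coeffs ` extend S u"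
      then obtain s c where s: "s \<in> S" "P = box_coeffs (s \<oplus>\<^bsub>Q\<^esub> scal c \<odot>\<^bsub>Q\<^esub> u)" by (auto simp: extend_def)
      then have "P = box_coeffs s + scale c (box_coeffs u)" using S'(1) u by (subst (asm) box_coeffs_add) (auto simp: box_coeffs_scal)
      then have "P - scale c (box_coeffs u) \<in> VS.span Bs" using s Bs by simp
      then show "P \<in> VS.span (insert (box_coeffs u) Bs)" unfolding VS.span_insert by blast
    qed
  qed
qed

end

lemma comp_factor_quot: "comp_factor Q N i = QM.quot (N (Suc i)) (N i)"
  by (simp add: comp_factor_def QM.quot_def)

lemma carrier_submodule: "Module.submodule (carrier Q) A Q"
  by (rule QM.submodule_intro) (auto simp: QM.smult_closed)

lemma zero_submodule: "Module.submodule {\<zero>\<^bsub>Q\<^esub>} A Q"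
  by (rule QM.submodule_intro) (auto simp: QM.smult_zero_right)

text \<open>Submodules of \<open>Q\<close> are measured by their images under the linear isomorphism \<open>box_coeffs\<close>.\<close>

definition has_dim :: "'q set \<Rightarrow> nat \<Rightarrow> bool" where
  "has_dim N k \<longleftrightarrow> (\<exists>Bs. finite Bs \<and> VS.independent Bs \<and> VS.span Bs = box_coeffs ` N \<and> card Bs = k)"

lemma has_dim_zero: "has_dim {\<zero>\<^bsub>Q\<^esub>} 0"
  unfolding has_dim_def using box_coeffs_zero_iff[of "\<zero>\<^bsub>Q\<^esub>"]
  by (intro exI[of _ "{}"]) (simp add: VS.independent_empty)

lemma has_dim_carrier_iff: "has_dim (carrier Q) k \<longleftrightarrow> k = p ^ (m * card B)"
proof
  assume "has_dim (carrier Q) k"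
  then obtain Bs where Bs: "finite Bs" "VS.independent Bs" "VS.span Bs = VS.span monomials" "card Bs = k"
    unfolding has_dim_def box_coeffs_image by blast
  have "card Bs \<le> card monomials"
    using VS.independent_span_bound[OF card_monomials(1) Bs(2)] Bs(3) VS.span_superset by blast
  moreover have "card monomials \<le> card Bs"
    using VS.independent_span_bound[OF Bs(1) independent_monomials] Bs(3) VS.span_superset by blast
  ultimately show "k = p ^ (m * card B)" using Bs(4) card_monomials(2) by simp
next
  assume "k = p ^ (m * card B)"
  then show "has_dim (carrier Q) k"
    unfolding has_dim_def box_coeffs_image using card_monomials independent_monomials by blast
qed

lemma has_dim_bound:
  assumes "has_dim N k" "N \<subseteq> carrier Q"
  shows "k \<le> p ^ (m * card B)"
proof -
  obtain Bs where Bs: "finite Bs" "VS.independent Bs" "VS.span Bs = box_coeffs ` N" "card Bs = k"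
    using assms unfolding has_dim_def by blast
  have "Bs \<subseteq> VS.span monomials"
    using Bs(3) VS.span_superset[of Bs] image_mono[OF assms(2), of box_coeffs] box_coeffs_image by blast
  then show ?thesis
    using VS.independent_span_bound[OF card_monomials(1) Bs(2)] Bs(4) card_monomials(2) by simp
qed

text \<open>An eigenvector modulo \<open>S\<close> spans a line in the simple quotient, which is therefore this line.\<close>

lemma composition_step:
  assumes S: "Module.submodule S A Q" and N: "Module.submodule N A Q" "S \<subseteq> N"
    and simple: "simple_module A (QM.quot N S)" and dim: "has_dim S k"
  shows "module_iso A (QM.quot N S) K \<and> has_dim N (Suc k)"
proof -
  have "\<not> N \<subseteq> S"
  proof
    assume "N \<subseteq> S"
    then have "N = S" using N by blast
    have "QM.coset_of S x = S" if "x \<in> S" for x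
      using QM.coset_of_eq_iff[OF S, of x "\<zero>\<^bsub>Q\<^esub>"] QM.coset_of_zero[OF S] QM.submodule_dest[OF S] that
      by (auto simp: a_minus_def)
    then have "carrier (QM.quot N S) = {\<zero>\<^bsub>QM.quot N S\<^esub>}"
      unfolding QM.quot_simps \<open>N = S\<close> using QM.submodule_dest(2)[OF S] by auto
    then show False using simple by (simp add: simple_module_def)
  qed
  then obtain u where u: "u \<in> N" "u \<notin> S"
    and eig: "\<And>f. f \<in> carrier F \<Longrightarrow> cls f \<odot>\<^bsub>Q\<^esub> u \<ominus>\<^bsub>Q\<^esub> scal (eps f) \<odot>\<^bsub>Q\<^esub> u \<in> S"
    using eigenvector_modulo[OF S N(1)] by blast
  have uc: "u \<in> carrier Q" using u QM.submodule_dest(1)[OF N(1)] by blast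
  have NE: "N = extend S u"
    by (rule simple_imp_extend[OF S uc u(2) eig N u(1) simple])
  obtain Bs where Bs: "finite Bs" "VS.independent Bs" "VS.span Bs = box_coeffs ` S" "card Bs = k"
    using dim unfolding has_dim_def by blast
  note ke = box_coeffs_extend[OF S uc u(2) eig Bs(2,3,1)]
  have "has_dim N (Suc k)"
    unfolding has_dim_def NE using ke Bs by (intro exI[of _ "insert (box_coeffs u) Bs"]) auto
  then show ?thesis using quot_extend_iso[OF S uc u(2) eig] NE by blast
qed

lemma composition_exists_step:
  assumes S: "Module.submodule S A Q" and ne: "S \<noteq> carrier Q" and dim: "has_dim S k"
  shows "\<exists>N. Module.submodule N A Q \<and> S \<subseteq> N \<and> simple_module A (QM.quot N S) \<and> has_dim N (Suc k)"
proof -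
  have "\<not> carrier Q \<subseteq> S" using ne QM.submodule_dest(1)[OF S] by blast
  then obtain u where u: "u \<in> carrier Q" "u \<notin> S"
    and eig: "\<And>f. f \<in> carrier F \<Longrightarrow> cls f \<odot>\<^bsub>Q\<^esub> u \<ominus>\<^bsub>Q\<^esub> scal (eps f) \<odot>\<^bsub>Q\<^esub> u \<in> S"
    using eigenvector_modulo[OF S carrier_submodule] by blast
  have sub: "Module.submodule (extend S u) A Q" by (rule extend_submodule[OF S u eig])
  have sup: "S \<subseteq> extend S u" by (rule extend_super(1)[OF S u eig])
  have sim: "simple_module A (QM.quot (extend S u) S)" by (rule quot_extend_simple[OF S u eig])
  show ?thesis using sub sup sim composition_step[OF S sub sup sim dim] by blast
qed

lemma composition_chain:
  assumes "k \<le> p ^ (m * card B)"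
  shows "\<exists>N. N 0 = {\<zero>\<^bsub>Q\<^esub>} \<and> (\<forall>i\<le>k. Module.submodule (N i) A Q) \<and>
    (\<forall>i<k. N i \<subseteq> N (Suc i) \<and> simple_module A (QM.quot (N (Suc i)) (N i))) \<and> has_dim (N k) k"
  using assms
proof (induction k)
  case 0
  show ?case
    by (rule exI[of _ "\<lambda>_. {\<zero>\<^bsub>Q\<^esub>}"]) (simp add: zero_submodule has_dim_zero)
next
  case (Suc k)
  then obtain N where N: "N 0 = {\<zero>\<^bsub>Q\<^esub>}" "\<forall>i\<le>k. Module.submodule (N i) A Q"
    "\<forall>i<k. N i \<subseteq> N (Suc i) \<and> simple_module A (QM.quot (N (Suc i)) (N i))" "has_dim (N k) k"
    by auto
  have "N k \<noteq> carrier Q" using N(4) Suc(2) has_dim_carrier_iff[of k] by auto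
  then obtain N' where N': "Module.submodule N' A Q" "N k \<subseteq> N'"
    "simple_module A (QM.quot N' (N k))" "has_dim N' (Suc k)"
    using composition_exists_step[of "N k" k] N by auto
  let ?N = "\<lambda>i. if i \<le> k then N i else N'"
  show ?case
  proof (rule exI[of _ ?N], intro conjI allI impI)
    fix i assume "i < Suc k"
    then consider "i < k" | "i = k" by linarith
    then show "?N i \<subseteq> ?N (Suc i)" "simple_module A (QM.quot (?N (Suc i)) (?N i))"
      using N N' by (cases, auto)+
  qed (use N N' in auto)
qed

theorem composition_series_exists: "\<exists>l N. composition_series A Q l N"
proof -
  let ?k = "p ^ (m * card B)"
  obtain N where N: "N 0 = {\<zero>\<^bsub>Q\<^esub>}" "\<forall>i\<le>?k. Module.submodule (N i) A Q"
    "\<forall>i<?k. N i \<subseteq> N (Suc i) \<and> simple_module A (QM.quot (N (Suc i)) (N i))" "has_dim (N ?k) ?k"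
    using composition_chain[OF order_refl] by blast
  have "N ?k = carrier Q"
  proof (rule ccontr)
    assume "N ?k \<noteq> carrier Q"
    then obtain N' where "Module.submodule N' A Q" "has_dim N' (Suc ?k)"
      using composition_exists_step[of "N ?k" ?k] N by blast
    then have "Suc ?k \<le> ?k" using has_dim_bound QM.submodule_dest(1) by blast
    then show False by simp
  qed
  then show ?thesis
    unfolding composition_series_def comp_factor_quot using N by blast
qed

text \<open>By induction the \<open>i\<close>-th term of a composition series has dimension \<open>i\<close>, so the length is the dimension of
  \<open>Q\<close>.\<close>

theorem composition_series_factors:
  assumes "composition_series A Q l N"
  shows "(\<forall>i<l. module_iso A (comp_factor Q N i) K) \<and> l = p ^ (m * card B)"
proof -
  note series = assms[unfolded composition_series_def comp_factor_quot]
  have "i \<le> l \<longrightarrow> has_dim (N i) i" for i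
  proof (induction i)
    case 0
    then show ?case using series has_dim_zero by simp
  next
    case (Suc i)
    then show ?case
      using composition_step[of "N i" "N (Suc i)" i] series by simp
  qed
  then have dim: "has_dim (N i) i" if "i \<le> l" for i using that by blast
  then have "\<forall>i<l. module_iso A (comp_factor Q N i) K"
    unfolding comp_factor_quot using composition_step[of "N i" "N (Suc i)" i for i] series by simp
  moreover have "l = p ^ (m * card B)"
    using dim[of l] series has_dim_carrier_iff by simp
  ultimately show ?thesis by blast
qed

end

section \<open>Tangent spaces of matrix groups\<close>

lemma infinite_alg_closed: "infinite (UNIV :: 'k::alg_closed_field set)"
proof
  assume fin: "finite (UNIV :: 'k set)"
  let ?q = "(\<Prod>a\<in>(UNIV::'k set). [:- a, 1:]) + 1"
  have "degree (\<Prod>a\<in>(UNIV::'k set). [:- a, 1:]) = card (UNIV :: 'k set)"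
    by (subst degree_prod_eq_sum_degree) auto
  moreover have "card (UNIV :: 'k set) > 0" using fin by (simp add: card_gt_0_iff)
  ultimately have "degree ?q > 0"
    by (subst degree_add_eq_left) auto
  then obtain x where "poly ?q x = 0" using alg_closed_imp_poly_has_root by blast
  moreover have "poly (\<Prod>a\<in>(UNIV::'k set). [:- a, 1:]) x = 0"
    using fin by (subst poly_prod) (auto intro!: prod_zero)
  ultimately show False by simp
qed

lemma poly_eqI_alg_closed:
  fixes q r :: "'k::alg_closed_field poly"
  assumes "\<And>t. poly q t = poly r t"
  shows "q = r"
proof (rule ccontr)
  assume "q \<noteq> r"
  then have "finite {t. poly (q - r) t = 0}" by (intro poly_roots_finite) simp
  moreover have "{t. poly (q - r) t = 0} = UNIV" using assms by auto
  ultimately show False using infinite_alg_closed[where ?'k = 'k] by simp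
qed

text \<open>The linear coefficient of the polynomial \<open>t \<mapsto> f (A + t X)\<close>, which over an infinite field is determined
  by its values.\<close>

definition dir_deriv :: "('k::field mat \<Rightarrow> 'k) \<Rightarrow> 'k mat \<Rightarrow> 'k mat \<Rightarrow> 'k" where
  "dir_deriv f A X = coeff (SOME q. \<forall>t. poly q t = f (A + t \<cdot>\<^sub>m X)) 1"

lemma dir_deriv_eqI:
  fixes f :: "'k::alg_closed_field mat \<Rightarrow> 'k"
  assumes "\<And>t. poly q t = f (A + t \<cdot>\<^sub>m X)"
  shows "dir_deriv f A X = coeff q 1"
proof -
  have "(SOME q. \<forall>t. poly q t = f (A + t \<cdot>\<^sub>m X)) = q"
    by (rule some_equality) (use assms in \<open>auto intro: poly_eqI_alg_closed\<close>)
  then show ?thesis by (simp add: dir_deriv_def)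
qed

text \<open>Functions given by a polynomial on \<open>n \<times> n\<close> matrices, whatever they do elsewhere. Unlike the polynomial
  functions themselves, they are closed under translation by a matrix and under directional derivatives.\<close>

definition pfun :: "nat \<Rightarrow> ('k::field mat \<Rightarrow> 'k) set" where
  "pfun n = {f. \<exists>g\<in>polyfun n. \<forall>A\<in>carrier_mat n n. f A = g A}"

lemma polyfun_pfun: "f \<in> polyfun n \<Longrightarrow> f \<in> pfun n"
  by (auto simp: pfun_def)

lemma pfun_cong: "f \<in> pfun n \<Longrightarrow> (\<And>A. A \<in> carrier_mat n n \<Longrightarrow> g A = f A) \<Longrightarrow> g \<in> pfun n"
  by (auto simp: pfun_def)

lemma pfun_add: "f \<in> pfun n \<Longrightarrow> g \<in> pfun n \<Longrightarrow> (\<lambda>A. f A + g A) \<in> pfun n"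
  and pfun_mult: "f \<in> pfun n \<Longrightarrow> g \<in> pfun n \<Longrightarrow> (\<lambda>A. f A * g A) \<in> pfun n"
proof -
  assume "f \<in> pfun n" "g \<in> pfun n"
  then obtain f' g' where "f' \<in> polyfun n" "g' \<in> polyfun n"
    and eq: "\<forall>A\<in>carrier_mat n n. f A = f' A" "\<forall>A\<in>carrier_mat n n. g A = g' A"
    by (auto simp: pfun_def)
  then have "(\<lambda>A. f' A + g' A) \<in> pfun n" "(\<lambda>A. f' A * g' A) \<in> pfun n"
    by (auto intro: polyfun_pfun polyfun.add polyfun.mult)
  then show "(\<lambda>A. f A + g A) \<in> pfun n" "(\<lambda>A. f A * g A) \<in> pfun n"
    using eq by (auto elim: pfun_cong)
qed

lemma pfun_const: "(\<lambda>_. c) \<in> pfun n"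
  by (intro polyfun_pfun polyfun.const)

lemma pfun_sum: "(\<And>i. i \<in> I \<Longrightarrow> f i \<in> pfun n) \<Longrightarrow> (\<lambda>A. \<Sum>i\<in>I. f i A) \<in> pfun n"
  by (induction I rule: infinite_finite_induct) (auto intro: pfun_const pfun_add)

lemma pfun_coord: "i < n \<Longrightarrow> j < n \<Longrightarrow> (\<lambda>A. A $$ (i, j)) \<in> pfun n"
  by (intro polyfun_pfun polyfun.coord)

lemma index_mult_sum:
  assumes "A \<in> carrier_mat n n" "B \<in> carrier_mat n n" "i < n" "j < n"
  shows "(A * B) $$ (i, j) = (\<Sum>k\<in>{0..<n}. A $$ (i, k) * B $$ (k, j))"
  using assms by (simp add: scalar_prod_def)

lemma pfun_mult_right:
  assumes "M \<in> carrier_mat n n" "i < n" "j < n"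
  shows "(\<lambda>A. (A * M) $$ (i, j)) \<in> pfun n"
proof (rule pfun_cong)
  show "(\<lambda>A. \<Sum>k\<in>{0..<n}. A $$ (i, k) * M $$ (k, j)) \<in> pfun n"
    using assms by (intro pfun_sum pfun_mult pfun_const pfun_coord) auto
qed (rule index_mult_sum, use assms in auto)

lemma pfun_mult_left:
  assumes "M \<in> carrier_mat n n" "i < n" "j < n"
  shows "(\<lambda>A. (M * A) $$ (i, j)) \<in> pfun n"
proof (rule pfun_cong)
  show "(\<lambda>A. \<Sum>k\<in>{0..<n}. M $$ (i, k) * A $$ (k, j)) \<in> pfun n"
    using assms by (intro pfun_sum pfun_mult pfun_const pfun_coord) auto
qed (rule index_mult_sum, use assms in auto)

lemma pfun_translate:
  assumes f: "f \<in> pfun n" and M: "M \<in> carrier_mat n n"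
  shows "(\<lambda>A. f (M * A)) \<in> pfun n"
proof -
  obtain g where g: "g \<in> polyfun n" "\<forall>A\<in>carrier_mat n n. f A = g A" using f by (auto simp: pfun_def)
  have "(\<lambda>A. g (M * A)) \<in> pfun n" using g(1)
    by induction (auto intro: pfun_const pfun_add pfun_mult pfun_mult_left M)
  then show ?thesis using g(2) M by (auto elim!: pfun_cong)
qed

lemma pfun_jet:
  fixes f :: "'k::alg_closed_field mat \<Rightarrow> 'k"
  assumes f: "f \<in> pfun n" and A: "A \<in> carrier_mat n n" and X: "X \<in> carrier_mat n n"
  shows "\<exists>q. (\<forall>t. poly q t = f (A + t \<cdot>\<^sub>m X)) \<and> coeff q 0 = f A \<and> coeff q 1 = dir_deriv f A X"
proof -
  obtain g where g: "g \<in> polyfun n" "\<forall>A\<in>carrier_mat n n. f A = g A" using f by (auto simp: pfun_def)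
  have "\<exists>q. \<forall>t. poly q t = g (A + t \<cdot>\<^sub>m X)" using g(1)
  proof induction
    case (const c)
    show ?case by (rule exI[of _ "[:c:]"]) simp
  next
    case (coord i j)
    then show ?case using A X by (intro exI[of _ "[:A $$ (i, j), X $$ (i, j):]"]) simp
  next
    case (add f g)
    then obtain q r where "\<forall>t. poly q t = f (A + t \<cdot>\<^sub>m X)" "\<forall>t. poly r t = g (A + t \<cdot>\<^sub>m X)" by blast
    then show ?case by (intro exI[of _ "q + r"]) simp
  next
    case (mult f g)
    then obtain q r where "\<forall>t. poly q t = f (A + t \<cdot>\<^sub>m X)" "\<forall>t. poly r t = g (A + t \<cdot>\<^sub>m X)" by blast
    then show ?case by (intro exI[of _ "q * r"]) simp
  qed
  then obtain q where q: "\<And>t. poly q t = g (A + t \<cdot>\<^sub>m X)" by blast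
  have q': "poly q t = f (A + t \<cdot>\<^sub>m X)" for t using q g(2) A X by simp
  have "A + 0 \<cdot>\<^sub>m X = A" using A X by auto
  then have "coeff q 0 = f A" using q'[of 0] by (simp add: poly_0_coeff_0)
  then show ?thesis using q' dir_deriv_eqI[of q f A X] by (intro exI[of _ q]) simp
qed

lemma dir_deriv_add:
  fixes f g :: "'k::alg_closed_field mat \<Rightarrow> 'k"
  assumes "f \<in> pfun n" "g \<in> pfun n" "A \<in> carrier_mat n n" "X \<in> carrier_mat n n"
  shows "dir_deriv (\<lambda>A. f A + g A) A X = dir_deriv f A X + dir_deriv g A X"
proof -
  obtain q r where q: "\<forall>t. poly q t = f (A + t \<cdot>\<^sub>m X)" "coeff q 1 = dir_deriv f A X"
    and r: "\<forall>t. poly r t = g (A + t \<cdot>\<^sub>m X)" "coeff r 1 = dir_deriv g A X"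
    using pfun_jet[OF assms(1,3,4)] pfun_jet[OF assms(2,3,4)] by blast
  have "dir_deriv (\<lambda>A. f A + g A) A X = coeff (q + r) 1"
    using q(1) r(1) by (intro dir_deriv_eqI) simp
  then show ?thesis using q(2) r(2) by simp
qed

lemma dir_deriv_mult:
  fixes f g :: "'k::alg_closed_field mat \<Rightarrow> 'k"
  assumes "f \<in> pfun n" "g \<in> pfun n" "A \<in> carrier_mat n n" "X \<in> carrier_mat n n"
  shows "dir_deriv (\<lambda>A. f A * g A) A X = dir_deriv f A X * g A + f A * dir_deriv g A X"
proof -
  obtain q r where q: "\<forall>t. poly q t = f (A + t \<cdot>\<^sub>m X)" "coeff q 1 = dir_deriv f A X" "coeff q 0 = f A"
    and r: "\<forall>t. poly r t = g (A + t \<cdot>\<^sub>m X)" "coeff r 1 = dir_deriv g A X" "coeff r 0 = g A"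
    using pfun_jet[OF assms(1,3,4)] pfun_jet[OF assms(2,3,4)] by blast
  have "dir_deriv (\<lambda>A. f A * g A) A X = coeff (q * r) 1"
    using q(1) r(1) by (intro dir_deriv_eqI) simp
  also have "\<dots> = coeff q 0 * coeff r 1 + coeff q 1 * coeff r 0"
    by (simp add: coeff_mult)
  finally show ?thesis using q(2,3) r(2,3) by simp
qed

lemma dir_deriv_const:
  "dir_deriv (\<lambda>_. c) A X = (0 :: 'k::alg_closed_field)"
  using dir_deriv_eqI[of "[:c:]" "\<lambda>_. c" A X] by simp

lemma dir_deriv_linear:
  fixes f :: "'k::alg_closed_field mat \<Rightarrow> 'k"
  assumes "\<And>t. f (A + t \<cdot>\<^sub>m X) = f A + t * f X"
  shows "dir_deriv f A X = f X"
  using dir_deriv_eqI[of "[:f A, f X:]" f A X] assms by simp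

lemma dir_deriv_cong:
  assumes "\<And>A. A \<in> carrier_mat n n \<Longrightarrow> f A = g A" "A \<in> carrier_mat n n" "X \<in> carrier_mat n n"
  shows "dir_deriv f A X = dir_deriv g A X"
proof -
  have "f (A + t \<cdot>\<^sub>m X) = g (A + t \<cdot>\<^sub>m X)" for t using assms by simp
  then show ?thesis unfolding dir_deriv_def by simp
qed

lemma dir_deriv_linear_dir:
  fixes f :: "'k::alg_closed_field mat \<Rightarrow> 'k"
  assumes f: "f \<in> polyfun n" and A: "A \<in> carrier_mat n n"
    and X: "X \<in> carrier_mat n n" "Z \<in> carrier_mat n n"
  shows "dir_deriv f A (X + Z) = dir_deriv f A X + dir_deriv f A Z
    \<and> dir_deriv f A (c \<cdot>\<^sub>m X) = c * dir_deriv f A X"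
  using f
proof induction
  case (const c)
  then show ?case by (simp add: dir_deriv_const)
next
  case (coord i j)
  have "dir_deriv (\<lambda>A. A $$ (i, j)) A Y = Y $$ (i, j)" if "Y \<in> carrier_mat n n" for Y :: "'k mat"
    using that A coord by (intro dir_deriv_linear) simp
  then show ?case using X coord by simp
next
  case (add f g)
  then show ?case using A X by (simp add: dir_deriv_add[where n=n] polyfun_pfun algebra_simps)
next
  case (mult f g)
  then show ?case using A X by (simp add: dir_deriv_mult[where n=n] polyfun_pfun algebra_simps)
qed

lemma tangent_space_iff:
  fixes G :: "'k::alg_closed_field mat set"
  shows "X \<in> tangent_space n G \<longleftrightarrow> X \<in> carrier_mat n n \<and>
    (\<forall>f\<in>polyfun n. (\<forall>g\<in>G. f g = 0) \<longrightarrow> dir_deriv f (1\<^sub>m n) X = 0)"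
proof (cases "X \<in> carrier_mat n n")
  case True
  have "(\<forall>q. (\<forall>t. poly q t = f (1\<^sub>m n + t \<cdot>\<^sub>m X)) \<longrightarrow> coeff q 1 = 0) \<longleftrightarrow> dir_deriv f (1\<^sub>m n) X = 0"
    if f: "f \<in> polyfun n" for f
  proof -
    obtain q where "\<forall>t. poly q t = f (1\<^sub>m n + t \<cdot>\<^sub>m X)" "coeff q 1 = dir_deriv f (1\<^sub>m n) X"
      using pfun_jet[OF polyfun_pfun[OF f] one_carrier_mat True] by blast
    then show ?thesis using dir_deriv_eqI[of _ f "1\<^sub>m n" X] by metis
  qed
  then show ?thesis by (auto simp: tangent_space_def True)
qed (simp add: tangent_space_def)

text \<open>The equation may be any function that agrees with a polynomial on square matrices, such as a translate of
  another equation.\<close>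

lemma tangent_pfun:
  fixes G :: "'k::alg_closed_field mat set"
  assumes X: "X \<in> tangent_space n G" and G: "G \<subseteq> carrier_mat n n"
    and f: "f \<in> pfun n" "\<And>g. g \<in> G \<Longrightarrow> f g = 0"
  shows "dir_deriv f (1\<^sub>m n) X = 0"
proof -
  obtain h where h: "h \<in> polyfun n" "\<forall>A\<in>carrier_mat n n. f A = h A" using f by (auto simp: pfun_def)
  have Xc: "X \<in> carrier_mat n n" using X by (simp add: tangent_space_iff)
  have "\<forall>g\<in>G. h g = 0" using h f(2) G by (metis subset_iff)
  then have "dir_deriv h (1\<^sub>m n) X = 0" using X h(1) by (simp add: tangent_space_iff)
  moreover have "dir_deriv f (1\<^sub>m n) X = dir_deriv h (1\<^sub>m n) X"
    using h(2) Xc by (intro dir_deriv_cong[where n=n]) auto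
  ultimately show ?thesis by simp
qed

text \<open>The left invariant vector field of \<open>X\<close>.\<close>

definition inv_field :: "'k::field mat \<Rightarrow> ('k mat \<Rightarrow> 'k) \<Rightarrow> 'k mat \<Rightarrow> 'k" where
  "inv_field X f = (\<lambda>A. dir_deriv f A (A * X))"

context
  fixes n :: nat and X :: "'k::alg_closed_field mat"
  assumes X: "X \<in> carrier_mat n n"
begin

abbreviation "D \<equiv> inv_field X"

lemma D_cong:
  "(\<And>A. A \<in> carrier_mat n n \<Longrightarrow> f A = g A) \<Longrightarrow> A \<in> carrier_mat n n \<Longrightarrow> D f A = D g A"
  unfolding inv_field_def using X by (intro dir_deriv_cong[where n=n]) auto

lemma D_add: "f \<in> pfun n \<Longrightarrow> g \<in> pfun n \<Longrightarrow> A \<in> carrier_mat n n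
    \<Longrightarrow> D (\<lambda>A. f A + g A) A = D f A + D g A"
  unfolding inv_field_def using X by (intro dir_deriv_add[where n=n]) auto

lemma D_mult: "f \<in> pfun n \<Longrightarrow> g \<in> pfun n \<Longrightarrow> A \<in> carrier_mat n n
    \<Longrightarrow> D (\<lambda>A. f A * g A) A = D f A * g A + f A * D g A"
  unfolding inv_field_def using X by (intro dir_deriv_mult[where n=n]) auto

lemma D_const: "D (\<lambda>_. c) A = 0"
  by (simp add: inv_field_def dir_deriv_const)

lemma D_cmult: "f \<in> pfun n \<Longrightarrow> A \<in> carrier_mat n n \<Longrightarrow> D (\<lambda>A. c * f A) A = c * D f A"
  using D_mult[OF pfun_const[of c n], of f A] by (simp add: D_const)

lemma D_sum:
  "(\<And>i. i \<in> I \<Longrightarrow> f i \<in> pfun n) \<Longrightarrow> A \<in> carrier_mat n n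
    \<Longrightarrow> D (\<lambda>A. \<Sum>i\<in>I. f i A) A = (\<Sum>i\<in>I. D (f i) A)"
proof (induction I rule: infinite_finite_induct)
  case (insert i I)
  then show ?case using D_add[of "f i" "\<lambda>A. \<Sum>i\<in>I. f i A" A] by (simp add: pfun_sum)
qed (simp_all add: D_const)

lemma D_mult_right:
  assumes "M \<in> carrier_mat n n" "i < n" "j < n" "A \<in> carrier_mat n n"
  shows "D (\<lambda>A. (A * M) $$ (i, j)) A = (A * X * M) $$ (i, j)"
  unfolding inv_field_def
proof (rule dir_deriv_linear)
  fix t
  have "(A + t \<cdot>\<^sub>m (A * X)) * M = A * M + t \<cdot>\<^sub>m (A * X * M)"
    using assms X by (simp add: add_mult_distrib_mat[of _ n n] mult_smult_assoc_mat[of _ n n _ n])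
  then show "((A + t \<cdot>\<^sub>m (A * X)) * M) $$ (i, j) = (A * M) $$ (i, j) + t * (A * X * M) $$ (i, j)"
    using assms X by simp
qed

lemma D_coord:
  assumes "i < n" "j < n" "A \<in> carrier_mat n n"
  shows "D (\<lambda>A. A $$ (i, j)) A = (A * X) $$ (i, j)"
  unfolding inv_field_def using assms X by (intro dir_deriv_linear) simp

lemma D_pfun:
  assumes f: "f \<in> pfun n" shows "D f \<in> pfun n"
proof -
  obtain g where g: "g \<in> polyfun n" "\<forall>A\<in>carrier_mat n n. f A = g A" using f by (auto simp: pfun_def)
  have "D g \<in> pfun n" using g(1)
  proof induction
    case (const c)
    then show ?case by (rule pfun_cong[OF pfun_const[of 0]]) (simp add: D_const)
  next
    case (coord i j)
    then show ?case by (intro pfun_cong[OF pfun_mult_right[OF X coord]] D_coord)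
  next
    case (add f g)
    then show ?case by (intro pfun_cong[OF pfun_add[OF add(3,4)]] D_add polyfun_pfun)
  next
    case (mult f g)
    have "(\<lambda>A. D f A * g A + f A * D g A) \<in> pfun n"
      using mult by (intro pfun_add pfun_mult) (auto intro: polyfun_pfun)
    then show ?case using mult by (elim pfun_cong) (intro D_mult polyfun_pfun)
  qed
  then show ?thesis by (rule pfun_cong) (use g D_cong[of f g] in auto)
qed

lemma D_pow_pfun: "f \<in> pfun n \<Longrightarrow> (D ^^ k) f \<in> pfun n"
  by (induction k) (auto intro: D_pfun)

lemma binomial_shift_sum:
  fixes a :: "nat \<Rightarrow> nat \<Rightarrow> 'k"
  shows "(\<Sum>i\<le>k. of_nat (k choose i) * (a (Suc i) (k - i) + a i (Suc (k - i))))
    = (\<Sum>i\<le>Suc k. of_nat (Suc k choose i) * a i (Suc k - i))"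
proof -
  have 1: "(\<Sum>i\<le>k. of_nat (k choose i) * a i (Suc (k - i)))
      = a 0 (Suc k) + (\<Sum>i\<le>k. of_nat (k choose Suc i) * a (Suc i) (k - i))"
  proof -
    have "(\<Sum>i\<le>k. of_nat (k choose i) * a i (Suc (k - i)))
        = (\<Sum>i\<le>k. of_nat (k choose i) * a i (Suc k - i))"
      by (intro sum.cong refl) (simp add: Suc_diff_le)
    also have "\<dots> = (\<Sum>i\<le>Suc k. of_nat (k choose i) * a i (Suc k - i))"
      by (simp add: binomial_eq_0)
    also have "\<dots> = a 0 (Suc k) + (\<Sum>i\<le>k. of_nat (k choose Suc i) * a (Suc i) (k - i))"
      by (subst sum.atMost_Suc_shift) simp
    finally show ?thesis .
  qed
  have "(\<Sum>i\<le>Suc k. of_nat (Suc k choose i) * a i (Suc k - i))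
      = a 0 (Suc k) + (\<Sum>i\<le>k. of_nat (Suc k choose Suc i) * a (Suc i) (k - i))"
    by (subst sum.atMost_Suc_shift) simp
  also have "\<dots> = a 0 (Suc k) + (\<Sum>i\<le>k. of_nat (k choose i) * a (Suc i) (k - i))
      + (\<Sum>i\<le>k. of_nat (k choose Suc i) * a (Suc i) (k - i))"
    by (simp add: distrib_right sum.distrib)
  finally show ?thesis using 1 by (simp add: distrib_left sum.distrib)
qed

text \<open>The general Leibniz rule. In characteristic \<open>p\<close> only its two outer terms survive for \<open>k = p\<close>.\<close>

lemma leibniz:
  assumes f: "f \<in> pfun n" and g: "g \<in> pfun n" and A: "A \<in> carrier_mat n n"
  shows "(D ^^ k) (\<lambda>A. f A * g A) A
    = (\<Sum>i\<le>k. of_nat (k choose i) * ((D ^^ i) f A * (D ^^ (k - i)) g A))"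
  using A
proof (induction k arbitrary: A)
  case 0
  then show ?case by simp
next
  case (Suc k)
  have "(D ^^ Suc k) (\<lambda>A. f A * g A) A
      = D (\<lambda>A. \<Sum>i\<le>k. of_nat (k choose i) * ((D ^^ i) f A * (D ^^ (k - i)) g A)) A"
    unfolding funpow.simps comp_def by (rule D_cong) (use Suc in auto)
  also have "\<dots> = (\<Sum>i\<le>k. D (\<lambda>A. of_nat (k choose i) * ((D ^^ i) f A * (D ^^ (k - i)) g A)) A)"
    using f g Suc(2) by (intro D_sum) (auto intro!: pfun_mult pfun_const D_pow_pfun)
  also have "\<dots> = (\<Sum>i\<le>k. of_nat (k choose i) *
      ((D ^^ Suc i) f A * (D ^^ (k - i)) g A + (D ^^ i) f A * (D ^^ Suc (k - i)) g A))"
    using f g Suc(2) by (intro sum.cong refl)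
      (subst D_cmult; (subst D_mult)?; auto intro!: pfun_mult D_pow_pfun)
  also have "\<dots> = (\<Sum>i\<le>Suc k. of_nat (Suc k choose i) * ((D ^^ i) f A * (D ^^ (Suc k - i)) g A))"
    by (rule binomial_shift_sum[of k "\<lambda>i j. (D ^^ i) f A * (D ^^ j) g A"])
  finally show ?case .
qed

lemma pow_mat_comm: "X * X ^\<^sub>m k = X ^\<^sub>m k * X"
proof (induction k)
  case (Suc k)
  have c: "X ^\<^sub>m k \<in> carrier_mat n n" using X by simp
  have "X * X ^\<^sub>m Suc k = (X * X ^\<^sub>m k) * X" using X c by (simp add: assoc_mult_mat[of _ n n _ n _ n])
  then show ?case using Suc by simp
qed (use X in simp)

lemma D_pow_coord:
  assumes "i < n" "j < n" "A \<in> carrier_mat n n"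
  shows "(D ^^ k) (\<lambda>A. A $$ (i, j)) A = (A * X ^\<^sub>m k) $$ (i, j)"
  using assms(3)
proof (induction k arbitrary: A)
  case 0
  then show ?case using X by simp
next
  case (Suc k)
  have c: "X ^\<^sub>m k \<in> carrier_mat n n" using X by simp
  have "(D ^^ Suc k) (\<lambda>A. A $$ (i, j)) A = D (\<lambda>A. (A * X ^\<^sub>m k) $$ (i, j)) A"
    unfolding funpow.simps comp_def by (rule D_cong) (use Suc in auto)
  also have "\<dots> = (A * X * X ^\<^sub>m k) $$ (i, j)" by (rule D_mult_right[OF c assms(1,2) Suc(2)])
  also have "A * X * X ^\<^sub>m k = A * X ^\<^sub>m Suc k"
    using X c Suc(2) by (simp add: assoc_mult_mat[of _ n n _ n _ n] pow_mat_comm)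
  finally show ?case .
qed

text \<open>In characteristic \<open>p\<close> the \<open>p\<close>-th power of a derivation is a derivation, and on coordinates it is
  the vector field of \<open>X^p\<close>.\<close>

lemma D_pow_char:
  assumes p: "CHAR('k) = p" "p > 0" and f: "f \<in> polyfun n" and A: "A \<in> carrier_mat n n"
  shows "(D ^^ p) f A = inv_field (X ^\<^sub>m p) f A"
  using f A
proof (induction arbitrary: A)
  case (const c)
  obtain k where k: "p = Suc k" using p by (cases p) auto
  have "(D ^^ Suc k) (\<lambda>_. c) A = 0" if "A \<in> carrier_mat n n" for k A
    using that
  proof (induction k arbitrary: A)
    case (Suc k)
    have "(D ^^ Suc (Suc k)) (\<lambda>_. c) A = D (\<lambda>_. 0) A"
      unfolding funpow.simps(2)[of "Suc k"] comp_def by (rule D_cong) (use Suc in auto)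
    then show ?case by (simp add: D_const)
  qed (simp add: D_const)
  then have "(D ^^ p) (\<lambda>_. c) A = 0" unfolding k using const by blast
  moreover have "inv_field (X ^\<^sub>m p) (\<lambda>_. c) A = 0" by (simp add: inv_field_def dir_deriv_const)
  ultimately show ?case by (simp only:)
next
  case (coord i j)
  then have "inv_field (X ^\<^sub>m p) (\<lambda>A. A $$ (i, j)) A = (A * X ^\<^sub>m p) $$ (i, j)"
    unfolding inv_field_def using X by (intro dir_deriv_linear) simp
  then show ?case using D_pow_coord coord by simp
next
  case (add f g)
  have "(D ^^ k) (\<lambda>A. f A + g A) A = (D ^^ k) f A + (D ^^ k) g A" if "A \<in> carrier_mat n n" for k A
    using that
  proof (induction k arbitrary: A)
    case (Suc k)
    have "(D ^^ Suc k) (\<lambda>A. f A + g A) A = D (\<lambda>A. (D ^^ k) f A + (D ^^ k) g A) A"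
      unfolding funpow.simps comp_def by (rule D_cong) (use Suc in auto)
    then show ?case using Suc(2) add(1,2) by (simp add: D_add D_pow_pfun polyfun_pfun)
  qed simp
  moreover have "inv_field (X ^\<^sub>m p) (\<lambda>A. f A + g A) A = inv_field (X ^\<^sub>m p) f A + inv_field (X ^\<^sub>m p) g A"
    unfolding inv_field_def using add X by (intro dir_deriv_add[where n=n]) (auto intro: polyfun_pfun)
  ultimately show ?case using add by simp
next
  case (mult f g)
  have fg: "f \<in> pfun n" "g \<in> pfun n" using mult by (auto intro: polyfun_pfun)
  have prime: "prime p" using prime_CHAR_semidom[where ?'a='k] p by simp
  have "(D ^^ p) (\<lambda>A. f A * g A) A
      = (\<Sum>i\<le>p. of_nat (p choose i) * ((D ^^ i) f A * (D ^^ (p - i)) g A))"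
    by (rule leibniz[OF fg mult(5)])
  also have "\<dots> = (\<Sum>i\<in>{0, p}. of_nat (p choose i) * ((D ^^ i) f A * (D ^^ (p - i)) g A))"
  proof (rule sum.mono_neutral_right)
    show "\<forall>i\<in>{..p} - {0, p}. of_nat (p choose i) * ((D ^^ i) f A * (D ^^ (p - i)) g A) = 0"
    proof
      fix i assume "i \<in> {..p} - {0, p}"
      then have "p dvd (p choose i)" using prime by (intro dvd_choose_prime) auto
      then have "(of_nat (p choose i) :: 'k) = 0" unfolding of_nat_eq_0_iff_char_dvd p(1) .
      then show "of_nat (p choose i) * ((D ^^ i) f A * (D ^^ (p - i)) g A) = 0" by simp
    qed
  qed auto
  also have "\<dots> = f A * (D ^^ p) g A + (D ^^ p) f A * g A" using p by simp
  also have "\<dots> = inv_field (X ^\<^sub>m p) (\<lambda>A. f A * g A) A"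
  proof -
    have "inv_field (X ^\<^sub>m p) (\<lambda>A. f A * g A) A
        = inv_field (X ^\<^sub>m p) f A * g A + f A * inv_field (X ^\<^sub>m p) g A"
      unfolding inv_field_def using mult X fg by (intro dir_deriv_mult[where n=n]) auto
    then show ?thesis using mult by simp
  qed
  finally show ?case .
qed

text \<open>The vector field is left invariant, and left translates of equations of \<open>G\<close> by elements of \<open>G\<close> are again
  equations of \<open>G\<close>. So the derivation maps equations to equations.\<close>

lemma D_vanish:
  assumes G: "G \<subseteq> carrier_mat n n" "\<And>g h. g \<in> G \<Longrightarrow> h \<in> G \<Longrightarrow> g * h \<in> G"
    and XG: "X \<in> tangent_space n G"
    and f: "f \<in> pfun n" "\<And>g. g \<in> G \<Longrightarrow> f g = 0" and g: "g \<in> G"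
  shows "D f g = 0"
proof -
  have gc: "g \<in> carrier_mat n n" using g G by blast
  have "dir_deriv (\<lambda>A. f (g * A)) (1\<^sub>m n) X = 0"
    using pfun_translate[OF f(1) gc] f(2) G g by (intro tangent_pfun[OF XG G(1)]) auto
  moreover have "dir_deriv (\<lambda>A. f (g * A)) (1\<^sub>m n) X = dir_deriv f g (g * X)"
  proof -
    have "g * (1\<^sub>m n + t \<cdot>\<^sub>m X) = g + t \<cdot>\<^sub>m (g * X)" for t
      using gc X mult_add_distrib_mat[OF gc one_carrier_mat, of "t \<cdot>\<^sub>m X"] mult_smult_distrib[OF gc X, of t]
      by simp
    then show ?thesis unfolding dir_deriv_def by simp
  qed
  ultimately show ?thesis by (simp add: inv_field_def)
qed

end

text \<open>If \<open>X\<close> is tangent, then the derivation \<open>D\<close> of \<open>X\<close> maps equations of \<open>G\<close> to equations of \<open>G\<close>. So does \<open>D ^^ p\<close>, which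
  is the derivation of \<open>X ^ p\<close>.\<close>

theorem tangent_space_p_power:
  fixes G :: "'k::alg_closed_field mat set"
  assumes p: "CHAR('k) = p" "p > 0"
    and G: "G \<subseteq> carrier_mat n n" "1\<^sub>m n \<in> G" "\<And>g h. g \<in> G \<Longrightarrow> h \<in> G \<Longrightarrow> g * h \<in> G"
    and XG: "X \<in> tangent_space n G"
  shows "X ^\<^sub>m p \<in> tangent_space n G"
proof -
  have X: "X \<in> carrier_mat n n" using XG by (simp add: tangent_space_iff)
  have "dir_deriv f (1\<^sub>m n) (X ^\<^sub>m p) = 0" if f: "f \<in> polyfun n" "\<forall>g\<in>G. f g = 0" for f
  proof -
    have "\<forall>g\<in>G. (inv_field X ^^ k) f g = 0" for k
    proof (induction k)
      case (Suc k)
      then show ?case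
        using D_vanish[OF X G(1,3) XG D_pow_pfun[OF X polyfun_pfun[OF f(1)], of k]] by simp
    qed (use f in simp)
    then have "inv_field (X ^\<^sub>m p) f (1\<^sub>m n) = 0"
      using G(2) D_pow_char[OF X p f(1), of "1\<^sub>m n"] by simp
    then show ?thesis using X by (simp add: inv_field_def)
  qed
  then show ?thesis using X by (simp add: tangent_space_iff)
qed

section \<open>Lie algebras of tori\<close>

lemma mat_frob_add:
  fixes M N :: "'k::field mat"
  assumes p: "CHAR('k) = p" "p > 0" and M: "M \<in> carrier_mat n n" and N: "N \<in> carrier_mat n n"
    and comm: "M * N = N * M"
  shows "(M + N) ^\<^sub>m p = M ^\<^sub>m p + N ^\<^sub>m p"
proof -
  let ?R = "ring_mat TYPE('k) n ()"
  interpret R: ring ?R by (rule ring_mat)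
  have pow: "X ^\<^sub>m k = X [^]\<^bsub>?R\<^esub> k" if "X \<in> carrier_mat n n" for X :: "'k mat" and k
    using pow_mat_ring_pow[OF that] .
  have "[k] \<cdot>\<^bsub>?R\<^esub> \<one>\<^bsub>?R\<^esub> = of_nat k \<cdot>\<^sub>m 1\<^sub>m n" for k :: nat
  proof (induction k)
    case 0
    then show ?case by (auto simp: ring_mat_simps)
  next
    case (Suc k)
    have "[Suc k] \<cdot>\<^bsub>?R\<^esub> \<one>\<^bsub>?R\<^esub> = of_nat k \<cdot>\<^sub>m 1\<^sub>m n + 1\<^sub>m n"
      using Suc by (simp add: ring_mat_simps)
    also have "\<dots> = of_nat (Suc k) \<cdot>\<^sub>m 1\<^sub>m n" by (intro eq_matI) auto
    finally show ?case .
  qed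
  moreover have "(of_nat p :: 'k) = 0" unfolding p(1)[symmetric] by simp
  ultimately have char: "[p] \<cdot>\<^bsub>?R\<^esub> \<one>\<^bsub>?R\<^esub> = \<zero>\<^bsub>?R\<^esub>" by (auto simp: ring_mat_simps)
  have prime: "prime p" using prime_CHAR_semidom[where ?'a='k] p by simp
  show ?thesis
    using R.freshmans_dream_commuting[OF prime char, of M N] M N comm
    by (simp add: pow ring_mat_simps)
qed

lemma mat_smult_pow:
  fixes M :: "'k::field mat"
  assumes M: "M \<in> carrier_mat n n"
  shows "(c \<cdot>\<^sub>m M) ^\<^sub>m k = c ^ k \<cdot>\<^sub>m M ^\<^sub>m k"
proof (induction k)
  case (Suc k)
  have c: "M ^\<^sub>m k \<in> carrier_mat n n" using M by simp
  have "(c \<cdot>\<^sub>m M) ^\<^sub>m Suc k = (c ^ k \<cdot>\<^sub>m M ^\<^sub>m k) * (c \<cdot>\<^sub>m M)" using Suc by simp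
  also have "\<dots> = c ^ k \<cdot>\<^sub>m (M ^\<^sub>m k * (c \<cdot>\<^sub>m M))"
    using c M by (intro mult_smult_assoc_mat) auto
  also have "M ^\<^sub>m k * (c \<cdot>\<^sub>m M) = c \<cdot>\<^sub>m (M ^\<^sub>m k * M)"
    using c M by (intro mult_smult_distrib) auto
  also have "c ^ k \<cdot>\<^sub>m (c \<cdot>\<^sub>m (M ^\<^sub>m k * M)) = c ^ Suc k \<cdot>\<^sub>m M ^\<^sub>m Suc k"
    using c M by (intro eq_matI) auto
  finally show ?case .
next
  case 0
  show ?case using M by (intro eq_matI) auto
qed

lemma sum_fun_apply: "(\<Sum>i\<in>I. f i) x = (\<Sum>i\<in>I. f i x :: 'k::comm_monoid_add)"
  by (induction I rule: infinite_finite_induct) auto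

interpretation FV: vector_space "\<lambda>(c::'k::field) (f :: 'i \<Rightarrow> 'k). \<lambda>x. c * f x"
  by unfold_locales (auto simp: fun_eq_iff algebra_simps)

text \<open>A Frobenius-semilinear map whose image contains a spanning set of a finite-dimensional space is
  injective: it carries a basis to a spanning set of the same size.\<close>

lemma (in vector_space) semilinear_onto_imp_inj:
  assumes Z: "finite Z" "S \<subseteq> span Z"
    and add: "\<And>v w. v \<in> span S \<Longrightarrow> w \<in> span S \<Longrightarrow> \<phi> (v + w) = \<phi> v + \<phi> w"
    and scale: "\<And>c v. v \<in> span S \<Longrightarrow> \<phi> (scale c v) = scale (c ^ p) (\<phi> v)" and p: "p > 0"
    and onto: "S \<subseteq> \<phi> ` span S"
    and v: "v \<in> span S" "\<phi> v = 0"
  shows "v = 0"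
proof -
  obtain B where B: "B \<subseteq> S" "independent B" "S \<subseteq> span B"
    using maximal_independent_subset by blast
  have fB: "finite B" using independent_span_bound[OF Z(1) B(2)] B(1) Z(2) by blast
  have \<phi>0: "\<phi> 0 = 0" using add[of 0 0] span_zero by simp
  have comb: "\<phi> (\<Sum>b\<in>B'. scale (u b) b) = (\<Sum>b\<in>B'. scale (u b ^ p) (\<phi> b))"
    if "B' \<subseteq> B" for u B'
    using finite_subset[OF that fB] that
  proof (induction B' rule: finite_induct)
    case (insert b B')
    have b: "b \<in> span S" using insert B(1) span_base by blast
    have "(\<Sum>b\<in>B'. scale (u b) b) \<in> span S"
      using insert B(1) by (intro span_sum span_scale span_base) auto
    then show ?case using insert b by (simp add: add scale span_scale)
  qed (simp add: \<phi>0)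
  have spanB: "span S \<subseteq> span B" using B(3) by (rule span_minimal) (rule subspace_span)
  have rep: "\<exists>u. w = (\<Sum>b\<in>B. scale (u b) b)" if "w \<in> span S" for w
    using that spanB span_finite[OF fB] by blast
  have S\<phi>: "S \<subseteq> span (\<phi> ` B)"
  proof
    fix s assume "s \<in> S"
    then obtain w where w: "w \<in> span S" "s = \<phi> w" using onto by blast
    then obtain u where "w = (\<Sum>b\<in>B. scale (u b) b)" using rep by blast
    then have "s = (\<Sum>b\<in>B. scale (u b ^ p) (\<phi> b))" using w comb by simp
    then show "s \<in> span (\<phi> ` B)" by (simp only:) (intro span_sum span_scale span_base imageI)
  qed
  \<comment> \<open>A spanning set of the space is at least as large as its basis \<open>B\<close>.\<close>
  have small: "card B \<le> card Y" if "finite Y" "S \<subseteq> span Y" for Y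
    using independent_span_bound[OF that(1) B(2)] B(1) that(2) by blast
  have inj: "inj_on \<phi> B"
    using small[OF finite_imageI[OF fB] S\<phi>] card_image_le[OF fB, of \<phi>] fB
    by (intro eq_card_imp_inj_on) auto
  have ind: "independent (\<phi> ` B)"
  proof
    assume "dependent (\<phi> ` B)"
    then obtain y where y: "y \<in> \<phi> ` B" "y \<in> span (\<phi> ` B - {y})" unfolding dependent_def by blast
    then have "span (\<phi> ` B - {y}) = span (\<phi> ` B)"
      using span_redundant[of y "\<phi> ` B - {y}"] by (simp add: insert_absorb)
    then have "card B \<le> card (\<phi> ` B - {y})" using small[of "\<phi> ` B - {y}"] S\<phi> fB by simp
    also have "\<dots> < card (\<phi> ` B)" using y fB by (intro card_Diff1_less) auto
    also have "\<dots> \<le> card B" by (rule card_image_le[OF fB])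
    finally show False by simp
  qed
  obtain u where u: "v = (\<Sum>b\<in>B. scale (u b) b)" using rep[OF v(1)] by blast
  have "(\<Sum>y\<in>\<phi> ` B. scale (u (inv_into B \<phi> y) ^ p) y) = (\<Sum>b\<in>B. scale (u b ^ p) (\<phi> b))"
    by (subst sum.reindex[OF inj]) (auto simp: inj intro!: sum.cong)
  also have "\<dots> = 0" using v(2) u comb[of B u] by simp
  finally have z: "(\<Sum>y\<in>\<phi> ` B. scale (u (inv_into B \<phi> y) ^ p) y) = 0" .
  have "u b = 0" if "b \<in> B" for b
  proof -
    have "u (inv_into B \<phi> (\<phi> b)) ^ p = 0"
    proof (rule ccontr)
      assume "u (inv_into B \<phi> (\<phi> b)) ^ p \<noteq> 0"
      then have "dependent (\<phi> ` B)"
        unfolding dependent_finite[OF finite_imageI[OF fB]]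
        by (intro exI[of _ "\<lambda>y. u (inv_into B \<phi> y) ^ p"] conjI bexI[of _ "\<phi> b"] z imageI that)
      then show False using ind by contradiction
    qed
    then show ?thesis using that inj p by simp
  qed
  then show ?thesis using u by simp
qed

text \<open>Matrices of a fixed size do not form a type. Linear algebra with them is done in the function space on all
  pairs of indices, into which they embed by extension by zero.\<close>

definition vecf :: "nat \<Rightarrow> 'k::zero mat \<Rightarrow> nat \<times> nat \<Rightarrow> 'k" where
  "vecf n A = (\<lambda>(i, j). if i < n \<and> j < n then A $$ (i, j) else 0)"

abbreviation unvec :: "nat \<Rightarrow> (nat \<times> nat \<Rightarrow> 'k) \<Rightarrow> 'k mat" where
  "unvec n v \<equiv> Matrix.mat n n v"

lemma unvec_vecf: "A \<in> carrier_mat n n \<Longrightarrow> unvec n (vecf n A) = A"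
  by (intro eq_matI) (auto simp: vecf_def)

lemma vecf_inj: "A \<in> carrier_mat n n \<Longrightarrow> A' \<in> carrier_mat n n \<Longrightarrow> vecf n A = vecf n A' \<Longrightarrow> A = A'"
  by (metis unvec_vecf)

lemma vecf_add: "(A :: 'k::field mat) \<in> carrier_mat n n \<Longrightarrow> A' \<in> carrier_mat n n \<Longrightarrow> vecf n (A + A') = vecf n A + vecf n A'"
  by (auto simp: vecf_def fun_eq_iff)

lemma vecf_smult: "A \<in> carrier_mat n n \<Longrightarrow> vecf n (c \<cdot>\<^sub>m A) = (\<lambda>x. c * vecf n (A :: 'k::field mat) x)"
  by (auto simp: vecf_def fun_eq_iff)

lemma vecf_zero: "vecf n (0\<^sub>m n n) = (0 :: _ \<Rightarrow> 'k::field)"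
  by (auto simp: vecf_def fun_eq_iff)

lemma unvec_add: "unvec n (v + w) = unvec n v + unvec n (w :: _ \<Rightarrow> 'k::field)"
  by (intro eq_matI) auto

lemma unvec_smult: "unvec n (\<lambda>x. c * v x) = c \<cdot>\<^sub>m unvec n (v :: _ \<Rightarrow> 'k::field)"
  by (intro eq_matI) auto

definition unit_fun :: "'i \<Rightarrow> 'i \<Rightarrow> 'k::field" where "unit_fun x = (\<lambda>y. if y = x then 1 else 0)"

lemma vecf_expand:
  "vecf n (A :: 'k::field mat) = (\<Sum>x\<in>{0..<n} \<times> {0..<n}. (\<lambda>y. A $$ x * unit_fun x y))"
proof
  fix y :: "nat \<times> nat"
  obtain i j where y: "y = (i, j)" by (cases y)
  have "(\<Sum>x\<in>{0..<n} \<times> {0..<n}. (\<lambda>y. A $$ x * unit_fun x y)) y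
      = (\<Sum>x\<in>{0..<n} \<times> {0..<n}. if x = y then A $$ x else 0)"
    unfolding sum_fun_apply unit_fun_def by (intro sum.cong) auto
  then show "vecf n A y = (\<Sum>x\<in>{0..<n} \<times> {0..<n}. (\<lambda>y. A $$ x * unit_fun x y)) y"
    by (simp add: vecf_def y)
qed

lemma vecf_in_span_units: "vecf n (A :: 'k::field mat) \<in> FV.span (unit_fun ` ({0..<n} \<times> {0..<n}))"
  unfolding vecf_expand by (intro FV.span_sum FV.span_scale FV.span_base) auto

text \<open>A tangent vector at the identity lies in the linear span of the group, because linear
  functionals vanishing on the group are among its equations.\<close>

lemma tangent_in_span:
  fixes G :: "'k::alg_closed_field mat set"
  assumes G: "G \<subseteq> carrier_mat n n" and X: "X \<in> tangent_space n G"
  shows "vecf n X \<in> FV.span (vecf n ` G)"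
proof (rule ccontr)
  assume nin: "vecf n X \<notin> FV.span (vecf n ` G)"
  have Xc: "X \<in> carrier_mat n n" using X by (simp add: tangent_space_iff)
  obtain B where B: "B \<subseteq> vecf n ` G" "FV.independent B" "vecf n ` G \<subseteq> FV.span B"
    using FV.maximal_independent_subset by blast
  have "vecf n X \<notin> FV.span B" using nin FV.span_mono[OF B(1)] by blast
  then have ind: "FV.independent (insert (vecf n X) B)" using B by (intro FV.independent_insertI)
  interpret P: vector_space_pair "\<lambda>(c::'k) (f :: nat \<times> nat \<Rightarrow> 'k). \<lambda>x. c * f x" "(*) :: 'k \<Rightarrow> 'k \<Rightarrow> 'k"
    by unfold_locales (auto simp: algebra_simps)
  obtain g where g: "Vector_Spaces.linear (\<lambda>(c::'k) f. \<lambda>x. c * f x) (*) g"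
    and gv: "\<forall>x\<in>insert (vecf n X) B. g x = (if x = vecf n X then 1 else 0)"
    using P.linear_independent_extend[OF ind, of "\<lambda>x. if x = vecf n X then 1 else 0"] by blast
  interpret g: Vector_Spaces.linear "\<lambda>(c::'k) (f :: nat \<times> nat \<Rightarrow> 'k). \<lambda>x. c * f x" "(*)" g by (rule g)
  have "g b = 0" if "b \<in> B" for b
    using gv that \<open>vecf n X \<notin> FV.span B\<close> FV.span_base by (metis insert_iff)
  then have "B \<subseteq> {v. g v = 0}" by blast
  moreover have "FV.subspace {v. g v = 0}"
    by (rule FV.subspaceI) (auto simp: g.zero g.add g.scale)
  ultimately have "FV.span B \<subseteq> {v. g v = 0}" by (rule FV.span_minimal)
  then have van: "g (vecf n t) = 0" if "t \<in> G" for t using that B(3) by blast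
  have "(\<lambda>A. g (vecf n A)) \<in> pfun n"
  proof (rule pfun_cong)
    show "(\<lambda>A. \<Sum>x\<in>{0..<n} \<times> {0..<n}. A $$ x * g (unit_fun x)) \<in> pfun n"
      by (intro pfun_sum pfun_mult pfun_const) (auto intro: pfun_coord)
    show "g (vecf n A) = (\<Sum>x\<in>{0..<n} \<times> {0..<n}. A $$ x * g (unit_fun x))" for A
      unfolding vecf_expand g.sum by (simp add: g.scale)
  qed
  then have "dir_deriv (\<lambda>A. g (vecf n A)) (1\<^sub>m n) X = 0" using van by (intro tangent_pfun[OF X G])
  moreover have "dir_deriv (\<lambda>A. g (vecf n A)) (1\<^sub>m n) X = g (vecf n X)"
  proof (rule dir_deriv_linear)
    fix t
    show "g (vecf n (1\<^sub>m n + t \<cdot>\<^sub>m X)) = g (vecf n (1\<^sub>m n)) + t * g (vecf n X)"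
      using Xc by (simp add: vecf_add vecf_smult g.add g.scale)
  qed
  ultimately show False using gv by simp
qed

text \<open>The properties of a torus that make its Lie algebra toral.\<close>

locale divisible_group =
  fixes n p :: nat and T :: "'k::alg_closed_field mat set"
  assumes T: "T \<subseteq> carrier_mat n n" and T_one: "1\<^sub>m n \<in> T"
    and T_mult: "\<And>s t. s \<in> T \<Longrightarrow> t \<in> T \<Longrightarrow> s * t \<in> T"
    and T_comm: "\<And>s t. s \<in> T \<Longrightarrow> t \<in> T \<Longrightarrow> s * t = t * s"
    and T_root: "\<And>t. t \<in> T \<Longrightarrow> \<exists>u\<in>T. u ^\<^sub>m p = t"
    and p: "CHAR('k) = p" "p > 0"
begin

abbreviation "U \<equiv> FV.span (vecf n ` T)"

text \<open>Commutation with a fixed matrix is a linear condition, so it passes from \<open>T\<close> to the linear span in one argument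
  after the other.\<close>

lemma U_comm:
  assumes "v \<in> U" "w \<in> U"
  shows "unvec n v * unvec n w = unvec n w * unvec n v"
proof -
  have sub: "FV.subspace {v. unvec n v * M = M * unvec n v}" if M: "M \<in> carrier_mat n n" for M :: "'k mat"
  proof (rule FV.subspaceI)
    show "0 \<in> {v. unvec n v * M = M * unvec n v}"
    proof -
      have "unvec n 0 = (0\<^sub>m n n :: 'k mat)" by (intro eq_matI) auto
      then show ?thesis using M by simp
    qed
    fix v w assume "v \<in> {v. unvec n v * M = M * unvec n v}" "w \<in> {v. unvec n v * M = M * unvec n v}"
    then show "v + w \<in> {v. unvec n v * M = M * unvec n v}"
      using M by (simp add: unvec_add add_mult_distrib_mat[of _ n n]
          mult_add_distrib_mat[OF M, of "unvec n v" n "unvec n w"])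
  next
    fix c v assume "v \<in> {v. unvec n v * M = M * unvec n v}"
    then show "(\<lambda>x. c * v x) \<in> {v. unvec n v * M = M * unvec n v}"
      using M by (simp add: unvec_smult mult_smult_assoc_mat[of _ n n _ n] mult_smult_distrib[of _ n n _ n])
  qed
  have "U \<subseteq> {v. unvec n v * t = t * unvec n v}" if t: "t \<in> T" for t
    using T T_comm t by (intro FV.span_minimal sub) (auto simp: unvec_vecf subset_iff)
  then have "vecf n ` T \<subseteq> {v. unvec n v * unvec n w = unvec n w * unvec n v}" if "w \<in> U" for w
    using that T by (auto simp: unvec_vecf subset_iff)
  then have "U \<subseteq> {v. unvec n v * unvec n w = unvec n w * unvec n v}"
    using assms(2) by (intro FV.span_minimal sub) auto
  then show ?thesis using assms(1) by blast
qed

text \<open>On the commutative span of \<open>T\<close> the \<open>p\<close>-th power map is Frobenius-semilinear, and its image contains \<open>T\<close>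
  because \<open>T\<close> consists of \<open>p\<close>-th powers of its elements.\<close>

lemma U_pow_inj:
  assumes v: "v \<in> U" and z: "unvec n v ^\<^sub>m p = 0\<^sub>m n n"
  shows "v = 0"
proof (rule FV.semilinear_onto_imp_inj[where \<phi> = "\<lambda>v. vecf n (unvec n v ^\<^sub>m p)" and p = p
      and S = "vecf n ` T" and Z = "unit_fun ` ({0..<n} \<times> {0..<n})"])
  show "finite (unit_fun ` ({0..<n} \<times> {0..<n}))" by simp
  show "vecf n ` T \<subseteq> FV.span (unit_fun ` ({0..<n} \<times> {0..<n}))" using vecf_in_span_units by blast
  show "vecf n (unvec n (v + w) ^\<^sub>m p) = vecf n (unvec n v ^\<^sub>m p) + vecf n (unvec n w ^\<^sub>m p)"
    if "v \<in> U" "w \<in> U" for v w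
    using mat_frob_add[OF p _ _ U_comm[OF that], of n] by (simp add: unvec_add vecf_add)
  show "vecf n (unvec n (\<lambda>x. c * v x) ^\<^sub>m p) = (\<lambda>x. c ^ p * vecf n (unvec n v ^\<^sub>m p) x)"
    for c :: 'k and v
    by (simp add: unvec_smult mat_smult_pow[of _ n] vecf_smult)
  show "vecf n ` T \<subseteq> (\<lambda>v. vecf n (unvec n v ^\<^sub>m p)) ` U"
  proof
    fix y assume "y \<in> vecf n ` T"
    then obtain t where t: "t \<in> T" "y = vecf n t" by blast
    then obtain u where u: "u \<in> T" "u ^\<^sub>m p = t" using T_root by blast
    have "unvec n (vecf n u) ^\<^sub>m p = t" using u T by (auto simp: unvec_vecf subset_iff)
    moreover have "vecf n u \<in> U" using u(1) by (intro FV.span_base) blast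
    ultimately show "y \<in> (\<lambda>v. vecf n (unvec n v ^\<^sub>m p)) ` U" using t(2) by blast
  qed
  show "vecf n (unvec n v ^\<^sub>m p) = 0" unfolding z by (rule vecf_zero)
qed (use p v in auto)

abbreviation "\<tt> \<equiv> tangent_space n T"
abbreviation "LT \<equiv> lie_algebra p n T"

lemma tangent_carrier: "X \<in> \<tt> \<Longrightarrow> X \<in> carrier_mat n n"
  by (simp add: tangent_space_iff)

lemma tangent_U: "X \<in> \<tt> \<Longrightarrow> vecf n X \<in> U"
  by (rule tangent_in_span[OF T])

lemma tangent_comm:
  assumes "X \<in> \<tt>" "X' \<in> \<tt>" shows "X * X' = X' * X"
  using U_comm[OF tangent_U[OF assms(1)] tangent_U[OF assms(2)]] assms
  by (simp add: unvec_vecf tangent_carrier)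

lemma tangent_inj:
  assumes "X \<in> \<tt>" "X ^\<^sub>m p = 0\<^sub>m n n" shows "X = 0\<^sub>m n n"
proof -
  have "vecf n X = 0"
    using U_pow_inj[OF tangent_U[OF assms(1)]] assms by (simp add: unvec_vecf tangent_carrier)
  then show ?thesis
    using vecf_inj[of X n "0\<^sub>m n n"] assms(1) by (simp add: vecf_zero tangent_carrier)
qed

lemma tangent_add: "X \<in> \<tt> \<Longrightarrow> X' \<in> \<tt> \<Longrightarrow> X + X' \<in> \<tt>"
  and tangent_smult: "X \<in> \<tt> \<Longrightarrow> c \<cdot>\<^sub>m X \<in> \<tt>"
  by (auto simp: tangent_space_iff dir_deriv_linear_dir)

lemma tangent_zero: "0\<^sub>m n n \<in> \<tt>"
proof -
  have "dir_deriv f (1\<^sub>m n) (0\<^sub>m n n) = 0" for f :: "'k mat \<Rightarrow> 'k"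
    using dir_deriv_eqI[of "[:f (1\<^sub>m n):]" f "1\<^sub>m n" "0\<^sub>m n n"] by simp
  then show ?thesis by (simp add: tangent_space_iff)
qed

lemma LT_vectorspace: "vectorspace class_ring LT"
proof -
  have "module class_ring LT"
  proof (rule Module.moduleI)
    show "cring (class_ring :: 'k ring)" using class_field[where ?'a = 'k] by (simp add: field_def domain_def)
    show "abelian_group LT"
    proof (rule abelian_groupI)
      fix X assume "X \<in> carrier LT"
      then have X: "X \<in> \<tt>" by (simp add: lie_algebra_def)
      have "(- 1) \<cdot>\<^sub>m X + X = 0\<^sub>m n n" using tangent_carrier[OF X] by (intro eq_matI) auto
      then show "\<exists>Y\<in>carrier LT. Y \<oplus>\<^bsub>LT\<^esub> X = \<zero>\<^bsub>LT\<^esub>"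
        using tangent_smult[OF X, of "- 1"] by (auto simp: lie_algebra_def)
    next
      fix X Y assume "X \<in> carrier LT" "Y \<in> carrier LT"
      then show "X \<oplus>\<^bsub>LT\<^esub> Y = Y \<oplus>\<^bsub>LT\<^esub> X"
        using comm_add_mat[of X n n Y] by (simp add: lie_algebra_def tangent_carrier)
    qed (auto simp: lie_algebra_def tangent_add tangent_zero tangent_carrier assoc_add_mat[of _ n n])
  qed (auto simp: lie_algebra_def class_ring_simps tangent_smult tangent_carrier
      add_smult_distrib_right_mat[of _ n n] add_smult_distrib_left_mat[of _ n n])
  then show ?thesis by (intro vectorspace.intro class_field)
qed

sublocale LV: vectorspace class_ring LT by (rule LT_vectorspace)

lemma LT_lincomb:
  assumes "finite S" "S \<subseteq> \<tt>"
  shows "vecf n (LV.lincomb a S) = (\<Sum>X\<in>S. (\<lambda>x. a X * vecf n X x))"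
  using assms
proof (induction S rule: finite_induct)
  case empty
  have "LV.lincomb a {} = \<zero>\<^bsub>LT\<^esub>" by (rule LV.lincomb_empty)
  also have "\<dots> = 0\<^sub>m n n" by (simp add: lie_algebra_def)
  finally show ?case by (simp add: vecf_zero)
next
  case (insert X S)
  have c: "carrier LT = \<tt>" "\<And>X c. c \<odot>\<^bsub>LT\<^esub> X = c \<cdot>\<^sub>m X" "\<And>X Y. X \<oplus>\<^bsub>LT\<^esub> Y = X + Y"
    by (simp_all add: lie_algebra_def)
  have K: "\<And>c. c \<in> carrier class_ring" by (simp add: class_ring_simps)
  have "LV.lincomb a (insert X S) = a X \<cdot>\<^sub>m X + LV.lincomb a S"
    using LV.lincomb_insert[of S a X] insert K by (simp add: c)
  moreover have "LV.lincomb a S \<in> \<tt>"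
    using LV.lincomb_closed[of S a] insert K by (simp add: c)
  ultimately show ?case using insert by (simp add: vecf_add vecf_smult tangent_carrier)
qed

text \<open>Independent subsets remain independent in the space of all \<open>n \<times> n\<close> matrices, so their size is bounded by
  \<open>n^2\<close>, and one of maximal size spans.\<close>

lemma LT_fin_dim: "LV.fin_dim"
proof -
  let ?Z = "unit_fun ` ({0..<n} \<times> {0..<n}) :: (nat \<times> nat \<Rightarrow> 'k) set"
  have car: "carrier LT = \<tt>" by (simp add: lie_algebra_def)
  have bound: "card S < Suc (card ?Z)" if S: "finite S" "S \<subseteq> \<tt>" "LV.lin_indpt S" for S
  proof -
    have inj: "inj_on (vecf n) S"
      using S(2) vecf_inj tangent_carrier by (intro inj_onI) blast
    have "FV.independent (vecf n ` S)"
    proof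
      assume "FV.dependent (vecf n ` S)"
      then obtain u X where X: "X \<in> S" "u (vecf n X) \<noteq> 0"
        and z: "(\<Sum>v\<in>vecf n ` S. (\<lambda>x. u v * v x)) = 0"
        unfolding FV.dependent_finite[OF finite_imageI[OF S(1)]] by blast
      have "vecf n (LV.lincomb (\<lambda>X. u (vecf n X)) S) = 0"
        using z unfolding LT_lincomb[OF S(1,2)] sum.reindex[OF inj] by (simp add: comp_def)
      moreover have "LV.lincomb (\<lambda>X. u (vecf n X)) S \<in> \<tt>"
        using LV.lincomb_closed[of S "\<lambda>X. u (vecf n X)"] S(2) by (simp add: car class_ring_simps)
      ultimately have "LV.lincomb (\<lambda>X. u (vecf n X)) S = 0\<^sub>m n n"
        by (intro vecf_inj[OF tangent_carrier zero_carrier_mat]) (simp_all only: vecf_zero)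
      then have "LV.lin_dep S"
        using X S by (intro LV.lin_dep_crit[of S S "\<lambda>X. u (vecf n X)" X])
          (auto simp: class_ring_simps lie_algebra_def)
      then show False using S(3) by simp
    qed
    moreover have "vecf n ` S \<subseteq> FV.span ?Z" using vecf_in_span_units by blast
    ultimately have "card (vecf n ` S) \<le> card ?Z"
      using FV.independent_span_bound[of ?Z "vecf n ` S"] by simp
    then show ?thesis using card_image[OF inj] by simp
  qed
  let ?P = "\<lambda>S. finite S \<and> S \<subseteq> \<tt> \<and> LV.lin_indpt S"
  have "\<exists>S. ?P S \<and> (\<forall>S'. ?P S' \<longrightarrow> card S' \<le> card S)"
  proof (rule ex_has_greatest_nat[where P = ?P and f = card and k = "{}" and b = "Suc (card ?Z)"])
    show "?P {}" by (simp add: LV.lin_dep_def)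
    show "\<forall>S. ?P S \<longrightarrow> card S < Suc (card ?Z)" using bound by blast
  qed
  then obtain S where S: "finite S" "S \<subseteq> \<tt>" "LV.lin_indpt S"
    and max: "\<And>S'. ?P S' \<Longrightarrow> card S' \<le> card S" by blast
  have "\<tt> \<subseteq> LV.span S"
  proof
    fix X assume X: "X \<in> \<tt>"
    show "X \<in> LV.span S"
    proof (cases "X \<in> S")
      case True
      then show ?thesis using LV.in_own_span[of S] S(2) car by blast
    next
      case False
      then have "\<not> card (S \<union> {X}) \<le> card S" using S(1) by simp
      then have "\<not> ?P (S \<union> {X})" using max by blast
      then have "LV.lin_dep (S \<union> {X})" using S X by simp
      then show ?thesis using LV.lin_dep_iff_in_span[of S X] S X False car by blast
    qed
  qed
  moreover have "LV.span S \<subseteq> \<tt>" using LV.span_is_subset2[of S] S(2) car by simp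
  ultimately have "LV.gen_set S" using car by blast
  then show ?thesis unfolding LV.fin_dim_def using S(1,2) car by blast
qed

theorem LT_toral: "toral_lie p LT"
proof (rule toral_lie.intro[OF LT_vectorspace LT_fin_dim p])
  fix X Y assume "X \<in> carrier LT" "Y \<in> carrier LT"
  then have XY: "X \<in> \<tt>" "Y \<in> \<tt>" by (simp_all add: lie_algebra_def)
  then show "lie_bracket LT X Y = \<zero>\<^bsub>LT\<^esub>"
    using tangent_comm[OF XY] tangent_carrier[OF XY(1)] tangent_carrier[OF XY(2)]
    by (simp add: lie_algebra_def)
  show "p_map LT (X \<oplus>\<^bsub>LT\<^esub> Y) = p_map LT X \<oplus>\<^bsub>LT\<^esub> p_map LT Y"
    using mat_frob_add[OF p tangent_carrier[OF XY(1)] tangent_carrier[OF XY(2)] tangent_comm[OF XY]]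
    by (simp add: lie_algebra_def)
next
  fix X assume "X \<in> carrier LT"
  then have X: "X \<in> \<tt>" by (simp add: lie_algebra_def)
  show "p_map LT X \<in> carrier LT"
    using tangent_space_p_power[OF p T T_one T_mult X] by (simp add: lie_algebra_def)
  show "p_map LT X = \<zero>\<^bsub>LT\<^esub> \<Longrightarrow> X = \<zero>\<^bsub>LT\<^esub>"
    using tangent_inj[OF X] by (simp add: lie_algebra_def)
  show "p_map LT (c \<odot>\<^bsub>LT\<^esub> X) = c ^ p \<odot>\<^bsub>LT\<^esub> p_map LT X" for c
    using mat_smult_pow[OF tangent_carrier[OF X]] by (simp add: lie_algebra_def)
qed

end

lemma diag_group_iff:
  fixes d :: "'k::field mat"
  shows "d \<in> diag_group r \<longleftrightarrow> (\<exists>f. (\<forall>i<r. f i \<noteq> 0) \<and> d = mat_diag r f)"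
proof
  assume d: "d \<in> diag_group r"
  then have dc: "d \<in> carrier_mat r r" and diag: "diagonal_mat d"
    and "\<exists>e\<in>carrier_mat r r. e * d = 1\<^sub>m r \<and> d * e = 1\<^sub>m r"
    by (auto simp: diag_group_def GL_def units_of_def Units_def ring_mat_simps)
  then obtain e where e: "e \<in> carrier_mat r r" "d * e = 1\<^sub>m r" by blast
  have eq: "d = mat_diag r (\<lambda>i. d $$ (i, i))"
    using dc diag by (intro eq_matI) (auto simp: mat_diag_def diagonal_mat_def)
  have "d $$ (i, i) \<noteq> 0" if i: "i < r" for i
  proof
    assume z: "d $$ (i, i) = 0"
    have "(mat_diag r (\<lambda>i. d $$ (i, i)) * e) $$ (i, i) = 0"
      using i z by (simp add: mat_diag_mult_left[OF e(1)])
    moreover have "mat_diag r (\<lambda>i. d $$ (i, i)) * e = 1\<^sub>m r" unfolding eq[symmetric] by (rule e(2))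
    ultimately show False using i by simp
  qed
  then show "\<exists>f. (\<forall>i<r. f i \<noteq> 0) \<and> d = mat_diag r f"
    using eq by (intro exI[of _ "\<lambda>i. d $$ (i, i)"]) simp
next
  assume "\<exists>f. (\<forall>i<r. f i \<noteq> 0) \<and> d = mat_diag r f"
  then obtain f where f: "\<forall>i<r. f i \<noteq> 0" "d = mat_diag r f" by blast
  have "mat_diag r (\<lambda>i. inverse (f i) * f i) = 1\<^sub>m r" "mat_diag r (\<lambda>i. f i * inverse (f i)) = 1\<^sub>m r"
    using f(1) by (auto simp: mat_diag_def intro!: eq_matI)
  then have "mat_diag r (\<lambda>i. inverse (f i)) * mat_diag r f = 1\<^sub>m r"
    "mat_diag r f * mat_diag r (\<lambda>i. inverse (f i)) = 1\<^sub>m r"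
    by simp_all
  moreover have "dim_row (mat_diag r f) = r" by (simp add: mat_diag_def)
  ultimately have "mat_diag r f \<in> Units (ring_mat TYPE('k) r ())"
    unfolding Units_def ring_mat_simps by (intro CollectI conjI bexI[of _ "mat_diag r (\<lambda>i. inverse (f i))"]) simp_all
  moreover have "diagonal_mat (mat_diag r f)" by (simp add: diagonal_mat_def mat_diag_def)
  ultimately show "d \<in> diag_group r"
    unfolding f(2) by (simp add: diag_group_def GL_def units_of_def)
qed

text \<open>All properties are transported from the diagonal group, where multiplication is commutative and roots are taken
  entry by entry.\<close>

theorem torus_divisible:
  fixes T :: "'k::alg_closed_field mat set"
  assumes T: "torus n T" and p: "CHAR('k) = p" "p > 0"
  shows "divisible_group n p T"
proof -
  obtain r \<phi> \<psi> where \<phi>: "alg_hom n T r (diag_group r) \<phi>" and \<psi>: "alg_hom r (diag_group r) n T \<psi>"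
    and \<psi>\<phi>: "\<And>t. t \<in> T \<Longrightarrow> \<psi> (\<phi> t) = t"
    using T unfolding torus_def alg_iso_def by blast
  have GLm: "x \<otimes>\<^bsub>GL k\<^esub> y = x * y" "\<one>\<^bsub>GL k\<^esub> = 1\<^sub>m k" for k and x y :: "'k mat"
    by (simp_all add: GL_def units_of_def ring_mat_simps)
  have \<phi>T: "\<phi> t \<in> diag_group r" if "t \<in> T" for t
    using \<phi> that by (auto simp: alg_hom_def hom_def)
  have \<phi>m: "\<phi> (s * t) = \<phi> s * \<phi> t" if "s \<in> T" "t \<in> T" for s t
    using \<phi> that by (auto simp: alg_hom_def hom_def GLm)
  have \<psi>D: "\<psi> d \<in> T" if "d \<in> diag_group r" for d
    using \<psi> that by (auto simp: alg_hom_def hom_def)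
  have \<psi>m: "\<psi> (d * e) = \<psi> d * \<psi> e" if "d \<in> diag_group r" "e \<in> diag_group r" for d e
    using \<psi> that by (auto simp: alg_hom_def hom_def GLm)
  have sub: "subgroup T (GL n)" using T by (simp add: torus_def algebraic_group_def)
  have Tc: "T \<subseteq> carrier_mat n n"
    using subgroup.subset[OF sub] by (auto simp: GL_def units_of_def Units_def ring_mat_simps)
  show ?thesis
  proof
    show "T \<subseteq> carrier_mat n n" by (rule Tc)
    show one: "1\<^sub>m n \<in> T" using subgroup.one_closed[OF sub] by (simp add: GLm)
    show mult: "s * t \<in> T" if "s \<in> T" "t \<in> T" for s t
      using subgroup.m_closed[OF sub that] by (simp add: GLm)
    show "s * t = t * s" if st: "s \<in> T" "t \<in> T" for s t
    proof -
      obtain f g where "\<phi> s = mat_diag r f" "\<phi> t = mat_diag r g"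
        using \<phi>T st unfolding diag_group_iff by meson
      then have "\<phi> (s * t) = \<phi> (t * s)" using st by (simp add: \<phi>m mult.commute)
      then show ?thesis using \<psi>\<phi> mult st by metis
    qed
    show "\<exists>u\<in>T. u ^\<^sub>m p = t" if t: "t \<in> T" for t
    proof -
      obtain f where f: "\<forall>i<r. f i \<noteq> 0" "\<phi> t = mat_diag r f"
        using \<phi>T[OF t] unfolding diag_group_iff by blast
      define g where "g = (\<lambda>i. SOME y. y ^ p = f i)"
      have g: "g i ^ p = f i" for i
        unfolding g_def using someI_ex[OF nth_root_exists[OF p(2), of "f i"]] .
      have g0: "g i ^ k \<noteq> 0" if "i < r" for i k
        using g[of i] f(1) that p(2) by (auto simp: power_0_left)
      have D: "mat_diag r (\<lambda>i. g i ^ k) \<in> diag_group r" for k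
        unfolding diag_group_iff by (intro exI[of _ "\<lambda>i. g i ^ k"] conjI allI impI g0 refl)
      let ?u = "\<psi> (mat_diag r g)"
      have gD: "mat_diag r g \<in> diag_group r" using D[of 1] by simp
      have pw: "?u ^\<^sub>m Suc k = \<psi> (mat_diag r (\<lambda>i. g i ^ Suc k))" for k
      proof (induction k)
        case 0
        then show ?case using \<psi>D[OF gD] Tc by auto
      next
        case (Suc k)
        have "?u ^\<^sub>m Suc (Suc k) = ?u ^\<^sub>m Suc k * ?u" by simp
        also have "\<dots> = \<psi> (mat_diag r (\<lambda>i. g i ^ Suc k) * mat_diag r g)"
          unfolding Suc by (rule \<psi>m[OF D gD, symmetric])
        also have "mat_diag r (\<lambda>i. g i ^ Suc k) * mat_diag r g = mat_diag r (\<lambda>i. g i ^ Suc (Suc k))"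
          by (simp add: mult.commute mult.left_commute)
        finally show ?case .
      qed
      obtain k where "p = Suc k" using p(2) by (cases p) auto
      then have "?u ^\<^sub>m p = \<psi> (\<phi> t)" using pw[of k] g f(2) by simp
      then have "?u ^\<^sub>m p = t" unfolding \<psi>\<phi>[OF t] .
      then show ?thesis by (rule bexI[OF _ \<psi>D[OF gD]])
    qed
  qed (rule p)+
qed

section \<open>The composition factors of the projective cover\<close>

theorem proposition4p5:
  fixes p n m :: nat
    and G T :: "'k::alg_closed_field mat set"
    and \<hh> :: "('k, 'k mat) restricted_lie"
    and lam :: "'k mat \<Rightarrow> 'k"
    and U0 :: "((nat \<Rightarrow> 'k mat) list \<Rightarrow> 'k) set set ring"
    and K :: "(((nat \<Rightarrow> 'k mat) list \<Rightarrow> 'k) set set, 'v) module"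
    and Q :: "(((nat \<Rightarrow> 'k mat) list \<Rightarrow> 'k) set set, 'q) module"
    and \<pi> :: "'q \<Rightarrow> 'v"
  assumes "CHAR('k) = p" and "p > 0"
    and "standard_reductive p n G"
    and "maximal_torus n G T"
    and "\<hh> = lie_algebra p n T"
    and "m > 0"
    and "U0 = renv_alg p (current_lie p m \<hh>)"
    and "lam \<in> linear_forms \<hh>"
    and "\<And>h. h \<in> carrier \<hh> \<Longrightarrow> lam h ^ p = lam (p_map \<hh> h)"
    and "weight_module p m \<hh> lam K"
    and "projective_cover U0 Q \<pi> K"
  shows "(\<exists>l N. composition_series U0 Q l N) \<and>
         (\<forall>l N. composition_series U0 Q l N \<longrightarrow>
            (\<forall>i<l. module_iso U0 (comp_factor Q N i) K) \<and>
            card {i. i < l \<and> module_iso U0 (comp_factor Q N i) K}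
              = p ^ (m * vectorspace.dim class_ring \<hh>))"
proof -
  have torus: "torus n T" using assms(4) by (simp add: maximal_torus_def)
  interpret T: divisible_group n p T by (rule torus_divisible[OF torus assms(1,2)])
  have toral: "toral_lie p \<hh>" unfolding assms(5) by (rule T.LT_toral)
  obtain B where B: "finite B" "vectorspace.basis class_ring \<hh> B"
    using vectorspace.finite_basis_exists[OF T.LT_vectorspace T.LT_fin_dim]
    unfolding assms(5) by blast
  have basis: "toral_lie_basis p \<hh> B"
    by (intro toral_lie_basis.intro toral_lie_basis_axioms.intro toral B)
  have weight: "toral_weight p \<hh> B lam"
    using assms(8,9)
    by (intro toral_weight.intro toral_weight_axioms.intro basis)
       (auto simp: linear_forms_def LinearCombinations.module_hom_def class_ring_simps)
  interpret toral_cover p m \<hh> B lam K Q \<pi>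
    using assms(10,11) unfolding assms(7)
    by (intro toral_cover.intro toral_cover_axioms.intro weight)
  show ?thesis
  proof (intro conjI allI impI)
    show "\<exists>l N. composition_series U0 Q l N"
      unfolding assms(7) by (rule composition_series_exists)
  next
    fix l N i assume "composition_series U0 Q l N" "i < l"
    then show "module_iso U0 (comp_factor Q N i) K"
      unfolding assms(7) using composition_series_factors by blast
  next
    fix l N assume "composition_series U0 Q l N"
    then have iso: "\<forall>i<l. module_iso U0 (comp_factor Q N i) K" and l: "l = p ^ (m * card B)"
      unfolding assms(7) using composition_series_factors by blast+
    have "{i. i < l \<and> module_iso U0 (comp_factor Q N i) K} = {..<l}" using iso by auto
    then show "card {i. i < l \<and> module_iso U0 (comp_factor Q N i) K}
        = p ^ (m * vectorspace.dim class_ring \<hh>)"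
      using l card_B by simp
  qed
qed

end
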